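(* Let $\Sigma \subset \mathbb{R}^{n+1}$ be a complete properly immersed self-shrinker (of dimension $n$). Then there exists a cone $\mathcal{C}\subset\mathbb{R}^{n+1}$ generated by a compact subset of $\mathbb{S}^n$ such that $$\lambda \Sigma \to \mathcal{C} \quad \text{when } \lambda \to 0^+,$$ locally in the Hausdorff metric on closed sets. Moreover, in the case $n=2$, if the number of connected components of $S(0,r)\cap\Sigma$ is bounded above as $r\to\infty$, then $\mathcal{C}\cap\mathbb{S}^2$ has $2$-dimensional Lebesgue measure $0$.
   Context: A hypersurface $\Sigma\subset\mathbb{R}^{n+1}$ is a self-shrinker if it satisfies $H=\frac{\langle x,\nu\rangle}{2}$, where $\nu$ is the (outer) unit normal vector, $H=\operatorname{div}(\nu)$ is the mean curvature and $x$ is the position vector. For $\lambda>0$, $\lambda\Sigma=\{\lambda x: x\in\Sigma\}$. $S(0,r)$ is the sphere of radius $r$ centered at the origin of $\mathbb{R}^{n+1}$ and $\mathbb{S}^n=S(0,1)$. For a compact (possibly empty) subset $K\subset\mathbb{S}^n$, the cone generated by $K$ is $\{rx : r>0,\ x\in K\}\cup\{0\}\subset\mathbb{R}^{n+1}$. *)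

theory Defs
  imports "HOL-Analysis.Analysis"
begin

section \<open>Smooth maps and smooth manifolds\<close>

text \<open>For open \<open>S\<close> the following says that all iterated directional derivatives of order at
  most \<open>k\<close> exist and are continuous on \<open>S\<close>, that is, that \<open>f\<close> is of class \<open>C\<^sup>k\<close>.\<close>

primrec Ck_on :: "nat \<Rightarrow> 'a::real_normed_vector set \<Rightarrow> ('a \<Rightarrow> 'b::real_normed_vector) \<Rightarrow> bool" where
  "Ck_on 0 S f \<longleftrightarrow> continuous_on S f"
| "Ck_on (Suc k) S f \<longleftrightarrow>
     f differentiable_on S \<and> (\<forall>v. Ck_on k S (\<lambda>x. frechet_derivative f (at x) v))"

definition smooth_on :: "'a::real_normed_vector set \<Rightarrow> ('a \<Rightarrow> 'b::real_normed_vector) \<Rightarrow> bool" where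
  "smooth_on S f \<longleftrightarrow> (\<forall>k. Ck_on k S f)"

text \<open>An atlas is given by local parametrizations (inverse charts) \<open>(U, \<phi>)\<close>, with \<open>U\<close> open in
  Euclidean space and \<open>\<phi>\<close> a homeomorphism from \<open>U\<close> onto an open subset of \<open>M\<close>. The dimension of
  the manifold is \<open>CARD('n)\<close>. Manifolds have no boundary and need not be connected.\<close>

type_synonym ('n, 'p) atlas = "((real^'n) set \<times> (real^'n \<Rightarrow> 'p)) set"

definition smooth_atlas :: "'p topology \<Rightarrow> ('n::finite, 'p) atlas \<Rightarrow> bool" where
  "smooth_atlas M A \<longleftrightarrow>
     (\<forall>(U, \<phi>)\<in>A. open U \<and> openin M (\<phi> ` U) \<and>
        homeomorphic_map (top_of_set U) (subtopology M (\<phi> ` U)) \<phi>) \<and>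
     (\<Union>(U, \<phi>)\<in>A. \<phi> ` U) = topspace M \<and>
     (\<forall>(U, \<phi>)\<in>A. \<forall>(V, \<psi>)\<in>A. smooth_on {u \<in> U. \<phi> u \<in> \<psi> ` V} (the_inv_into V \<psi> \<circ> \<phi>))"

definition smooth_manifold :: "'p topology \<Rightarrow> ('n::finite, 'p) atlas \<Rightarrow> bool" where
  "smooth_manifold M A \<longleftrightarrow> Hausdorff_space M \<and> second_countable M \<and> smooth_atlas M A"

section \<open>Immersed hypersurfaces\<close>

definition smooth_immersion :: "('n::finite, 'p) atlas \<Rightarrow> ('p \<Rightarrow> real^'m::finite) \<Rightarrow> bool" where
  "smooth_immersion A F \<longleftrightarrow>
     (\<forall>(U, \<phi>)\<in>A. smooth_on U (F \<circ> \<phi>) \<and> (\<forall>u\<in>U. inj (frechet_derivative (F \<circ> \<phi>) (at u))))"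

text \<open>Geodesic distance of the metric induced by an immersion \<open>F\<close>: the infimum of the lengths of
  piecewise \<open>C\<^sup>1\<close> curves. As \<open>F\<close> is an immersion, a continuous curve \<open>c\<close> in \<open>M\<close> is piecewise
  \<open>C\<^sup>1\<close> iff \<open>F \<circ> c\<close> is, and its length in the induced metric is the Euclidean length of
  \<open>F \<circ> c\<close>. Points in different components have distance \<open>\<infinity>\<close>.\<close>

definition induced_dist :: "'p topology \<Rightarrow> ('p \<Rightarrow> real^'m::finite) \<Rightarrow> 'p \<Rightarrow> 'p \<Rightarrow> ennreal" where
  "induced_dist M F p q =
     (INF c \<in> {c. pathin M c \<and> (F \<circ> c) piecewise_C1_differentiable_on {0..1} \<and> c 0 = p \<and> c 1 = q}.
        \<integral>\<^sup>+t\<in>{0..1}. ennreal (norm (vector_derivative (F \<circ> c) (at t))) \<partial>lborel)"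

definition complete_immersion :: "'p topology \<Rightarrow> ('p \<Rightarrow> real^'m::finite) \<Rightarrow> bool" where
  "complete_immersion M F \<longleftrightarrow>
     (\<forall>s::nat \<Rightarrow> 'p. range s \<subseteq> topspace M \<and>
        (\<forall>e>0. \<exists>N. \<forall>i\<ge>N. \<forall>j\<ge>N. induced_dist M F (s i) (s j) < ennreal e) \<longrightarrow>
        (\<exists>p. limitin M s p sequentially))"

definition unit_normal_on ::
  "(real^'n::finite) set \<Rightarrow> (real^'n \<Rightarrow> real^'m::finite) \<Rightarrow> (real^'n \<Rightarrow> real^'m) \<Rightarrow> bool" where
  "unit_normal_on W X \<nu> \<longleftrightarrow> smooth_on W \<nu> \<and>
     (\<forall>u\<in>W. norm (\<nu> u) = 1 \<and> (\<forall>v. \<nu> u \<bullet> frechet_derivative X (at u) v = 0))"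

definition first_fundamental_form ::
  "(real^'n::finite \<Rightarrow> real^'m::finite) \<Rightarrow> real^'n \<Rightarrow> real^'n^'n" where
  "first_fundamental_form X u =
     (\<chi> i j. frechet_derivative X (at u) (axis i 1) \<bullet> frechet_derivative X (at u) (axis j 1))"

text \<open>\<open>H = div \<nu>\<close>, the tangential divergence of \<open>\<nu>\<close> along the hypersurface, which in local
  coordinates is the sum of \<open>g\<^sup>i\<^sup>j \<langle>\<partial>\<^sub>i\<nu>, \<partial>\<^sub>jX\<rangle>\<close> over \<open>i, j\<close>. With the outer normal, the sphere
  of radius \<open>r\<close> has \<open>H = n/r\<close>.\<close>

definition mean_curvature ::
  "(real^'n::finite \<Rightarrow> real^'m::finite) \<Rightarrow> (real^'n \<Rightarrow> real^'m) \<Rightarrow> real^'n \<Rightarrow> real" where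
  "mean_curvature X \<nu> u =
     (\<Sum>i\<in>UNIV. \<Sum>j\<in>UNIV. matrix_inv (first_fundamental_form X u) $ i $ j *
        (frechet_derivative \<nu> (at u) (axis i 1) \<bullet> frechet_derivative X (at u) (axis j 1)))"

text \<open>Both sides of \<open>H = \<langle>x, \<nu>\<rangle>/2\<close> change sign with \<open>\<nu>\<close>, so the equation does not depend on the
  choice of the unit normal, and a normal defined near each point suffices; no orientation of
  the immersed hypersurface is required.\<close>

definition self_shrinker :: "('n::finite, 'p) atlas \<Rightarrow> ('p \<Rightarrow> real^'m::finite) \<Rightarrow> bool" where
  "self_shrinker A F \<longleftrightarrow>
     (\<forall>(U, \<phi>)\<in>A. \<forall>u\<in>U. \<exists>W \<nu>. open W \<and> u \<in> W \<and> W \<subseteq> U \<and> unit_normal_on W (F \<circ> \<phi>) \<nu> \<and>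
        (\<forall>w\<in>W. mean_curvature (F \<circ> \<phi>) \<nu> w = ((F \<circ> \<phi>) w \<bullet> \<nu> w) / 2))"

section \<open>Cones, local Hausdorff convergence and Hausdorff measure\<close>

definition cone_generated :: "'a::real_vector set \<Rightarrow> 'a set" where
  "cone_generated K = {r *\<^sub>R x | r x. r > 0 \<and> x \<in> K} \<union> {0}"

text \<open>With values in \<open>ennreal\<close>, the distance of the empty set to a nonempty set is \<open>\<infinity>\<close>.\<close>

definition hausdorff_dist :: "'a::metric_space set \<Rightarrow> 'a set \<Rightarrow> ennreal" where
  "hausdorff_dist A B =
     sup (SUP x\<in>A. INF y\<in>B. ennreal (dist x y)) (SUP y\<in>B. INF x\<in>A. ennreal (dist x y))"

text \<open>Convergence of the intersections with every closed ball around the origin. For a limit that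
  is a cone with apex \<open>0\<close>, this agrees with convergence in the sense that for all \<open>R, \<epsilon> > 0\<close>
  eventually \<open>S t \<inter> cball 0 R\<close> lies in the \<open>\<epsilon>\<close>-neighbourhood of \<open>C\<close> and \<open>C \<inter> cball 0 R\<close> in that
  of \<open>S t\<close>.\<close>

definition locally_hausdorff_tendsto ::
  "('t \<Rightarrow> 'a::real_normed_vector set) \<Rightarrow> 'a set \<Rightarrow> 't filter \<Rightarrow> bool" where
  "locally_hausdorff_tendsto S C \<F> \<longleftrightarrow>
     (\<forall>R>0. ((\<lambda>t. hausdorff_dist (S t \<inter> cball 0 R) (C \<inter> cball 0 R)) \<longlongrightarrow> 0) \<F>)"

text \<open>\<open>k\<close>-dimensional Hausdorff (outer) measure for \<open>k \<ge> 1\<close>, normalized so that on \<open>k\<close>-dimensional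
  submanifolds of Euclidean space it is the \<open>k\<close>-dimensional Lebesgue (Riemannian) measure.\<close>

definition hausdorff_measure :: "nat \<Rightarrow> 'a::metric_space set \<Rightarrow> ennreal" where
  "hausdorff_measure k A =
     (SUP \<delta>\<in>{0<..}. INF E \<in> {E :: nat \<Rightarrow> 'a set.
         A \<subseteq> (\<Union>i. E i) \<and> (\<forall>i. bounded (E i) \<and> diameter (E i) \<le> (\<delta>::real))}.
       \<Sum>i. ennreal (unit_ball_vol (real k) * (diameter (E i) / 2) ^ k))"

end

theory Submission
  imports Defs
begin

text \<open>
  At a minimum on the self-shrinker \<open>\<Sigma>\<close> of a quadratic function \<open>V\<close> the trace of the Hessian of
  \<open>V\<close> over the tangent space is at least \<open>x \<bullet> \<nabla>V / 2\<close>. For \<open>V(x) = \<bar>\<lambda>x - y\<bar>\<^sup>2\<close> this says that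
  \<open>dist(y, \<lambda>\<Sigma>)\<^sup>2 - 2n\<lambda>\<^sup>2\<close> is nonincreasing in \<open>\<lambda>\<close> (avoidance of shrinking spheres). Hence every
  limit point \<open>y\<close> of \<open>\<lambda>\<Sigma>\<close> as \<open>\<lambda> \<rightarrow> 0\<close> satisfies \<open>dist(y, \<lambda>\<Sigma>) \<le> \<lambda>\<surd>(2n)\<close> for all \<open>\<lambda>\<close>, and
  the limit points form a closed cone to which \<open>\<lambda>\<Sigma>\<close> converges locally.

  Let \<open>n = 2\<close>. With \<open>V\<close> a combination of the squared distances to the origin and to the ray
  through \<open>y\<close>, the minimum principle shows that \<open>\<Sigma> \<inter> S(0,r)\<close> comes within distance about \<open>3\<close> of
  \<open>ry\<close> for all \<open>y\<close> in the link \<open>K\<close> and all large \<open>r\<close>. Take points of \<open>K\<close> separated by more than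
  \<open>12/r\<close>. If there are at most \<open>N\<close> components, then for all but \<open>N\<close> of these points the slice
  \<open>\<Sigma> \<inter> S(0,r)\<close> runs from distance \<open>3\<close> to distance \<open>4\<close> of the ray, so it contributes a definite
  length. Integrated over \<open>R \<le> r \<le> 2R\<close>, this is at least a constant times \<open>R\<close> per point. As \<open>\<Sigma>\<close> has
  quadratic area growth, there are only \<open>O(R)\<close> such points, and \<open>K\<close> has measure \<open>0\<close>. The area
  growth follows from the first variation formula for a suitable field \<open>\<Psi>(\<bar>x\<bar>\<^sup>2) x\<close>.
\<close>

section \<open>The second order condition at a minimum on a self-shrinker\<close>

text \<open>For the cone, the surface enters only as a closed set with the second order condition,
  tested against all nearby points of the set; overlapping sheets of the immersion therefore cause
  no difficulty there. They matter for the area growth: the first variation must be summed over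
  sheets with multiplicity. It is obtained by cutting the field, in the ambient space, into fields
  supported in small balls whose preimages are finitely many disjoint sheets. The count behind the
  last claim is done in the plane: \<open>z\<close> is mapped to the squares of its distances to the
  origin and to the ray. At each radius, the images of the tubes between distances 3 and 4 contain,
  for all but \<open>N\<close> points, a vertical interval of length 16 - 9 = 7, over a base of
  length 4R^2 - R^2 = 3R^2. The Jacobian of the map is at most 32R times the area element, and the
  tubes of separated points are disjoint. Hence 21R^2 (number of points - N) is at most 32R times an
  area of order R^2. The points number O(R) and the covering balls have radius 12/R, so the total
  content is O(1/R).\<close>

lemma orthonormal_frame:
  fixes L :: "real^'n::finite \<Rightarrow> real^'m::finite"
  assumes "linear L" "inj L"
  obtains w :: "'n \<Rightarrow> real^'n" where "\<And>k l. L (w k) \<bullet> L (w l) = (if k = l then 1 else 0)"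
proof -
  have "subspace (range L)"
    using assms(1) by (simp add: linear_subspace_image)
  then obtain B where B: "B \<subseteq> range L" "pairwise orthogonal B" "\<And>x. x \<in> B \<Longrightarrow> norm x = 1"
    "independent B" "card B = dim (range L)"
    by (metis orthonormal_basis_subspace)
  have "dim (range L) = CARD('n)"
    using dim_image_eq[OF assms(1), of UNIV] assms(2) by (simp add: dim_UNIV)
  then obtain b where b: "bij_betw b (UNIV::'n set) B"
    using B(4,5) by (metis finite_class.finite_UNIV finiteI_independent finite_same_card_bij)
  define w where "w k = inv L (b k)" for k
  have "L (w k) = b k" for k
    unfolding w_def using b B(1) by (meson bij_betwE UNIV_I f_inv_into_f subsetD)
  moreover have "b k \<bullet> b l = (if k = l then 1 else 0)" for k l
  proof (cases "k = l")
    case True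
    then show ?thesis
      using B(3)[of "b k"] b by (metis bij_betwE UNIV_I norm_eq_1)
  next
    case False
    then have "b k \<noteq> b l" "b k \<in> B" "b l \<in> B"
      using b by (auto simp: bij_betw_def inj_on_def)
    then show ?thesis
      using B(2) False by (auto simp: pairwise_def orthogonal_def)
  qed
  ultimately show ?thesis
    using that by metis
qed

lemma matrix_inv_eqI:
  fixes A B :: "real^'n^'n"
  assumes "A ** B = mat 1"
  shows "matrix_inv A = B"
proof -
  have "A ** B = mat 1 \<and> B ** A = mat 1"
    using assms matrix_left_right_inverse by blast
  then have "A ** matrix_inv A = mat 1 \<and> matrix_inv A ** A = mat 1"
    unfolding matrix_inv_def by (rule someI)
  then show ?thesis
    by (metis assms matrix_mul_assoc matrix_mul_lid matrix_mul_rid)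
qed

text \<open>With the frame as rows of \<open>P\<close>, orthonormality reads
  \<open>P g P^T = 1\<close>, so \<open>g^-1 = P^T P\<close> and the trace with respect to
  \<open>g\<close> becomes a sum over the frame.\<close>

lemma mean_curvature_frame:
  fixes X \<nu> :: "real^'n::finite \<Rightarrow> real^'m::finite"
  assumes X: "linear (frechet_derivative X (at u))" and N: "linear (frechet_derivative \<nu> (at u))"
    and w: "\<And>k l::'n. frechet_derivative X (at u) (w k) \<bullet> frechet_derivative X (at u) (w l)
               = (if k = l then 1 else 0)"
  shows "mean_curvature X \<nu> u =
    (\<Sum>k\<in>UNIV. frechet_derivative \<nu> (at u) (w k) \<bullet> frechet_derivative X (at u) (w k))"
proof -
  define L where "L = frechet_derivative X (at u)"
  define D where "D = frechet_derivative \<nu> (at u)"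
  define P :: "real^'n^'n" where "P = (\<chi> k i. w k $ i)"
  let ?g = "first_fundamental_form X u"
  have expand: "w k = (\<Sum>i\<in>UNIV. w k $ i *\<^sub>R axis i 1)" for k
    by (simp add: basis_expansion flip: scalar_mult_eq_scaleR)
  have Lw: "L (w k) = (\<Sum>i\<in>UNIV. w k $ i *\<^sub>R L (axis i 1))" for k
    by (subst expand) (simp add: L_def linear_sum[OF X] linear_cmul[OF X])
  have Dw: "D (w k) = (\<Sum>i\<in>UNIV. w k $ i *\<^sub>R D (axis i 1))" for k
    by (subst expand) (simp add: D_def linear_sum[OF N] linear_cmul[OF N])
  have "(P ** (?g ** transpose P)) $ k $ l = L (w k) \<bullet> L (w l)" for k l
    unfolding Lw by (simp add: matrix_matrix_mult_def P_def first_fundamental_form_def transpose_def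
        inner_sum_left inner_sum_right sum_distrib_left L_def mult_ac) (rule sum.swap)
  then have "P ** (?g ** transpose P) = mat 1"
    using w by (simp add: vec_eq_iff mat_def L_def)
  then have "(?g ** transpose P) ** P = mat 1"
    using matrix_left_right_inverse by blast
  then have inv: "matrix_inv ?g = transpose P ** P"
    by (intro matrix_inv_eqI) (simp add: matrix_mul_assoc)
  have "mean_curvature X \<nu> u =
      (\<Sum>i\<in>UNIV. \<Sum>j\<in>UNIV. (\<Sum>k\<in>UNIV. w k $ i * w k $ j) * (D (axis i 1) \<bullet> L (axis j 1)))"
    unfolding mean_curvature_def inv
    by (simp add: matrix_matrix_mult_def transpose_def P_def D_def L_def)
  also have "\<dots> = (\<Sum>i\<in>UNIV. \<Sum>j\<in>UNIV. \<Sum>k\<in>UNIV. w k $ i * w k $ j * (D (axis i 1) \<bullet> L (axis j 1)))"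
    by (simp add: sum_distrib_right)
  also have "\<dots> = (\<Sum>i\<in>UNIV. \<Sum>k\<in>UNIV. \<Sum>j\<in>UNIV. w k $ i * w k $ j * (D (axis i 1) \<bullet> L (axis j 1)))"
    by (rule sum.cong[OF refl], rule sum.swap)
  also have "\<dots> = (\<Sum>k\<in>UNIV. \<Sum>i\<in>UNIV. \<Sum>j\<in>UNIV. w k $ i * w k $ j * (D (axis i 1) \<bullet> L (axis j 1)))"
    by (rule sum.swap)
  also have "\<dots> = (\<Sum>k\<in>UNIV. D (w k) \<bullet> L (w k))"
    unfolding Lw Dw
    by (simp add: inner_sum_left inner_sum_right sum_distrib_left mult_ac)
      (rule sum.cong[OF refl], rule trans[OF sum.swap], simp add: mult_ac)
  finally show ?thesis by (simp add: D_def L_def)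
qed

text \<open>Codimension one: the tangent frame and the normal are \<open>CARD('m)\<close>
  orthonormal vectors, hence they span, and only the normal component of \<open>z\<close>
  survives.\<close>

lemma normal_parallel:
  fixes e :: "'n::finite \<Rightarrow> real^'m::finite"
  assumes dim: "CARD('m) = CARD('n) + 1"
    and e: "\<And>k l. e k \<bullet> e l = (if k = l then 1 else 0)"
    and N: "norm N = 1" "\<And>k. N \<bullet> e k = 0" and z: "\<And>k. z \<bullet> e k = 0"
  shows "z = (z \<bullet> N) *\<^sub>R N"
proof -
  let ?B = "insert N (range e)"
  have "e k \<noteq> e l" if "k \<noteq> l" for k l
    using e[of k l] e[of k k] that by auto
  then have inj: "inj e" by (meson injI)
  have notin: "N \<notin> range e"
    using N e by (metis imageE norm_eq_1 zero_neq_one)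
  have orth: "pairwise orthogonal ?B"
    using e N by (auto simp: pairwise_def orthogonal_def inner_commute)
  have "0 \<notin> ?B"
    using N(1) e by (metis image_iff inner_zero_left insert_iff norm_zero zero_neq_one)
  then have indep: "independent ?B"
    using orth pairwise_orthogonal_independent by blast
  have "card ?B = DIM(real^'m)"
    using inj notin dim by (simp add: card_image)
  then have span: "span ?B = UNIV"
    using indep by (metis card_ge_dim_independent dim_UNIV order_refl subset_UNIV top.extremum_uniqueI)
  define y where "y = z - (z \<bullet> N) *\<^sub>R N"
  have "orthogonal y x" if "x \<in> ?B" for x
    using that z N e unfolding y_def orthogonal_def
    by (auto simp: inner_diff_left inner_diff_right norm_eq_1)
  then have "orthogonal y y"
    using orthogonal_to_span span by blast
  then show ?thesis
    by (simp add: orthogonal_self y_def)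
qed

text \<open>If \<open>g'' < 0\<close>, then \<open>g'\<close> is negative just to the right of 0,
  and the mean value theorem gives a smaller value of \<open>g\<close> there.\<close>

lemma second_derivative_nonneg_at_local_min:
  fixes g :: "real \<Rightarrow> real"
  assumes d: "0 < d" and der: "\<And>t. \<bar>t\<bar> < d \<Longrightarrow> (g has_real_derivative g' t) (at t)"
    and der2: "(g' has_real_derivative g'') (at 0)"
    and min: "\<And>t. \<bar>t\<bar> < d \<Longrightarrow> g 0 \<le> g t"
  shows "g' 0 = 0" "g'' \<ge> 0"
proof -
  show 0: "g' 0 = 0"
    using DERIV_local_min[OF der[of 0] d] min d by simp
  show "g'' \<ge> 0"
  proof (rule ccontr)
    assume "\<not> ?thesis"
    then obtain e where e: "e > 0" "\<And>h. h > 0 \<Longrightarrow> h < e \<Longrightarrow> g' h < 0"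
      using DERIV_neg_dec_right[OF der2] 0 by auto
    define t where "t = min d e / 2"
    have t: "0 < t" "t < d" "t < e"
      using d e(1) by (auto simp: t_def)
    have "\<exists>z. 0 < z \<and> z < t \<and> g t - g 0 = (t - 0) * g' z"
      using t by (intro MVT2 der) auto
    then obtain z where z: "0 < z" "z < t" "g t - g 0 = t * g' z" by auto
    have "t * g' z < 0"
      using z t e(2) by (intro mult_pos_neg) auto
    then show False
      using z min[of t] t by auto
  qed
qed

lemma Ck_on_2D:
  assumes "Ck_on (Suc (Suc 0)) S X" "open S" "x \<in> S"
  shows "(X has_derivative frechet_derivative X (at x)) (at x)"
    and "((\<lambda>x. frechet_derivative X (at x) v) has_derivative
          frechet_derivative (\<lambda>x. frechet_derivative X (at x) v) (at x)) (at x)"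
    and "continuous_on S (\<lambda>x. frechet_derivative (\<lambda>x. frechet_derivative X (at x) v) (at x) w)"
  using assms by (auto simp: differentiable_on_eq_differentiable_at frechet_derivative_works)

lemma has_derivative_line:
  assumes "(X has_derivative D) (at (u + t *\<^sub>R w))"
  shows "((\<lambda>t. X (u + t *\<^sub>R w)) has_vector_derivative D w) (at t)"
proof -
  have "((\<lambda>t. u + t *\<^sub>R w) has_derivative (\<lambda>h. h *\<^sub>R w)) (at t)"
    by (auto intro!: derivative_eq_intros)
  from has_derivative_compose[OF this assms]
  have "((\<lambda>t. X (u + t *\<^sub>R w)) has_derivative (\<lambda>h. D (h *\<^sub>R w))) (at t)" .
  moreover have "D (h *\<^sub>R w) = h *\<^sub>R D w" for h
    using assms has_derivative_linear linear_cmul by blast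
  ultimately show ?thesis
    by (simp add: has_vector_derivative_def)
qed

text \<open>At a minimum the Hessian of \<open>V\<close> along the tangent directions, corrected by the curvature
  term \<open>H \<nu> \<bullet> \<nabla>V = x \<bullet> \<nabla>V / 2\<close>, is nonnegative; here \<open>V\<close> is quadratic.\<close>

lemma shrinker_local_min:
  fixes X \<nu> :: "real^'n::finite \<Rightarrow> real^'m::finite" and c p :: "real^'m" and \<alpha> \<beta> :: real
  defines "V \<equiv> \<lambda>x. \<alpha> * (x \<bullet> x) - \<beta> * (x \<bullet> p)\<^sup>2 + c \<bullet> x"
  assumes dim: "CARD('m) = CARD('n) + 1" and W: "open W" "u \<in> W"
    and X: "Ck_on (Suc (Suc 0)) W X" "inj (frechet_derivative X (at u))"
    and \<nu>: "unit_normal_on W X \<nu>" and H: "mean_curvature X \<nu> u = (X u \<bullet> \<nu> u) / 2"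
    and \<beta>: "\<beta> \<ge> 0" and min: "\<And>w. w \<in> W \<Longrightarrow> V (X u) \<le> V (X w)"
  shows "\<alpha> * (X u \<bullet> X u) - \<beta> * (X u \<bullet> p)\<^sup>2 + (c \<bullet> X u) / 2 \<le> 2 * real CARD('n) * \<alpha>"
proof -
  define L where "L = frechet_derivative X (at u)"
  define x where "x = X u"
  \<comment> \<open>\<open>G\<close> is the gradient of \<open>V\<close> at
    \<open>x\<close>.\<close>
  define G where "G = (2 * \<alpha>) *\<^sub>R x - (2 * \<beta> * (x \<bullet> p)) *\<^sub>R p + c"
  have \<nu>1: "Ck_on (Suc 0) W \<nu>" "norm (\<nu> u) = 1" "\<And>y v. y \<in> W \<Longrightarrow> \<nu> y \<bullet> frechet_derivative X (at y) v = 0"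
    using \<nu> W by (auto simp: unit_normal_on_def smooth_on_def)
  note dX = Ck_on_2D[OF X(1) W(1)]
  have dN: "(\<nu> has_derivative frechet_derivative \<nu> (at u)) (at u)"
    using \<nu>1(1) W by (auto simp: differentiable_on_eq_differentiable_at frechet_derivative_works)
  have "linear L"
    using dX(1)[OF W(2)] by (simp add: L_def has_derivative_linear)
  then obtain w :: "'n \<Rightarrow> real^'n" where w: "\<And>k l. L (w k) \<bullet> L (w l) = (if k = l then 1 else 0)"
    using orthonormal_frame[of L] X(2) by (auto simp: L_def)
  obtain e0 where e0: "e0 > 0" "ball u e0 \<subseteq> W"
    using W openE by blast
  define D2 where "D2 k = frechet_derivative (\<lambda>x. frechet_derivative X (at x) (w k)) (at u) (w k)" for k
  \<comment> \<open>Along the parameter line in direction \<open>w k\<close>: the first order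
    condition, the second order condition with the \<beta>-term discarded by its sign, and the
    derivative of the identity \<open>\<nu> \<bullet> dX = 0\<close>, which ties the normal part of
    the acceleration to the derivative of \<open>\<nu>\<close>.\<close>
  have key: "G \<bullet> L (w k) = 0 \<and> 0 \<le> 2 * \<alpha> + G \<bullet> D2 k \<and>
      D2 k \<bullet> \<nu> u = - (frechet_derivative \<nu> (at u) (w k) \<bullet> L (w k))" for k
  proof -
    define d where "d = e0 / (norm (w k) + 1)"
    have d: "d > 0" using e0(1) by (simp add: d_def add_nonneg_pos)
    have inW: "u + t *\<^sub>R w k \<in> W" if "\<bar>t\<bar> < d" for t
    proof -
      have "\<bar>t\<bar> * norm (w k) \<le> \<bar>t\<bar> * (norm (w k) + 1)" by (intro mult_left_mono) auto
      also have "\<dots> < e0"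
        using that by (simp add: d_def pos_less_divide_eq add_nonneg_pos)
      finally show ?thesis using e0(2) by (auto simp: subset_iff dist_norm)
    qed
    define Y where "Y t = X (u + t *\<^sub>R w k)" for t
    define Y' where "Y' t = frechet_derivative X (at (u + t *\<^sub>R w k)) (w k)" for t
    have Y: "(Y has_vector_derivative Y' t) (at t)" if "\<bar>t\<bar> < d" for t
      unfolding Y_def Y'_def by (intro has_derivative_line dX(1) inW that)
    have Y'2: "(Y' has_vector_derivative D2 k) (at 0)"
      unfolding Y'_def D2_def
      by (rule has_derivative_line[where t=0, simplified]) (use dX(2)[OF W(2)] in simp)
    have N: "((\<lambda>t. \<nu> (u + t *\<^sub>R w k)) has_vector_derivative frechet_derivative \<nu> (at u) (w k)) (at 0)"
      by (rule has_derivative_line[where t=0, simplified]) (use dN in simp)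
    have Y0: "Y 0 = x" "Y' 0 = L (w k)" by (simp_all add: Y_def Y'_def x_def L_def)
    define g' where "g' t = 2 * \<alpha> * (Y t \<bullet> Y' t) - 2 * \<beta> * (Y t \<bullet> p) * (Y' t \<bullet> p) + c \<bullet> Y' t" for t
    have 1: "((\<lambda>t. V (Y t)) has_real_derivative g' t) (at t)" if "\<bar>t\<bar> < d" for t
      using Y[OF that] unfolding V_def g'_def has_vector_derivative_def has_field_derivative_def
      by (auto intro!: derivative_eq_intros simp: fun_eq_iff algebra_simps inner_commute power2_eq_square)
    have 2: "(g' has_real_derivative (2 * \<alpha> * (L (w k) \<bullet> L (w k)) + 2 * \<alpha> * (x \<bullet> D2 k)
         - 2 * \<beta> * (L (w k) \<bullet> p)\<^sup>2 - 2 * \<beta> * (x \<bullet> p) * (D2 k \<bullet> p) + c \<bullet> D2 k)) (at 0)"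
      using Y[of 0] Y'2 d unfolding g'_def has_vector_derivative_def has_field_derivative_def Y0[symmetric]
      by (auto intro!: derivative_eq_intros simp: fun_eq_iff algebra_simps inner_commute power2_eq_square)
    have 3: "V (Y 0) \<le> V (Y t)" if "\<bar>t\<bar> < d" for t
      using min[OF inW[OF that]] by (simp add: Y_def)
    note sd = second_derivative_nonneg_at_local_min[OF d 1 2 3]
    have "g' 0 = 0" using sd(1) by blast
    then have "G \<bullet> L (w k) = 0"
      by (simp add: g'_def Y0 G_def inner_add_left inner_diff_left inner_commute[of _ p])
    moreover have "0 \<le> 2 * \<alpha> + G \<bullet> D2 k"
    proof -
      have "0 \<le> 2 * \<beta> * (L (w k) \<bullet> p)\<^sup>2" using \<beta> by simp
      with sd(2) show ?thesis
        using w[of k k] by (simp add: G_def inner_add_left inner_diff_left inner_commute[of _ p])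
    qed
    moreover
    have "((\<lambda>t. \<nu> (u + t *\<^sub>R w k) \<bullet> Y' t) has_real_derivative
        (\<nu> u \<bullet> D2 k + frechet_derivative \<nu> (at u) (w k) \<bullet> L (w k))) (at 0)"
      using N Y'2 unfolding has_vector_derivative_def has_field_derivative_def Y0[symmetric]
      by (auto intro!: derivative_eq_intros simp: fun_eq_iff algebra_simps)
    moreover have "((\<lambda>t. \<nu> (u + t *\<^sub>R w k) \<bullet> Y' t) has_real_derivative 0) (at 0)"
    proof (rule has_field_derivative_transform_within[OF DERIV_const d])
      show "0 = \<nu> (u + t *\<^sub>R w k) \<bullet> Y' t" if "t \<in> UNIV" "dist t 0 < d" for t
        using \<nu>1(3)[OF inW] that by (simp add: Y'_def)
    qed simp
    ultimately show ?thesis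
      using DERIV_unique by (fastforce simp: inner_commute)
  qed
  have "linear (frechet_derivative \<nu> (at u))"
    using dN by (simp add: has_derivative_linear)
  then have "(\<Sum>k\<in>UNIV. frechet_derivative \<nu> (at u) (w k) \<bullet> L (w k)) = (x \<bullet> \<nu> u) / 2"
    using mean_curvature_frame[of X u \<nu> w] H w \<open>linear L\<close> by (simp add: L_def x_def)
  moreover have G: "G = (G \<bullet> \<nu> u) *\<^sub>R \<nu> u"
    using normal_parallel[OF dim, of "\<lambda>k. L (w k)"] w \<nu>1 key W(2) by (simp add: L_def)
  moreover have "G \<bullet> D2 k = - (G \<bullet> \<nu> u) * (frechet_derivative \<nu> (at u) (w k) \<bullet> L (w k))" for k
    by (subst G) (use key in \<open>simp add: inner_commute\<close>)
  \<comment> \<open>\<open>G\<close> is normal, so the accelerations enter the sum only through the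
    mean curvature, and \<open>H = x \<bullet> \<nu> / 2\<close> turns the sum into
    \<open>- x \<bullet> G / 2\<close>.\<close>
  ultimately have "(\<Sum>k\<in>UNIV. G \<bullet> D2 k) = - (G \<bullet> \<nu> u) * ((x \<bullet> \<nu> u) / 2)"
    by (simp add: sum_negf flip: sum_distrib_left)
  also have "\<dots> = - (x \<bullet> G) / 2"
    by (subst (2) G) simp
  finally have "0 \<le> (\<Sum>k\<in>(UNIV::'n set). 2 * \<alpha>) - (x \<bullet> G) / 2"
    using sum_nonneg[of UNIV "\<lambda>k. 2 * \<alpha> + G \<bullet> D2 k"] key by (simp add: sum.distrib)
  then show ?thesis
    by (simp add: G_def x_def inner_add_right inner_diff_right inner_commute power2_eq_square
        field_simps)
qed

section \<open>The asymptotic cone\<close>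

lemma hausdorff_dist_le:
  assumes e: "e \<ge> 0" and "\<And>x. x \<in> A \<Longrightarrow> \<exists>y\<in>B. dist x y \<le> e" "\<And>y. y \<in> B \<Longrightarrow> \<exists>x\<in>A. dist x y \<le> e"
  shows "hausdorff_dist A B \<le> ennreal e"
  unfolding hausdorff_dist_def
proof (intro sup_least SUP_least)
  fix x assume "x \<in> A"
  then obtain y where "y \<in> B" "dist x y \<le> e" using assms by blast
  then show "(INF y\<in>B. ennreal (dist x y)) \<le> ennreal e"
    by (intro INF_lower2[of y]) (auto intro: ennreal_leI)
next
  fix y assume "y \<in> B"
  then obtain x where "x \<in> A" "dist x y \<le> e" using assms by blast
  then show "(INF x\<in>A. ennreal (dist x y)) \<le> ennreal e"
    by (intro INF_lower2[of x]) (auto intro: ennreal_leI)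
qed

text \<open>What the cone construction uses of the surface; \<open>D\<close> stands for the
  dimension. Minimality is tested against all nearby points of the set, so it holds on every sheet
  through the point. The test functions with \<beta> = 0 include squared distances to points, those
  with \<beta> > 0 squared distances to lines through the origin.\<close>

locale shrinker_set =
  fixes \<Sigma> :: "'a::euclidean_space set" and D :: real
  assumes closed: "closed \<Sigma>" and nonempty: "\<Sigma> \<noteq> {}" and D: "D > 0"
    and local_min: "\<And>\<alpha> \<beta> c p x d. \<lbrakk>\<beta> \<ge> 0; x \<in> \<Sigma>; d > 0;
      \<And>z. z \<in> \<Sigma> \<Longrightarrow> dist x z < d \<Longrightarrow> \<alpha> * (x \<bullet> x) - \<beta> * (x \<bullet> p)\<^sup>2 + c \<bullet> x
                                    \<le> \<alpha> * (z \<bullet> z) - \<beta> * (z \<bullet> p)\<^sup>2 + c \<bullet> z\<rbrakk>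
      \<Longrightarrow> \<alpha> * (x \<bullet> x) - \<beta> * (x \<bullet> p)\<^sup>2 + (c \<bullet> x) / 2 \<le> 2 * D * \<alpha>"
begin

section \<open>Monotonicity of the distance to the rescaled sets\<close>

definition "scaled l = (*\<^sub>R) l ` \<Sigma>"

lemma scaled_nonempty: "scaled l \<noteq> {}"
  using nonempty by (simp add: scaled_def)

lemma closed_scaled: "closed (scaled l)"
  unfolding scaled_def by (intro closed_scaling closed)

lemma nearest:
  obtains x where "x \<in> \<Sigma>" "infdist y (scaled l) = norm (l *\<^sub>R x - y)"
proof -
  obtain z where "z \<in> scaled l" "infdist y (scaled l) = dist y z"
    using infdist_attains_inf[OF closed_scaled scaled_nonempty] by metis
  then show ?thesis
    using that by (auto simp: scaled_def dist_norm norm_minus_commute)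
qed

lemma infdist_scaled_le:
  assumes "x \<in> \<Sigma>"
  shows "infdist y (scaled l) \<le> norm (l *\<^sub>R x - y)"
  using assms infdist_le[of "l *\<^sub>R x" "scaled l" y]
  by (auto simp: scaled_def dist_norm norm_minus_commute)

text \<open>The second order condition for the test function \<open>|l z - y|^2\<close>. The left
  side is half the derivative in \<open>l\<close> of \<open>|l x - y|^2\<close> at fixed
  \<open>x\<close>, the right side half the derivative of \<open>2 D l^2\<close>.\<close>

lemma nearest_inner_le:
  assumes l: "l > 0" and x: "x \<in> \<Sigma>" "infdist y (scaled l) = norm (l *\<^sub>R x - y)"
  shows "(l *\<^sub>R x - y) \<bullet> x \<le> 2 * D * l"
proof -
  have expand: "(norm (l *\<^sub>R z - y))\<^sup>2 = l\<^sup>2 * (z \<bullet> z) - 0 * (z \<bullet> 0)\<^sup>2 + ((-2 * l) *\<^sub>R y) \<bullet> z + y \<bullet> y" for z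
    unfolding power2_norm_eq_inner
    by (simp add: inner_diff_left inner_diff_right inner_commute power2_eq_square algebra_simps)
  have "l\<^sup>2 * (x \<bullet> x) - 0 * (x \<bullet> 0)\<^sup>2 + (((-2 * l) *\<^sub>R y) \<bullet> x) / 2 \<le> 2 * D * l\<^sup>2"
  proof (rule local_min[of _ _ 1])
    fix z assume "z \<in> \<Sigma>"
    then have "norm (l *\<^sub>R x - y) \<le> norm (l *\<^sub>R z - y)"
      using infdist_scaled_le x(2) by metis
    then have "(norm (l *\<^sub>R x - y))\<^sup>2 \<le> (norm (l *\<^sub>R z - y))\<^sup>2"
      by (rule power_mono) simp
    then show "l\<^sup>2 * (x \<bullet> x) - 0 * (x \<bullet> 0)\<^sup>2 + ((-2 * l) *\<^sub>R y) \<bullet> x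
        \<le> l\<^sup>2 * (z \<bullet> z) - 0 * (z \<bullet> 0)\<^sup>2 + ((-2 * l) *\<^sub>R y) \<bullet> z"
      unfolding expand by linarith
  qed (use x in auto)
  then have "l * ((l *\<^sub>R x - y) \<bullet> x) \<le> l * (2 * D * l)"
    by (simp add: inner_diff_left algebra_simps power2_eq_square inner_commute)
  then show ?thesis using l by simp
qed

definition "defect y l = (infdist y (scaled l))\<^sup>2 - 2 * D * l\<^sup>2"

text \<open>The point nearest to \<open>y\<close> at scale \<open>l\<close> serves as a competitor
  at scale \<open>m\<close>. The distance may fail to be differentiable in the scale, so the
  estimate is kept as a one-sided inequality with a quadratic error.\<close>

lemma defect_step:
  assumes "0 < a" "a \<le> l" "l \<le> m" "m \<le> b"
  obtains x where "x \<in> \<Sigma>" "infdist y (scaled l) = norm (l *\<^sub>R x - y)"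
    "defect y m \<le> defect y l + (norm x)\<^sup>2 * (m - l)\<^sup>2"
proof -
  obtain x where x: "x \<in> \<Sigma>" "infdist y (scaled l) = norm (l *\<^sub>R x - y)"
    using nearest by blast
  have le: "(l *\<^sub>R x - y) \<bullet> x \<le> 2 * D * l"
    using nearest_inner_le x assms by simp
  have "(infdist y (scaled m))\<^sup>2 \<le> (norm (m *\<^sub>R x - y))\<^sup>2"
    by (intro power_mono infdist_scaled_le x infdist_nonneg)
  also have "\<dots> = (norm (l *\<^sub>R x - y))\<^sup>2 + 2 * (m - l) * ((l *\<^sub>R x - y) \<bullet> x) + (m - l)\<^sup>2 * (norm x)\<^sup>2"
    unfolding power2_norm_eq_inner
    by (simp add: inner_diff_left inner_diff_right inner_commute power2_eq_square algebra_simps)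
  also have "\<dots> \<le> (norm (l *\<^sub>R x - y))\<^sup>2 + 2 * (m - l) * (2 * D * l) + (m - l)\<^sup>2 * (norm x)\<^sup>2"
    using le assms by (intro add_mono mult_left_mono order_refl) auto
  finally have 1: "(infdist y (scaled m))\<^sup>2 \<le> \<dots>" .
  have "2 * D * m\<^sup>2 = 2 * D * l\<^sup>2 + 2 * (m - l) * (2 * D * l) + 2 * D * (m - l)\<^sup>2"
    by (simp add: power2_eq_square algebra_simps)
  moreover have "0 \<le> 2 * D * (m - l)\<^sup>2" using D by simp
  ultimately have "defect y m \<le> defect y l + (norm x)\<^sup>2 * (m - l)\<^sup>2"
    using 1 x(2) by (simp add: defect_def mult.commute)
  with x show ?thesis using that by blast
qed

end

text \<open>The quadratic error is harmless: it is summed over \<open>k\<close> steps of length \<open>(b - a) / k\<close>.\<close>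

lemma quadratic_error_imp_le:
  fixes h :: "real \<Rightarrow> real"
  assumes ab: "a \<le> b" and C: "\<And>l m. a \<le> l \<Longrightarrow> l \<le> m \<Longrightarrow> m \<le> b \<Longrightarrow> h m \<le> h l + C * (m - l)\<^sup>2"
  shows "h b \<le> h a"
proof -
  have step: "h b \<le> h a + C * (b - a)\<^sup>2 / real (Suc n)" for n
  proof -
    define k where "k = real (Suc n)"
    define t where "t i = a + real i * ((b - a) / k)" for i
    have k: "k > 0" by (simp add: k_def)
    have "h (t i) \<le> h a + real i * (C * ((b - a) / k)\<^sup>2)" if "i \<le> Suc n" for i
      using that
    proof (induction i)
      case 0
      then show ?case by (simp add: t_def)
    next
      case (Suc i)
      have "real (Suc i) * ((b - a) / k) \<le> k * ((b - a) / k)"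
        using Suc.prems ab k by (intro mult_right_mono) (auto simp: k_def)
      then have "t (Suc i) \<le> b" using k by (simp add: t_def)
      moreover have "a \<le> t i" "t i \<le> t (Suc i)"
        using ab k by (auto simp: t_def intro!: divide_right_mono mult_right_mono)
      ultimately have "h (t (Suc i)) \<le> h (t i) + C * (t (Suc i) - t i)\<^sup>2"
        using C by blast
      also have "t (Suc i) - t i = (b - a) / k" by (simp add: t_def algebra_simps add_divide_distrib diff_divide_distrib)
      finally show ?case using Suc by (simp add: algebra_simps)
    qed
    from this[of "Suc n"] have "h b \<le> h a + k * (C * ((b - a) / k)\<^sup>2)"
      using k by (simp add: t_def k_def)
    also have "k * (C * ((b - a) / k)\<^sup>2) = C * (b - a)\<^sup>2 / k"
      using k by (simp add: power2_eq_square field_simps)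
    finally show ?thesis by (simp add: k_def)
  qed
  have "(\<lambda>n. h a + C * (b - a)\<^sup>2 / real (Suc n)) \<longlonglongrightarrow> h a + 0"
    by (intro tendsto_add tendsto_const LIMSEQ_Suc[OF lim_const_over_n])
  then show ?thesis
    using LIMSEQ_le_const step by fastforce
qed

context shrinker_set
begin

lemma defect_antimono:
  assumes "0 < a" "a \<le> b"
  shows "defect y b \<le> defect y a"
proof -
  obtain p where p: "p \<in> \<Sigma>" using nonempty by blast
  \<comment> \<open>Comparison with the fixed point \<open>p\<close> bounds the nearest points
    uniformly over all scales in \<open>[a, b]\<close>.\<close>
  define B where "B = (2 * norm y + b * norm p) / a"
  show ?thesis
  proof (rule quadratic_error_imp_le[OF assms(2), where C="B\<^sup>2"])
    fix l m assume lm: "a \<le> l" "l \<le> m" "m \<le> b"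
    obtain x where x: "x \<in> \<Sigma>" "infdist y (scaled l) = norm (l *\<^sub>R x - y)"
      "defect y m \<le> defect y l + (norm x)\<^sup>2 * (m - l)\<^sup>2"
      using defect_step[OF assms(1) lm] by metis
    have "norm (l *\<^sub>R x - y) \<le> norm (l *\<^sub>R p - y)"
      using infdist_scaled_le[OF p] x(2) by metis
    then have "norm (l *\<^sub>R x) \<le> 2 * norm y + norm (l *\<^sub>R p)"
      using norm_triangle_ineq2[of "l *\<^sub>R x" y] norm_triangle_ineq4[of "l *\<^sub>R p" y] by linarith
    also have "\<dots> \<le> 2 * norm y + b * norm p"
      using lm assms by (auto intro!: mult_right_mono)
    finally have "a * norm x \<le> 2 * norm y + b * norm p"
      using lm assms mult_right_mono[of a l "norm x"] by auto
    then have "norm x \<le> B"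
      using assms by (simp add: B_def field_simps)
    then have "(norm x)\<^sup>2 * (m - l)\<^sup>2 \<le> B\<^sup>2 * (m - l)\<^sup>2"
      by (intro mult_right_mono power_mono) auto
    with x(3) show "defect y m \<le> defect y l + B\<^sup>2 * (m - l)\<^sup>2" by linarith
  qed
qed

text \<open>Membership is a quantitative condition at every scale instead of a limit: closedness and
  homogeneity can then be read off, and \<open>limit_coneI\<close> shows that all subsequential
  limits are captured.\<close>

definition "limit_cone = {y. \<forall>l>0. infdist y (scaled l) \<le> sqrt (2 * D) * l}"

text \<open>The defect tends to 0 along the sequence and does not increase with the scale, so it is
  nonpositive at every scale. Convergence along one sequence thus controls all scales at
  once.\<close>

lemma limit_coneI:
  assumes "\<And>i. 0 < l i" "l \<longlonglongrightarrow> 0" "(\<lambda>i. infdist y (scaled (l i))) \<longlonglongrightarrow> 0"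
  shows "y \<in> limit_cone"
  unfolding limit_cone_def
proof (intro CollectI allI impI)
  fix m :: real assume m: "m > 0"
  have "(\<lambda>i. defect y (l i)) \<longlonglongrightarrow> 0\<^sup>2 - 2 * D * 0\<^sup>2"
    unfolding defect_def by (intro tendsto_intros assms)
  moreover have "\<forall>\<^sub>F i in sequentially. l i < m"
    using assms(2) m order_tendstoD(2) by blast
  then have "\<forall>\<^sub>F i in sequentially. defect y m \<le> defect y (l i)"
    by (rule eventually_mono) (use assms(1) in \<open>auto intro: defect_antimono\<close>)
  ultimately have "defect y m \<le> 0"
    by (intro tendsto_lowerbound[of "\<lambda>i. defect y (l i)" 0 sequentially]) auto
  then have "(infdist y (scaled m))\<^sup>2 \<le> (sqrt (2 * D) * m)\<^sup>2"
    using D by (simp add: defect_def power_mult_distrib)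
  then show "infdist y (scaled m) \<le> sqrt (2 * D) * m"
    using m D by (simp add: power2_le_iff_abs_le infdist_nonneg)
qed

lemma zero_in_limit_cone: "0 \<in> limit_cone"
proof (rule limit_coneI[where l="\<lambda>i. 1 / real (Suc i)"])
  obtain p where p: "p \<in> \<Sigma>" using nonempty by blast
  show "(\<lambda>i. infdist 0 (scaled (1 / real (Suc i)))) \<longlonglongrightarrow> 0"
  proof (rule tendsto_sandwich[OF _ _ tendsto_const])
    show "(\<lambda>i. norm p / real (Suc i)) \<longlonglongrightarrow> 0"
      by (rule LIMSEQ_Suc[OF lim_const_over_n])
    show "\<forall>\<^sub>F i in sequentially. infdist 0 (scaled (1 / real (Suc i))) \<le> norm p / real (Suc i)"
      by (rule always_eventually, intro allI, rule order_trans[OF infdist_scaled_le[OF p]]) simp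
  qed (simp add: infdist_nonneg)
  show "(\<lambda>i. 1 / real (Suc i)) \<longlonglongrightarrow> 0"
    by (rule LIMSEQ_Suc[OF lim_const_over_n])
qed simp

lemma closed_limit_cone: "closed limit_cone"
proof -
  have "limit_cone = (\<Inter>l\<in>{0<..}. {y. infdist y (scaled l) \<le> sqrt (2 * D) * l})"
    by (auto simp: limit_cone_def)
  also have "closed \<dots>"
    by (intro closed_INT ballI closed_Collect_le continuous_intros)
  finally show ?thesis .
qed

lemma infdist_scaleR_scaled:
  assumes "s > 0"
  shows "infdist (s *\<^sub>R y) (scaled (s * l)) \<le> s * infdist y (scaled l)"
proof -
  obtain x where x: "x \<in> \<Sigma>" "infdist y (scaled l) = norm (l *\<^sub>R x - y)"
    using nearest by blast
  have "infdist (s *\<^sub>R y) (scaled (s * l)) \<le> norm ((s * l) *\<^sub>R x - s *\<^sub>R y)"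
    by (rule infdist_scaled_le[OF x(1)])
  also have "\<dots> = norm (s *\<^sub>R (l *\<^sub>R x - y))" by (simp add: scaleR_diff_right)
  finally show ?thesis using assms x(2) by simp
qed

text \<open>The distance from \<open>s y\<close> to \<open>l \<Sigma>\<close> is \<open>s\<close>
  times that from \<open>y\<close> to \<open>(l / s) \<Sigma>\<close>, and the rate
  \<open>sqrt (2 D) l\<close> is linear in the scale.\<close>

lemma limit_cone_scaleR:
  assumes "s > 0" "y \<in> limit_cone"
  shows "s *\<^sub>R y \<in> limit_cone"
  unfolding limit_cone_def
proof (intro CollectI allI impI)
  fix l :: real assume l: "l > 0"
  have "infdist (s *\<^sub>R y) (scaled l) \<le> s * infdist y (scaled (l / s))"
    using infdist_scaleR_scaled[OF assms(1), of y "l / s"] assms(1) by simp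
  also have "\<dots> \<le> s * (sqrt (2 * D) * (l / s))"
    using assms l unfolding limit_cone_def by (intro mult_left_mono) (auto simp del: times_divide_eq_right)
  finally show "infdist (s *\<^sub>R y) (scaled l) \<le> sqrt (2 * D) * l"
    using assms(1) by simp
qed

lemma limit_cone_eq: "limit_cone = cone_generated (limit_cone \<inter> sphere 0 1)"
proof (intro equalityI subsetI)
  fix y assume y: "y \<in> limit_cone"
  show "y \<in> cone_generated (limit_cone \<inter> sphere 0 1)"
  proof (cases "y = 0")
    case False
    have "(1 / norm y) *\<^sub>R y \<in> limit_cone \<inter> sphere 0 1"
      using False y limit_cone_scaleR[of "1 / norm y" y] by simp
    moreover have "y = norm y *\<^sub>R ((1 / norm y) *\<^sub>R y)" using False by simp
    ultimately show ?thesis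
      using False unfolding cone_generated_def by (metis (mono_tags, lifting) CollectI UnI1 zero_less_norm_iff)
  qed (simp add: cone_generated_def)
qed (auto simp: cone_generated_def zero_in_limit_cone limit_cone_scaleR)

text \<open>The local Hausdorff distance compares sets cut by the same ball, and a point of the
  rescaled set near \<open>y\<close> may fall outside. Hence \<open>y\<close> is first pulled
  inwards by the factor \<open>s\<close>, which leaves room for the approximation at the price of
  doubling the error.\<close>

lemma limit_cone_near_scaled:
  assumes R: "R > 0" and l: "0 < l" "sqrt (2 * D) * l \<le> R" and y: "y \<in> limit_cone" "norm y \<le> R"
  obtains x where "x \<in> scaled l" "norm x \<le> R" "dist x y \<le> 2 * (sqrt (2 * D) * l)"
proof -
  define s where "s = 1 - sqrt (2 * D) * l / R"
  have s: "0 \<le> s" "s \<le> 1" "(1 - s) * R = sqrt (2 * D) * l"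
    using R l D by (auto simp: s_def field_simps)
  have "s *\<^sub>R y \<in> limit_cone"
    using s(1) y zero_in_limit_cone limit_cone_scaleR[of s y] by (cases "s = 0") auto
  then have inf: "infdist (s *\<^sub>R y) (scaled l) \<le> sqrt (2 * D) * l"
    using l by (simp add: limit_cone_def)
  obtain x where x: "x \<in> scaled l" "infdist (s *\<^sub>R y) (scaled l) = dist (s *\<^sub>R y) x"
    using infdist_attains_inf[OF closed_scaled scaled_nonempty] by metis
  have "norm x \<le> norm (s *\<^sub>R y) + dist (s *\<^sub>R y) x"
    using norm_triangle_ineq3[of x "s *\<^sub>R y"] by (simp add: dist_norm norm_minus_commute)
  also have "\<dots> \<le> s * R + (1 - s) * R"
    using s inf x(2) y(2) by (auto intro!: add_mono mult_left_mono)
  finally have "norm x \<le> R" by (simp add: algebra_simps)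
  moreover have "dist (s *\<^sub>R y) y \<le> sqrt (2 * D) * l"
  proof -
    have "s *\<^sub>R y - y = (s - 1) *\<^sub>R y" by (simp add: algebra_simps)
    then have "dist (s *\<^sub>R y) y = (1 - s) * norm y"
      using s by (simp add: dist_norm)
    also have "\<dots> \<le> (1 - s) * R" using s y by (intro mult_left_mono) auto
    finally show ?thesis using s(3) by simp
  qed
  then have "dist x y \<le> 2 * (sqrt (2 * D) * l)"
    using inf x(2) dist_triangle[of x y "s *\<^sub>R y"] by (simp add: dist_commute)
  ultimately show ?thesis using that x(1) by blast
qed

text \<open>Otherwise there are points of the sets, at scales tending to 0, that stay
  \<open>e\<close> away from the cone; a convergent subsequence has its limit in the closed ball
  and, by \<open>limit_coneI\<close>, in the cone.\<close>

lemma scaled_near_limit_cone: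
  assumes R: "R > 0" and e: "e > 0"
  shows "\<forall>\<^sub>F l in at_right 0. \<forall>x\<in>scaled l \<inter> cball 0 R. \<exists>y\<in>limit_cone \<inter> cball 0 R. dist x y < e"
proof (rule ccontr)
  assume "\<not> ?thesis"
  then have "\<forall>b>0. \<exists>l>0. l < b \<and> (\<exists>x\<in>scaled l \<inter> cball 0 R. \<forall>y\<in>limit_cone \<inter> cball 0 R. \<not> dist x y < e)"
    by (auto simp: eventually_at_right_field)
  then have "\<forall>i. \<exists>l x. 0 < l \<and> l < 1 / real (Suc i) \<and> x \<in> scaled l \<and> norm x \<le> R \<and>
      (\<forall>y\<in>limit_cone \<inter> cball 0 R. \<not> dist x y < e)"
  proof (intro allI)
    fix i
    have "1 / real (Suc i) > 0" by simp
    then show "\<exists>l x. 0 < l \<and> l < 1 / real (Suc i) \<and> x \<in> scaled l \<and> norm x \<le> R \<and>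
      (\<forall>y\<in>limit_cone \<inter> cball 0 R. \<not> dist x y < e)"
      using \<open>\<forall>b>0. _ b\<close> by (metis IntE mem_cball_0)
  qed
  then obtain l x where lx: "\<And>i. 0 < l i" "\<And>i. l i < 1 / real (Suc i)" "\<And>i. x i \<in> scaled (l i)"
    "\<And>i. norm (x i) \<le> R" "\<And>i y. y \<in> limit_cone \<inter> cball 0 R \<Longrightarrow> \<not> dist (x i) y < e"
    by metis
  have "compact (cball (0::'a) R)" "range x \<subseteq> cball 0 R" using lx(4) by auto
  then obtain y r where yr: "y \<in> cball 0 R" "strict_mono r" "(x \<circ> r) \<longlonglongrightarrow> y"
    unfolding compact_def by (metis range_subsetD)
  have "l \<longlonglongrightarrow> 0"
  proof (rule tendsto_sandwich[OF _ _ tendsto_const])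
    show "(\<lambda>i. 1 / real (Suc i)) \<longlonglongrightarrow> 0" by (rule LIMSEQ_Suc[OF lim_const_over_n])
  qed (use lx(1,2) in \<open>auto intro!: always_eventually less_imp_le\<close>)
  then have l0: "(l \<circ> r) \<longlonglongrightarrow> 0" using yr(2) LIMSEQ_subseq_LIMSEQ by blast
  have "y \<in> limit_cone"
  proof (rule limit_coneI[OF _ l0])
    have "(\<lambda>i. dist y ((x \<circ> r) i)) \<longlonglongrightarrow> dist y y"
      by (intro tendsto_intros yr)
    then have "(\<lambda>i. dist y ((x \<circ> r) i)) \<longlonglongrightarrow> 0" by simp
    then show "(\<lambda>i. infdist y (scaled ((l \<circ> r) i))) \<longlonglongrightarrow> 0"
      by (rule tendsto_sandwich[OF _ _ tendsto_const, rotated 2])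
        (use lx(3) in \<open>auto intro!: always_eventually infdist_le infdist_nonneg\<close>)
  qed (use lx in auto)
  moreover obtain i where "dist ((x \<circ> r) i) y < e"
    using yr(3) e by (meson lim_sequentially order_refl)
  ultimately show False using lx(5)[of y] yr(1) by auto
qed

lemma scaled_tendsto_limit_cone: "locally_hausdorff_tendsto scaled limit_cone (at_right 0)"
  unfolding locally_hausdorff_tendsto_def
proof (intro allI impI)
  fix R :: real assume R: "R > 0"
  show "((\<lambda>l. hausdorff_dist (scaled l \<inter> cball 0 R) (limit_cone \<inter> cball 0 R)) \<longlongrightarrow> 0) (at_right 0)"
  proof (rule order_tendstoI)
    fix a :: ennreal assume "0 < a"
    then obtain e where e: "e > 0" "ennreal e < a"
      by (metis dense ennreal_cases ennreal_less_zero_iff less_top_ennreal neq_top_trans not_less order_less_imp_le)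
    \<comment> \<open>The first bound is what \<open>limit_cone_near_scaled\<close> requires, the
      second makes its error at most \<open>e\<close>.\<close>
    define b where "b = min (R / sqrt (2 * D)) (e / (2 * sqrt (2 * D)))"
    have b: "b > 0" using R e D by (simp add: b_def)
    then have "\<forall>\<^sub>F l in at_right 0. l < b \<and> l > 0"
      using eventually_at_right_field by blast
    then show "\<forall>\<^sub>F l in at_right 0. hausdorff_dist (scaled l \<inter> cball 0 R) (limit_cone \<inter> cball 0 R) < a"
      using scaled_near_limit_cone[OF R e(1)]
    proof eventually_elim
      case (elim l)
      have l: "sqrt (2 * D) * l \<le> R" "2 * (sqrt (2 * D) * l) \<le> e"
        using elim D by (auto simp: b_def field_simps)
      have "hausdorff_dist (scaled l \<inter> cball 0 R) (limit_cone \<inter> cball 0 R) \<le> ennreal e"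
      proof (rule hausdorff_dist_le)
        fix y assume "y \<in> limit_cone \<inter> cball 0 R"
        then obtain x where "x \<in> scaled l" "norm x \<le> R" "dist x y \<le> 2 * (sqrt (2 * D) * l)"
          using limit_cone_near_scaled[OF R _ l(1), of y] elim by auto
        then show "\<exists>x\<in>scaled l \<inter> cball 0 R. dist x y \<le> e"
          using l(2) by (intro bexI[of _ x]) auto
      next
        fix x assume "x \<in> scaled l \<inter> cball 0 R"
        then show "\<exists>y\<in>limit_cone \<inter> cball 0 R. dist x y \<le> e"
          using elim(2) less_imp_le by blast
      qed (use e in auto)
      then show ?case using e(2) by (rule le_less_trans)
    qed
  qed simp
qed

end

section \<open>From the immersion to the conditions on its image\<close>

lemma Ck_on_subset: "Ck_on k S f \<Longrightarrow> T \<subseteq> S \<Longrightarrow> Ck_on k T f"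
  by (induction k arbitrary: f) (auto intro: continuous_on_subset differentiable_on_subset)

lemma smooth_on_subset: "smooth_on S f \<Longrightarrow> T \<subseteq> S \<Longrightarrow> smooth_on T f"
  unfolding smooth_on_def using Ck_on_subset by blast

lemma Ck_on_continuous: "Ck_on k S f \<Longrightarrow> continuous_on S f"
  by (cases k) (auto intro: differentiable_imp_continuous_on)

text \<open>One preimage of the minimum point is chosen; in a chart around it the parameters are
  restricted to those mapped into the ball where minimality is known.\<close>

lemma shrinker_set_image:
  fixes F :: "'p \<Rightarrow> real^'m::finite" and A :: "('n::finite, 'p) atlas"
  assumes dim: "CARD('m) = CARD('n) + 1" and M: "smooth_manifold M A" "topspace M \<noteq> {}"
    and F: "smooth_immersion A F" "proper_map M euclidean F" and H: "self_shrinker A F"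
  shows "shrinker_set (F ` topspace M) (real CARD('n))"
proof
  show "closed (F ` topspace M)"
    using proper_imp_closed_map[OF F(2)] by (simp add: closed_map_def)
  show "F ` topspace M \<noteq> {}" "real CARD('n) > 0" using M by auto
next
  fix \<alpha> \<beta> :: real and c p x :: "real^'m" and d :: real
  assume \<beta>: "\<beta> \<ge> 0" and x: "x \<in> F ` topspace M" and d: "d > 0"
    and min: "\<And>z. z \<in> F ` topspace M \<Longrightarrow> dist x z < d \<Longrightarrow>
      \<alpha> * (x \<bullet> x) - \<beta> * (x \<bullet> p)\<^sup>2 + c \<bullet> x \<le> \<alpha> * (z \<bullet> z) - \<beta> * (z \<bullet> p)\<^sup>2 + c \<bullet> z"
  obtain q where q: "q \<in> topspace M" "x = F q" using x by auto
  have cover: "(\<Union>(U, \<phi>)\<in>A. \<phi> ` U) = topspace M"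
    using M by (auto simp: smooth_manifold_def smooth_atlas_def)
  then obtain U \<phi> u where U: "(U, \<phi>) \<in> A" "u \<in> U" "q = \<phi> u"
    using q(1) by blast
  obtain W \<nu> where W: "open W" "u \<in> W" "W \<subseteq> U" "unit_normal_on W (F \<circ> \<phi>) \<nu>"
    "\<And>w. w \<in> W \<Longrightarrow> mean_curvature (F \<circ> \<phi>) \<nu> w = ((F \<circ> \<phi>) w \<bullet> \<nu> w) / 2"
    using bspec[OF bspec[OF H[unfolded self_shrinker_def] U(1), unfolded prod.case] U(2)] by blast
  have sm: "smooth_on U (F \<circ> \<phi>)" "inj (frechet_derivative (F \<circ> \<phi>) (at u))"
    using F(1) U by (auto simp: smooth_immersion_def)
  define W' where "W' = W \<inter> (F \<circ> \<phi>) -` ball x d"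
  have "continuous_on W (F \<circ> \<phi>)"
    using sm(1) W(3) unfolding smooth_on_def by (meson Ck_on_continuous continuous_on_subset)
  then have W': "open W'" unfolding W'_def by (intro continuous_open_preimage W(1)) auto
  have uW': "u \<in> W'" using W(2) d q U by (simp add: W'_def)
  have "\<alpha> * ((F \<circ> \<phi>) u \<bullet> (F \<circ> \<phi>) u) - \<beta> * ((F \<circ> \<phi>) u \<bullet> p)\<^sup>2 + (c \<bullet> (F \<circ> \<phi>) u) / 2
      \<le> 2 * real CARD('n) * \<alpha>"
  proof (rule shrinker_local_min[OF dim W' uW'])
    show "Ck_on (Suc (Suc 0)) W' (F \<circ> \<phi>)"
      using sm(1) W(3) unfolding smooth_on_def W'_def by (meson Ck_on_subset inf_le1 order_trans)
    show "unit_normal_on W' (F \<circ> \<phi>) \<nu>"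
      using W(4) unfolding unit_normal_on_def W'_def by (auto intro: smooth_on_subset)
    show "mean_curvature (F \<circ> \<phi>) \<nu> u = ((F \<circ> \<phi>) u \<bullet> \<nu> u) / 2" using W(2,5) by blast
    fix w assume w: "w \<in> W'"
    then have "w \<in> U" using W(3) by (auto simp: W'_def)
    then have "\<phi> w \<in> topspace M" using U(1) cover by blast
    then show "\<alpha> * ((F \<circ> \<phi>) u \<bullet> (F \<circ> \<phi>) u) - \<beta> * ((F \<circ> \<phi>) u \<bullet> p)\<^sup>2 + c \<bullet> (F \<circ> \<phi>) u
       \<le> \<alpha> * ((F \<circ> \<phi>) w \<bullet> (F \<circ> \<phi>) w) - \<beta> * ((F \<circ> \<phi>) w \<bullet> p)\<^sup>2 + c \<bullet> (F \<circ> \<phi>) w"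
      using min[of "F (\<phi> w)"] w q U by (simp add: W'_def)
  qed (use sm(2) \<beta> in \<open>simp_all only:\<close>)
  then show "\<alpha> * (x \<bullet> x) - \<beta> * (x \<bullet> p)\<^sup>2 + (c \<bullet> x) / 2 \<le> 2 * real CARD('n) * \<alpha>"
    using q U by simp
qed

section \<open>Counting spherical slices\<close>

text \<open>A barrier argument. \<open>V\<close> is the squared distance to the axis plus
  \<open>b |z|^2\<close>. A minimum of \<open>V\<close> on the surface strictly outside the ball of
  radius \<open>r\<close> would have \<open>V \<le> 4 (1 + b)\<close>, while
  \<open>V \<ge> b r^2 = 6\<close> there. So the minimum lies on the sphere, and its value is
  controlled by a point of the surface near \<open>(r + 2) y\<close>.\<close>

lemma (in shrinker_set) exists_on_sphere_near_axis:
  assumes D2: "D = 2" and y: "y \<in> limit_cone" "norm y = 1" and r: "r \<ge> 12"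
  obtains x where "x \<in> \<Sigma>" "norm x = r" "x \<bullet> y > 0" "x \<bullet> x - (x \<bullet> y)\<^sup>2 \<le> 9"
proof -
  have yy: "y \<bullet> y = 1" using y(2) by (simp add: norm_eq_1)
  \<comment> \<open>With \<open>D = 2\<close> the distance at scale 1 is at most
    \<open>sqrt 4 = 2\<close>. The shift by 2 ensures \<open>x1 \<bullet> y \<ge> r\<close>, so that
    \<open>x1\<close> is not inside the ball.\<close>
  have "(r + 2) *\<^sub>R y \<in> limit_cone"
    using r y(1) by (intro limit_cone_scaleR) auto
  then have "infdist ((r + 2) *\<^sub>R y) (scaled 1) \<le> 2"
    using D2 unfolding limit_cone_def by (auto dest!: spec[of _ 1])
  then obtain x1 where x1: "x1 \<in> \<Sigma>" "norm (x1 - (r + 2) *\<^sub>R y) \<le> 2"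
    using nearest[of "(r + 2) *\<^sub>R y" 1] by (metis scaleR_one)
  define v where "v = x1 - (r + 2) *\<^sub>R y"
  have x1v: "x1 = v + (r + 2) *\<^sub>R y" by (simp add: v_def)
  have v: "norm v \<le> 2" "\<bar>v \<bullet> y\<bar> \<le> 2"
    using x1(2) Cauchy_Schwarz_ineq2[of v y] y(2) by (auto simp: v_def)
  have x1y: "x1 \<bullet> y \<ge> r" using v by (simp add: x1v inner_add_left yy)
  have "norm x1 \<le> r + 4"
    using norm_triangle_ineq[of v "(r + 2) *\<^sub>R y"] v r y(2) by (simp add: x1v)
  have "norm x1 \<ge> r"
    using x1y Cauchy_Schwarz_ineq2[of x1 y] y(2) by simp
  have "x1 \<bullet> x1 - (x1 \<bullet> y)\<^sup>2 = v \<bullet> v - (v \<bullet> y)\<^sup>2"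
    by (simp add: x1v inner_add_left inner_add_right yy inner_commute[of y v] power2_eq_square algebra_simps)
  also have "\<dots> \<le> (norm v)\<^sup>2" by (simp add: power2_norm_eq_inner)
  also have "\<dots> \<le> 2\<^sup>2" using v by (intro power_mono) auto
  finally have \<rho>1: "x1 \<bullet> x1 - (x1 \<bullet> y)\<^sup>2 \<le> 4" by simp
  \<comment> \<open>Large enough that \<open>b r^2 = 6\<close> exceeds \<open>4 (1 + b)\<close>,
    small enough that \<open>V x1 - 6 \<le> 4 + 8 b r + 16 b \<le> 9\<close> for
    \<open>r \<ge> 12\<close>.\<close>
  define b where "b = 6 / r\<^sup>2"
  have b: "b > 0" "b * r\<^sup>2 = 6" using r by (auto simp: b_def)
  have rr: "r\<^sup>2 \<ge> 12 * r" "r\<^sup>2 \<ge> 144"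
    using r mult_mono[of 12 r 12 r] by (auto simp: power2_eq_square)
  have bsmall: "b * (12 * r) \<le> 6" "b * 144 \<le> 6"
    using b rr mult_left_mono[of "12 * r" "r\<^sup>2" b] mult_left_mono[of 144 "r\<^sup>2" b] by auto
  have br4: "b * (r + 4)\<^sup>2 = 6 + 8 * (b * r) + 16 * b"
    using b(2) by (simp add: power2_eq_square algebra_simps)
  define V where "V z = (1 + b) * (z \<bullet> z) - (z \<bullet> y)\<^sup>2" for z
  have Vge: "V z \<ge> b * (z \<bullet> z)" for z
    using Cauchy_Schwarz_ineq[of z y] yy by (simp add: V_def algebra_simps)
  have "x1 \<bullet> x1 \<le> (r + 4)\<^sup>2"
    using power_mono[OF \<open>norm x1 \<le> r + 4\<close>, of 2] by (simp add: power2_norm_eq_inner)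
  then have "b * (x1 \<bullet> x1) \<le> b * (r + 4)\<^sup>2" using b by (intro mult_left_mono) auto
  then have V1: "V x1 \<le> 9 + 6"
    using \<rho>1 br4 bsmall by (simp add: V_def algebra_simps)
  \<comment> \<open>The other two walls of \<open>Q\<close> cannot carry the minimum:
    \<open>V \<ge> 144\<close> on the plane \<open>z \<bullet> y = 0\<close> and
    \<open>V \<ge> 24\<close> on the sphere of radius \<open>2 r\<close>, against
    \<open>V x1 \<le> 15\<close>.\<close>
  define Q where "Q = \<Sigma> \<inter> {z. r \<le> norm z} \<inter> {z. 0 \<le> z \<bullet> y} \<inter> cball 0 (2 * r)"
  have "compact Q" unfolding Q_def
    by (intro compact_Int_closed closed_Int_compact closed_Int closed closed_Collect_le continuous_intros compact_cball)
  moreover have x1Q: "x1 \<in> Q"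
    using x1 x1y \<open>norm x1 \<le> r + 4\<close> \<open>norm x1 \<ge> r\<close> r by (simp add: Q_def)
  moreover have "continuous_on Q V" unfolding V_def by (intro continuous_intros)
  ultimately obtain x where x: "x \<in> Q" "\<And>z. z \<in> Q \<Longrightarrow> V x \<le> V z"
    using continuous_attains_inf[of Q V] by blast
  have Vx: "V x \<le> V x1" using x(2) x1Q by blast
  have xx: "x \<bullet> x = (norm x)\<^sup>2" by (simp add: power2_norm_eq_inner)
  have "r\<^sup>2 \<le> x \<bullet> x"
    using x(1) r power_mono[of r "norm x" 2] by (simp add: Q_def xx)
  have pos: "x \<bullet> y > 0"
  proof (rule ccontr)
    assume "\<not> ?thesis"
    then have "x \<bullet> y = 0" using x(1) by (simp add: Q_def)
    then have "V x = (x \<bullet> x) + b * (x \<bullet> x)" by (simp add: V_def algebra_simps)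
    moreover have "b * (x \<bullet> x) \<ge> 0" using b by simp
    ultimately show False using Vx V1 rr \<open>r\<^sup>2 \<le> x \<bullet> x\<close> by linarith
  qed
  have lt: "norm x < 2 * r"
  proof (rule ccontr)
    assume "\<not> ?thesis"
    then have "(2 * r)\<^sup>2 \<le> x \<bullet> x"
      using r power_mono[of "2 * r" "norm x" 2] by (simp add: xx)
    then have "b * (2 * r)\<^sup>2 \<le> V x"
      using Vge[of x] b mult_left_mono[of "(2 * r)\<^sup>2" "x \<bullet> x" b] by linarith
    then show False using Vx V1 b(2) by (simp add: power2_eq_square algebra_simps)
  qed
  have "norm x = r"
  proof (rule ccontr)
    assume "norm x \<noteq> r"
    then have gt: "norm x > r" using x(1) by (simp add: Q_def)
    define U where "U = {z. r < norm z} \<inter> {z. 0 < z \<bullet> y} \<inter> ball 0 (2 * r)"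
    have "open U" unfolding U_def
      by (intro open_Int open_Collect_less continuous_intros open_ball)
    moreover have "x \<in> U" using gt pos lt by (simp add: U_def)
    ultimately obtain d where d: "d > 0" "ball x d \<subseteq> U" using openE by blast
    have "(1 + b) * (x \<bullet> x) - 1 * (x \<bullet> y)\<^sup>2 + (0 \<bullet> x) / 2 \<le> 2 * D * (1 + b)"
    proof (rule local_min[OF _ _ d(1)])
      fix z assume "z \<in> \<Sigma>" "dist x z < d"
      then have "z \<in> Q" using d(2) by (force simp: U_def Q_def)
      then show "(1 + b) * (x \<bullet> x) - 1 * (x \<bullet> y)\<^sup>2 + 0 \<bullet> x \<le> (1 + b) * (z \<bullet> z) - 1 * (z \<bullet> y)\<^sup>2 + 0 \<bullet> z"
        using x(2)[of z] by (simp add: V_def)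
    qed (use x(1) Q_def in auto)
    then have "V x \<le> 4 * (1 + b)" by (simp add: V_def D2)
    moreover have "b * r\<^sup>2 \<le> V x"
      using Vge[of x] \<open>r\<^sup>2 \<le> x \<bullet> x\<close> b mult_left_mono[of "r\<^sup>2" "x \<bullet> x" b] by linarith
    ultimately show False using b(2) bsmall(2) by simp
  qed
  have "x \<bullet> x - (x \<bullet> y)\<^sup>2 = V x - b * r\<^sup>2"
    using \<open>norm x = r\<close> by (simp add: V_def xx algebra_simps)
  also have "\<dots> \<le> 9"
  proof -
    have "V x1 \<le> 4 + b * (r + 4)\<^sup>2"
      using \<rho>1 \<open>b * (x1 \<bullet> x1) \<le> b * (r + 4)\<^sup>2\<close> by (simp add: V_def algebra_simps)
    then show ?thesis using Vx br4 bsmall b(2) by simp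
  qed
  finally show ?thesis
    using that x(1) pos \<open>norm x = r\<close> Q_def by blast
qed

text \<open>Origin of the constant 12: at squared distance at most 16 from the ray, \<open>z\<close>
  lies within \<open>sqrt 32 \<le> 6\<close> of \<open>|z| y\<close>, so two such rays satisfy
  \<open>|z| |y - y'| \<le> 12\<close>.\<close>

lemma cap_disjoint:
  fixes y y' z :: "'a::real_inner"
  assumes R: "R > 0" "norm z \<ge> R" and y: "norm y = 1" "norm y' = 1"
    and z: "z \<bullet> y \<ge> 0" "z \<bullet> z - (z \<bullet> y)\<^sup>2 \<le> 16" "z \<bullet> y' \<ge> 0" "z \<bullet> z - (z \<bullet> y')\<^sup>2 \<le> 16"
  shows "dist y y' \<le> 12 / R"
proof -
  have zz: "z \<bullet> z = (norm z)\<^sup>2" by (simp add: power2_norm_eq_inner)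
  have *: "norm (z - norm z *\<^sub>R y) \<le> 6"
    if "norm y = 1" "z \<bullet> y \<ge> 0" "z \<bullet> z - (z \<bullet> y)\<^sup>2 \<le> 16" for y
  proof -
    have "z \<bullet> y \<le> norm z" using norm_cauchy_schwarz[of z y] that by simp
    then have "norm z * (norm z - z \<bullet> y) \<le> (norm z + z \<bullet> y) * (norm z - z \<bullet> y)"
      using that by (intro mult_right_mono) auto
    also have "\<dots> = z \<bullet> z - (z \<bullet> y)\<^sup>2"
      unfolding zz by (simp add: power2_eq_square algebra_simps)
    finally have "norm z * (norm z - z \<bullet> y) \<le> 16" using that by simp
    moreover have "(norm (z - norm z *\<^sub>R y))\<^sup>2 = z \<bullet> z - 2 * norm z * (z \<bullet> y) + (norm z)\<^sup>2 * (y \<bullet> y)"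
      unfolding power2_norm_eq_inner[of "z - norm z *\<^sub>R y"]
      by (simp add: inner_diff_left inner_diff_right inner_commute[of y z] power2_eq_square algebra_simps)
    then have "(norm (z - norm z *\<^sub>R y))\<^sup>2 = 2 * (norm z * (norm z - z \<bullet> y))"
      using that(1) unfolding zz norm_eq_1 by (simp add: power2_eq_square algebra_simps)
    ultimately have "(norm (z - norm z *\<^sub>R y))\<^sup>2 \<le> 6\<^sup>2" by simp
    then show ?thesis by (rule power2_le_imp_le) simp
  qed
  have "norm z * norm (y - y') = norm ((z - norm z *\<^sub>R y') - (z - norm z *\<^sub>R y))"
    using norm_scaleR[of "norm z" "y - y'"] by (simp add: scaleR_diff_right)
  also have "\<dots> \<le> 6 + 6"
    using *[of y] *[of y'] y z norm_triangle_ineq4[of "z - norm z *\<^sub>R y'" "z - norm z *\<^sub>R y"] by linarith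
  finally have "R * norm (y - y') \<le> 12"
    using R mult_right_mono[of R "norm z" "norm (y - y')"] by simp
  then show ?thesis using R by (simp add: dist_norm field_simps)
qed

text \<open>On the sphere, within the half space, the squared distance to the ray equals
  \<open>c\<close> exactly where \<open>z \<bullet> y = h\<close> with
  \<open>h = sqrt (r^2 - c)\<close>. A connected set that starts with
  \<open>x \<bullet> y \<ge> h\<close> and misses this level stays above it.\<close>

lemma component_in_cap:
  fixes G :: "'a::real_inner set"
  assumes G: "G \<subseteq> sphere 0 r" and r: "r > 4" and x: "x \<in> Q" "Q \<in> components G" "x \<bullet> y > 0"
    and \<rho>: "x \<bullet> x - (x \<bullet> y)\<^sup>2 \<le> 9" and c: "9 \<le> c" "c \<le> 16"
    and miss: "\<And>z. z \<in> G \<Longrightarrow> z \<bullet> y \<ge> 0 \<Longrightarrow> z \<bullet> z - (z \<bullet> y)\<^sup>2 \<noteq> c"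
    and z: "z \<in> Q"
  shows "z \<bullet> y > 0 \<and> z \<bullet> z - (z \<bullet> y)\<^sup>2 < 16"
proof -
  define h where "h = sqrt (r\<^sup>2 - c)"
  have "r\<^sup>2 > 16" using r power_strict_mono[of 4 r 2] by simp
  then have h: "h > 0" "h\<^sup>2 = r\<^sup>2 - c" using c by (auto simp: h_def)
  have QG: "Q \<subseteq> G" using x(2) in_components_subset by blast
  have norm: "z \<bullet> z = r\<^sup>2" if "z \<in> Q" for z
    using that QG G by (auto simp flip: power2_norm_eq_inner)
  have ne: "z \<bullet> y \<noteq> h" if "z \<in> Q" for z
    using miss[of z] that QG h norm[OF that] by (auto simp: subset_iff)
  have "h\<^sup>2 \<le> (x \<bullet> y)\<^sup>2" using norm[OF x(1)] \<rho> c h by simp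
  then have hx: "h \<le> x \<bullet> y" by (rule power2_le_imp_le[OF _ less_imp_le[OF x(3)]])
  have "z \<bullet> y > h"
  proof (rule ccontr)
    assume "\<not> ?thesis"
    moreover have "connected ((\<lambda>z. z \<bullet> y) ` Q)"
      using in_components_connected[OF x(2)] by (intro connected_continuous_image continuous_intros)
    ultimately have "h \<in> (\<lambda>z. z \<bullet> y) ` Q"
      using connectedD_interval[of "(\<lambda>z. z \<bullet> y) ` Q" "z \<bullet> y" "x \<bullet> y" h] hx x(1) z by auto
    then show False using ne by auto
  qed
  then have "z \<bullet> y > 0" "(z \<bullet> y)\<^sup>2 > h\<^sup>2"
    using h(1) power_strict_mono[of h "z \<bullet> y" 2] by auto
  then show ?thesis using norm[OF z] h c by simp
qed

section \<open>Plane Lebesgue measure through vertical slices\<close>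

lemma lborel_real2: "distr lborel borel (\<lambda>v::real^2. (v $ 1, v $ 2)) = lborel"
proof (rule lborel_eqI[symmetric])
  let ?f = "\<lambda>v::real^2. (v $ 1, v $ 2)"
  have m: "?f \<in> measurable lborel borel"
    by (simp add: borel_measurable_continuous_onI continuous_intros)
  fix l u :: "real \<times> real" assume le: "\<And>b. b \<in> Basis \<Longrightarrow> l \<bullet> b \<le> u \<bullet> b"
  have le12: "fst l \<le> fst u" "snd l \<le> snd u"
    using le[of "(1,0)"] le[of "(0,1)"] by (auto simp: Basis_prod_def inner_prod_def)
  have "?f -` box l u \<inter> space lborel = box (vector [fst l, snd l]) (vector [fst u, snd u])"
    by (auto simp: mem_box_cart forall_2 mem_box Basis_prod_def inner_prod_def)
  then have "emeasure (distr lborel borel ?f) (box l u)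
      = emeasure lborel (box (vector [fst l, snd l]) (vector [fst u, snd u] :: real^2))"
    using m by (simp add: emeasure_distr)
  also have "\<dots> = ennreal (\<Prod>b\<in>Basis. (vector [fst u, snd u] - vector [fst l, snd l] :: real^2) \<bullet> b)"
  proof (rule emeasure_lborel_box)
    fix b :: "real^2" assume "b \<in> Basis"
    then obtain i where "b = axis i 1" by (auto simp: Basis_vec_def)
    then show "vector [fst l, snd l] \<bullet> b \<le> vector [fst u, snd u] \<bullet> b"
      using le12 exhaust_2[of i] by (auto simp: inner_axis)
  qed
  also have "(\<Prod>b\<in>Basis. (vector [fst u, snd u] - vector [fst l, snd l] :: real^2) \<bullet> b)
      = (fst u - fst l) * (snd u - snd l)"
  proof -
    have "(\<Prod>b\<in>Basis. (vector [fst u, snd u] - vector [fst l, snd l] :: real^2) \<bullet> b)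
      = (\<Prod>i\<in>UNIV. (vector [fst u, snd u] - vector [fst l, snd l] :: real^2) $ i)"
      by (rule prod.reindex_cong[of "\<lambda>i. axis i 1"])
        (auto simp: Basis_vec_def inner_axis inj_on_def axis_eq_axis)
    then show ?thesis by (simp add: prod_2 UNIV_2)
  qed
  also have "\<dots> = (\<Prod>b\<in>Basis. (u - l) \<bullet> b)"
    by (simp add: Basis_prod_def prod.union_disjoint inner_prod_def)
  finally show "emeasure (distr lborel borel ?f) (box l u) = (\<Prod>b\<in>Basis. (u - l) \<bullet> b)" .
qed simp

lemma vector_2_eta: "vector [v $ 1, v $ 2] = (v::real^2)"
  by (simp add: vec_eq_iff forall_2)

lemma continuous_on_vector_2:
  fixes f g :: "'a::topological_space \<Rightarrow> real"
  assumes "continuous_on S f" "continuous_on S g"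
  shows "continuous_on S (\<lambda>x. vector [f x, g x] :: real^2)"
proof -
  have "continuous_on S (\<lambda>x. (\<chi> i. if i = 1 then f x else g x) :: real^2)"
  proof (rule continuous_on_vec_lambda)
    fix i :: 2
    show "continuous_on S (\<lambda>x. if i = 1 then f x else g x)"
      using assms by (cases "i = 1") auto
  qed
  then show ?thesis
    by (rule continuous_on_eq) (simp add: vec_eq_iff forall_2)
qed

lemma emeasure_real2_slices:
  fixes E :: "(real^2) set"
  assumes "closed E"
  shows "emeasure lborel E = (\<integral>\<^sup>+a. emeasure lborel {c. vector [a, c] \<in> E} \<partial>lborel)"
    and "(\<lambda>a. emeasure lborel {c. vector [a, c] \<in> E}) \<in> borel_measurable lborel"
proof -
  let ?f = "\<lambda>v::real^2. (v $ 1, v $ 2)"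
  define E' where "E' = {p. vector [fst p, snd p] \<in> E}"
  have "closed ((\<lambda>p. vector [fst p, snd p] :: real^2) -` E)"
    using continuous_on_closed_vimage[of UNIV "\<lambda>p. vector [fst p, snd p] :: real^2"] assms
    by (simp add: continuous_on_vector_2 continuous_on_fst continuous_on_snd continuous_on_id)
  then have E': "E' \<in> sets borel" by (simp add: E'_def vimage_def borel_closed)
  then have E'2: "E' \<in> sets (lborel \<Otimes>\<^sub>M lborel)" unfolding lborel_prod by simp
  show "(\<lambda>a. emeasure lborel {c. vector [a, c] \<in> E}) \<in> borel_measurable lborel"
    using lborel.measurable_emeasure_Pair[OF E'2] by (simp add: E'_def vimage_def)
  have "E = ?f -` E' \<inter> space lborel"
    by (simp add: E'_def vector_2_eta vimage_def)
  then have "emeasure lborel E = emeasure (distr lborel borel ?f) E'"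
    using E' by (simp add: emeasure_distr borel_measurable_continuous_onI continuous_intros)
  also have "\<dots> = emeasure lborel E'" by (simp add: lborel_real2)
  also have "\<dots> = emeasure (lborel \<Otimes>\<^sub>M lborel) E'" by (simp add: lborel_prod)
  also have "\<dots> = (\<integral>\<^sup>+a. emeasure lborel (Pair a -` E') \<partial>lborel)"
    by (rule lborel.emeasure_pair_measure_alt[OF E'2])
  finally show "emeasure lborel E = (\<integral>\<^sup>+a. emeasure lborel {c. vector [a, c] \<in> E} \<partial>lborel)"
    by (simp add: E'_def vimage_def)
qed

text \<open>The part of \<open>\<Sigma>\<close> near the ray through \<open>y\<close>, mapped to the squares of the distances to
  the origin and to the ray.\<close>

definition tube :: "'a::real_inner set \<Rightarrow> real \<Rightarrow> 'a \<Rightarrow> 'a set" where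
  "tube \<Sigma> R y = {z \<in> \<Sigma>. R \<le> norm z \<and> norm z \<le> 2 * R \<and> 0 \<le> z \<bullet> y \<and>
     9 \<le> z \<bullet> z - (z \<bullet> y)\<^sup>2 \<and> z \<bullet> z - (z \<bullet> y)\<^sup>2 \<le> 16}"

definition tube_map :: "'a::real_inner \<Rightarrow> 'a \<Rightarrow> real^2" where
  "tube_map y z = vector [z \<bullet> z, z \<bullet> z - (z \<bullet> y)\<^sup>2]"

lemma compact_tube:
  fixes \<Sigma> :: "'a::euclidean_space set"
  assumes "closed \<Sigma>"
  shows "compact (tube \<Sigma> R y)"
proof -
  have "tube \<Sigma> R y = (\<Sigma> \<inter> {z. R \<le> norm z} \<inter> {z. 0 \<le> z \<bullet> y} \<inter> {z. 9 \<le> z \<bullet> z - (z \<bullet> y)\<^sup>2} \<inter>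
      {z. z \<bullet> z - (z \<bullet> y)\<^sup>2 \<le> 16}) \<inter> cball 0 (2 * R)"
    by (auto simp: tube_def)
  also have "compact \<dots>"
    by (intro closed_Int_compact closed_Int assms closed_Collect_le continuous_intros compact_cball)
  finally show ?thesis .
qed

lemma continuous_on_tube_map: "continuous_on S (tube_map y)"
  unfolding tube_map_def by (intro continuous_on_vector_2 continuous_intros)

text \<open>By \<open>component_in_cap\<close> a bad point owns a component of the slice that is
  trapped in its cap. The caps of separated points are disjoint on the slice, so distinct bad points
  own distinct components.\<close>

lemma card_bad_caps_le:
  fixes \<Sigma> :: "'a::real_inner set"
  assumes R: "R > 4" and r: "R \<le> r" "r \<le> 2 * R" and N: "finite (components (sphere 0 r \<inter> \<Sigma>))"
      "card (components (sphere 0 r \<inter> \<Sigma>)) \<le> N"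
    and P: "finite P" "\<And>y. y \<in> P \<Longrightarrow> norm y = 1"
      "\<And>y y'. y \<in> P \<Longrightarrow> y' \<in> P \<Longrightarrow> y \<noteq> y' \<Longrightarrow> dist y y' > 12 / R"
    and near: "\<And>y. y \<in> P \<Longrightarrow> \<exists>x\<in>\<Sigma>. norm x = r \<and> x \<bullet> y > 0 \<and> x \<bullet> x - (x \<bullet> y)\<^sup>2 \<le> 9"
  shows "card {y \<in> P. \<not> {9..16} \<subseteq> {c. vector [r\<^sup>2, c] \<in> tube_map y ` tube \<Sigma> R y}} \<le> N"
proof -
  let ?G = "sphere 0 r \<inter> \<Sigma>"
  define B where "B = {y \<in> P. \<not> {9..16} \<subseteq> {c. vector [r\<^sup>2, c] \<in> tube_map y ` tube \<Sigma> R y}}"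
  have "\<exists>Q\<in>components ?G. \<forall>z\<in>Q. z \<bullet> y > 0 \<and> z \<bullet> z - (z \<bullet> y)\<^sup>2 < 16" if y: "y \<in> B" for y
  proof -
    obtain x where x: "x \<in> \<Sigma>" "norm x = r" "x \<bullet> y > 0" "x \<bullet> x - (x \<bullet> y)\<^sup>2 \<le> 9"
      using near y unfolding B_def by blast
    have "\<not> {9..16} \<subseteq> {c. vector [r\<^sup>2, c] \<in> tube_map y ` tube \<Sigma> R y}"
      using y by (simp add: B_def)
    then obtain c where c: "9 \<le> c" "c \<le> 16" "vector [r\<^sup>2, c] \<notin> tube_map y ` tube \<Sigma> R y"
      unfolding subset_iff atLeastAtMost_iff mem_Collect_eq by blast
    define Q where "Q = connected_component_set ?G x"
    have xG: "x \<in> ?G" using x by simp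
    then have Q: "Q \<in> components ?G" "x \<in> Q"
      by (auto simp: Q_def components_def)
    have "z \<bullet> z - (z \<bullet> y)\<^sup>2 \<noteq> c" if z: "z \<in> ?G" "z \<bullet> y \<ge> 0" for z
    proof
      assume eq: "z \<bullet> z - (z \<bullet> y)\<^sup>2 = c"
      then have "z \<in> tube \<Sigma> R y" using z c r by (auto simp: tube_def)
      moreover have "tube_map y z = vector [r\<^sup>2, c]"
        using z eq by (simp add: tube_map_def flip: power2_norm_eq_inner)
      ultimately show False using c(3) by (metis image_eqI)
    qed
    then have "\<forall>z\<in>Q. z \<bullet> y > 0 \<and> z \<bullet> z - (z \<bullet> y)\<^sup>2 < 16"
      using component_in_cap[of ?G r x Q y c] Q x c R r by auto
    then show ?thesis using Q by blast
  qed
  then obtain q where q: "\<And>y. y \<in> B \<Longrightarrow> q y \<in> components ?G"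
    "\<And>y z. y \<in> B \<Longrightarrow> z \<in> q y \<Longrightarrow> z \<bullet> y > 0 \<and> z \<bullet> z - (z \<bullet> y)\<^sup>2 < 16" by metis
  have "inj_on q B"
  proof (rule inj_onI, rule ccontr)
    fix y y' assume yy: "y \<in> B" "y' \<in> B" "q y = q y'" "y \<noteq> y'"
    obtain z where z: "z \<in> q y" using q(1)[OF yy(1)] in_components_nonempty by blast
    then have "norm z = r" using q(1)[OF yy(1)] in_components_subset by fastforce
    then have "dist y y' \<le> 12 / R"
      using q(2)[of y z] q(2)[of y' z] z yy P(2) R r by (intro cap_disjoint[of R z]) (auto simp: B_def)
    moreover have "dist y y' > 12 / R" using P(3) yy by (auto simp: B_def)
    ultimately show False by simp
  qed
  then have "card B \<le> card (components ?G)"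
    using q(1) N(1) by (intro card_inj_on_le) auto
  then show ?thesis using N(2) by (simp add: B_def)
qed

text \<open>The factor \<open>21 R^2\<close> is the slice length 16 - 9 = 7 times the length
  \<open>4 R^2 - R^2\<close> of the range of \<open>|z|^2\<close>. The bad points may change with
  the radius, which is why the sum over \<open>P\<close> is estimated and not its single
  terms.\<close>

lemma sum_measure_tubes_ge:
  fixes \<Sigma> :: "'a::euclidean_space set"
  assumes cl: "closed \<Sigma>" and R: "R > 4"
    and N: "\<And>r. R \<le> r \<Longrightarrow> r \<le> 2 * R \<Longrightarrow> finite (components (sphere 0 r \<inter> \<Sigma>)) \<and>
      card (components (sphere 0 r \<inter> \<Sigma>)) \<le> N"
    and P: "finite P" "\<And>y. y \<in> P \<Longrightarrow> norm y = 1"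
      "\<And>y y'. y \<in> P \<Longrightarrow> y' \<in> P \<Longrightarrow> y \<noteq> y' \<Longrightarrow> dist y y' > 12 / R"
    and near: "\<And>y r. y \<in> P \<Longrightarrow> R \<le> r \<Longrightarrow> r \<le> 2 * R \<Longrightarrow>
      \<exists>x\<in>\<Sigma>. norm x = r \<and> x \<bullet> y > 0 \<and> x \<bullet> x - (x \<bullet> y)\<^sup>2 \<le> 9"
  shows "21 * R\<^sup>2 * (real (card P) - real N) \<le> (\<Sum>y\<in>P. measure lebesgue (tube_map y ` tube \<Sigma> R y))"
\<comment> \<open>The difference is passed through \<open>ennreal\<close>, which truncates negative
  numbers to 0.\<close>
proof (cases "N \<le> card P")
  case False
  then have "21 * R\<^sup>2 * (real (card P) - real N) \<le> 0"
    by (intro mult_nonneg_nonpos) auto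
  also have "0 \<le> (\<Sum>y\<in>P. measure lebesgue (tube_map y ` tube \<Sigma> R y))" by (simp add: sum_nonneg)
  finally show ?thesis .
next
  case True
  let ?E = "\<lambda>y. tube_map y ` tube \<Sigma> R y"
  let ?s = "\<lambda>y a. emeasure lborel {c. vector [a, c] \<in> ?E y}"
  have comp: "compact (?E y)" for y
    by (intro compact_continuous_image continuous_on_tube_map compact_tube cl)
  have slice: "ennreal (7 * (real (card P) - real N)) * indicator {R\<^sup>2..(2*R)\<^sup>2} a \<le> (\<Sum>y\<in>P. ?s y a)" for a
  proof (cases "a \<in> {R\<^sup>2..(2*R)\<^sup>2}")
    case a: True
    define r where "r = sqrt a"
    have "a \<ge> 0" using a by (auto intro: order_trans[of 0 "R\<^sup>2" a])
    then have ar: "a = r\<^sup>2" by (simp add: r_def)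
    have r: "R \<le> r" "r \<le> 2 * R"
      using a R by (auto simp: r_def real_le_rsqrt real_le_lsqrt)
    define G where "G = {y \<in> P. {9..16} \<subseteq> {c. vector [r\<^sup>2, c] \<in> ?E y}}"
    have "card (P - G) \<le> N"
    proof -
      have "P - G = {y \<in> P. \<not> {9..16} \<subseteq> {c. vector [r\<^sup>2, c] \<in> ?E y}}" by (auto simp: G_def)
      then show ?thesis
        using card_bad_caps_le[OF R r _ _ P near[OF _ r], of N] N[OF r] by simp
    qed
    moreover have "card (P - G) = card P - card G"
      using P(1) by (intro card_Diff_subset) (auto simp: G_def intro: finite_subset)
    ultimately have cG: "real (card P) - real N \<le> real (card G)" by linarith
    have "ennreal (7 * (real (card P) - real N)) \<le> ennreal (7 * real (card G))"
      using cG by (intro ennreal_leI) simp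
    also have "\<dots> = (\<Sum>y\<in>G. ennreal 7)"
      by (simp add: ennreal_mult'' mult.commute ennreal_of_nat_eq_real_of_nat)
    also have "\<dots> \<le> (\<Sum>y\<in>G. ?s y a)"
    proof (rule sum_mono)
      fix y assume y: "y \<in> G"
      have "closed {c. vector [a, c] \<in> ?E y}"
      proof -
        have "closed ((\<lambda>c. vector [a, c] :: real^2) -` ?E y)"
          using continuous_on_closed_vimage[of UNIV "\<lambda>c. vector [a, c] :: real^2"] comp
          by (simp add: continuous_on_vector_2 compact_imp_closed continuous_on_const continuous_on_id)
        then show ?thesis by (simp add: vimage_def)
      qed
      then have "emeasure lborel {9..16::real} \<le> ?s y a"
        using y by (intro emeasure_mono) (auto simp: G_def ar)
      then show "ennreal 7 \<le> ?s y a" by simp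
    qed
    also have "\<dots> \<le> (\<Sum>y\<in>P. ?s y a)"
      using P(1) by (intro sum_mono2) (auto simp: G_def)
    finally show ?thesis using a by simp
  qed simp
  have "ennreal (21 * R\<^sup>2 * (real (card P) - real N))
      = ennreal (7 * (real (card P) - real N)) * emeasure lborel {R\<^sup>2..(2*R)\<^sup>2}"
    using True R by (simp add: power_mult_distrib ennreal_mult'[symmetric] algebra_simps)
  also have "\<dots> = (\<integral>\<^sup>+a. ennreal (7 * (real (card P) - real N)) * indicator {R\<^sup>2..(2*R)\<^sup>2} a \<partial>lborel)"
    by (simp add: nn_integral_cmult_indicator)
  also have "\<dots> \<le> (\<integral>\<^sup>+a. (\<Sum>y\<in>P. ?s y a) \<partial>lborel)"
    by (rule nn_integral_mono) (use slice in simp)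
  also have "\<dots> = (\<Sum>y\<in>P. \<integral>\<^sup>+a. ?s y a \<partial>lborel)"
  proof (rule nn_integral_sum)
    fix y
    show "?s y \<in> borel_measurable lborel"
      by (rule emeasure_real2_slices) (simp add: comp compact_imp_closed)
  qed
  also have "\<dots> = (\<Sum>y\<in>P. emeasure lborel (?E y))"
    by (intro sum.cong refl emeasure_real2_slices(1)[symmetric] compact_imp_closed comp)
  also have "\<dots> = (\<Sum>y\<in>P. ennreal (measure lebesgue (?E y)))"
  proof (intro sum.cong refl)
    fix y
    have b: "?E y \<in> sets borel" using comp by (simp add: borel_compact)
    then have "measure lebesgue (?E y) = measure lborel (?E y)"
      by (simp add: measure_completion)
    then show "emeasure lborel (?E y) = ennreal (measure lebesgue (?E y))"
      using emeasure_compact_finite[OF comp] by (simp add: emeasure_eq_ennreal_measure less_top[symmetric])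
  qed
  also have "\<dots> = ennreal (\<Sum>y\<in>P. measure lebesgue (?E y))"
    by (simp add: sum_ennreal)
  finally show ?thesis
    by (simp add: ennreal_le_iff sum_nonneg)
qed

section \<open>Calculus of \<open>C\<^sup>k\<close> maps\<close>

lemma frechet_derivative_cong_open:
  assumes "open S" "x \<in> S" "\<And>y. y \<in> S \<Longrightarrow> f y = g y"
  shows "frechet_derivative f (at x) = frechet_derivative g (at x)"
proof -
  have "(f has_derivative D) (at x) = (g has_derivative D) (at x)" for D
    using has_derivative_transform_within_open[of f D x UNIV S g]
      has_derivative_transform_within_open[of g D x UNIV S f] assms by auto
  then show ?thesis by (simp add: frechet_derivative_def)
qed

lemma differentiable_on_cong_open:
  assumes "open S" "f differentiable_on S" "\<And>y. y \<in> S \<Longrightarrow> f y = g y"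
  shows "g differentiable_on S"
  using assms has_derivative_transform_within_open[of f _ _ UNIV S g]
  by (auto simp: differentiable_on_eq_differentiable_at differentiable_def) blast

lemma Ck_on_cong:
  assumes "open S" "\<And>x. x \<in> S \<Longrightarrow> f x = g x"
  shows "Ck_on k S f \<longleftrightarrow> Ck_on k S g"
  using assms(2)
proof (induction k arbitrary: f g)
  case 0
  then show ?case by (simp cong: continuous_on_cong)
next
  case (Suc k)
  have "f differentiable_on S \<longleftrightarrow> g differentiable_on S"
    using differentiable_on_cong_open[OF assms(1), of f g] differentiable_on_cong_open[OF assms(1), of g f]
      Suc.prems by auto
  moreover have "Ck_on k S (\<lambda>x. frechet_derivative f (at x) v) \<longleftrightarrow>
      Ck_on k S (\<lambda>x. frechet_derivative g (at x) v)" for v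
    using frechet_derivative_cong_open[OF assms(1) _ Suc.prems] by (intro Suc.IH) auto
  ultimately show ?case by simp
qed

lemma has_derivative_linear_comp:
  assumes "bounded_linear S" "bounded_linear T" "(X has_derivative D) (at (S u))"
  shows "((\<lambda>u. T (X (S u))) has_derivative (\<lambda>h. T (D (S h)))) (at u)"
  using bounded_linear.has_derivative[OF assms(2)
      has_derivative_compose[OF bounded_linear_imp_has_derivative[OF assms(1)] assms(3)]] .

lemma frechet_derivative_linear_comp:
  assumes "bounded_linear S" "bounded_linear T" "X differentiable (at (S u))"
  shows "frechet_derivative (\<lambda>u. T (X (S u))) (at u) h = T (frechet_derivative X (at (S u)) (S h))"
  using has_derivative_linear_comp[OF assms(1,2) iffD1[OF frechet_derivative_works assms(3)]]
  by (simp add: frechet_derivative_at[symmetric])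

text \<open>A directional derivative of \<open>T \<circ> X \<circ> S\<close> has the same form, with
  \<open>X\<close> replaced by one of its directional derivatives, so the induction runs over all
  \<open>X\<close>.\<close>

lemma Ck_on_linear_comp:
  assumes S: "bounded_linear S" and T: "bounded_linear T" and W: "open W" and X: "Ck_on k W X"
  shows "Ck_on k (S -` W) (\<lambda>u. T (X (S u)))"
  using X
proof (induction k arbitrary: X)
  case 0
  have "continuous_on (S -` W) S" using S by (simp add: linear_continuous_on)
  then have "continuous_on (S -` W) (\<lambda>u. X (S u))"
    by (rule continuous_on_compose2[OF 0[unfolded Ck_on.simps]]) auto
  then show ?case using bounded_linear.continuous_on[OF T] by simp
next
  case (Suc k)
  have opn: "open (S -` W)"
    using S W by (simp add: linear_continuous_on open_vimage)
  have d: "X differentiable (at (S u))" if "u \<in> S -` W" for u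
    using Suc.prems that W by (auto simp: differentiable_on_eq_differentiable_at)
  have "(\<lambda>u. T (X (S u))) differentiable (at u)" if "u \<in> S -` W" for u
    using has_derivative_linear_comp[OF S T iffD1[OF frechet_derivative_works d[OF that]]]
    by (auto simp: differentiable_def)
  then have "(\<lambda>u. T (X (S u))) differentiable_on (S -` W)"
    using opn by (simp add: differentiable_on_eq_differentiable_at)
  moreover have "Ck_on k (S -` W) (\<lambda>u. frechet_derivative (\<lambda>u. T (X (S u))) (at u) v)" for v
  proof -
    have "Ck_on k (S -` W) (\<lambda>u. T (frechet_derivative X (at (S u)) (S v)))"
      using Suc.prems by (intro Suc.IH) simp
    then show ?thesis
      using frechet_derivative_linear_comp[OF S T d] by (subst Ck_on_cong[OF opn]) auto
  qed
  ultimately show ?case by simp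
qed

section \<open>Symmetry of second derivatives\<close>

lemma has_real_derivative_line:
  fixes f :: "'a::real_normed_vector \<Rightarrow> real"
  assumes "(f has_derivative D) (at (u + t *\<^sub>R w))"
  shows "((\<lambda>t. f (u + t *\<^sub>R w)) has_real_derivative D w) (at t)"
  using has_derivative_line[OF assms] by (simp add: has_real_derivative_iff_has_vector_derivative)

text \<open>Two mean value steps: first along \<open>v\<close> for the increment of \<open>f\<close>
  in direction \<open>w\<close>, then along \<open>w\<close> for the derivative in direction
  \<open>v\<close>.\<close>

lemma second_difference_mvt:
  fixes f :: "'a::real_normed_vector \<Rightarrow> real"
  assumes U: "open U" "Ck_on (Suc (Suc 0)) U f" and t: "t > 0"
    and box: "\<And>s r. \<bar>s\<bar> \<le> t \<Longrightarrow> \<bar>r\<bar> \<le> t \<Longrightarrow> a + s *\<^sub>R v + r *\<^sub>R w \<in> U"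
  shows "\<exists>s r. 0 < s \<and> s < t \<and> 0 < r \<and> r < t \<and>
    f (a + t *\<^sub>R v + t *\<^sub>R w) - f (a + t *\<^sub>R v) - f (a + t *\<^sub>R w) + f a
      = t * (t * frechet_derivative (\<lambda>x. frechet_derivative f (at x) v) (at (a + s *\<^sub>R v + r *\<^sub>R w)) w)"
proof -
  note d = Ck_on_2D[OF U(2,1)]
  let ?d = "\<lambda>x. frechet_derivative f (at x) v"
  have A: "((\<lambda>s. f (a + s *\<^sub>R v + c)) has_real_derivative ?d (a + s *\<^sub>R v + c)) (at s)"
    if "a + s *\<^sub>R v + c \<in> U" for s c
    using has_real_derivative_line[OF d(1), of "a + c" s v] that by (simp add: ac_simps)
  have "\<exists>s. 0 < s \<and> s < t \<and> (f (a + t *\<^sub>R v + t *\<^sub>R w) - f (a + t *\<^sub>R v + 0))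
       - (f (a + 0 *\<^sub>R v + t *\<^sub>R w) - f (a + 0 *\<^sub>R v + 0))
     = (t - 0) * (?d (a + s *\<^sub>R v + t *\<^sub>R w) - ?d (a + s *\<^sub>R v + 0))"
    using t box[of _ t] box[of _ 0] by (intro MVT2 DERIV_diff A) auto
  then obtain s where s: "0 < s" "s < t"
    "f (a + t *\<^sub>R v + t *\<^sub>R w) - f (a + t *\<^sub>R v) - f (a + t *\<^sub>R w) + f a
     = t * (?d (a + s *\<^sub>R v + t *\<^sub>R w) - ?d (a + s *\<^sub>R v))" by auto
  have "\<exists>r. 0 < r \<and> r < t \<and> ?d (a + s *\<^sub>R v + t *\<^sub>R w) - ?d (a + s *\<^sub>R v + 0 *\<^sub>R w)
     = (t - 0) * frechet_derivative ?d (at (a + s *\<^sub>R v + r *\<^sub>R w)) w"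
    using t s box[of s] by (intro MVT2 has_real_derivative_line d(2)) auto
  then show ?thesis using s by auto
qed

text \<open>The second difference is symmetric in \<open>v\<close> and \<open>w\<close>. Evaluated
  in both orders it equals \<open>t^2\<close> times either mixed derivative at a point near
  \<open>a\<close>, and continuity forces the two to agree at \<open>a\<close>.\<close>

lemma mixed_derivatives_commute_real:
  fixes f :: "'a::real_normed_vector \<Rightarrow> real"
  assumes U: "open U" "Ck_on (Suc (Suc 0)) U f" and a: "a \<in> U"
  shows "frechet_derivative (\<lambda>x. frechet_derivative f (at x) v) (at a) w
       = frechet_derivative (\<lambda>x. frechet_derivative f (at x) w) (at a) v"
proof (rule ccontr)
  define A where "A v w x = frechet_derivative (\<lambda>x. frechet_derivative f (at x) v) (at x) w" for v w x
  assume "\<not> ?thesis"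
  then have ne: "A v w a \<noteq> A w v a" by (simp add: A_def)
  define e where "e = \<bar>A v w a - A w v a\<bar> / 2"
  have e: "e > 0" using ne by (simp add: e_def)
  have "continuous_on U (A v w)" "continuous_on U (A w v)"
    unfolding A_def by (intro Ck_on_2D(3)[OF U(2,1) a])+
  then have "\<forall>\<^sub>F x in at a. dist (A v w x) (A v w a) < e" "\<forall>\<^sub>F x in at a. dist (A w v x) (A w v a) < e"
    using U(1) a e by (auto simp: continuous_on_eq_continuous_at isCont_def tendsto_iff)
  moreover have "\<forall>\<^sub>F x in at a. x \<in> U"
    using U(1) a eventually_at_in_open' by blast
  ultimately have "\<forall>\<^sub>F x in at a. x \<in> U \<and> dist (A v w x) (A v w a) < e \<and> dist (A w v x) (A w v a) < e"
    by eventually_elim auto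
  then obtain \<delta> where \<delta>: "\<delta> > 0" "\<And>x. dist x a < \<delta> \<Longrightarrow>
      x \<in> U \<and> dist (A v w x) (A v w a) < e \<and> dist (A w v x) (A w v a) < e"
    using e a unfolding eventually_at by (metis UNIV_I dist_self)
  define t where "t = \<delta> / (2 * (norm v + norm w + 1))"
  have nn: "norm v + norm w + 1 > 0" by (simp add: add_nonneg_pos)
  have t: "t > 0" using \<delta>(1) nn by (simp add: t_def)
  have close: "dist (a + s *\<^sub>R x + r *\<^sub>R y) a < \<delta>"
    if "\<bar>s\<bar> \<le> t" "\<bar>r\<bar> \<le> t" "norm x + norm y = norm v + norm w" for s r x y
  proof -
    have "norm (s *\<^sub>R x + r *\<^sub>R y) \<le> \<bar>s\<bar> * norm x + \<bar>r\<bar> * norm y"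
      using norm_triangle_ineq[of "s *\<^sub>R x" "r *\<^sub>R y"] by simp
    also have "\<dots> \<le> t * norm x + t * norm y"
      using that by (intro add_mono mult_right_mono) auto
    also have "\<dots> = t * (norm v + norm w)" using that(3) by (metis distrib_left)
    also have "\<dots> < t * (2 * (norm v + norm w + 1))"
    proof -
      have "n < 2 * (n + 1)" if "n \<ge> 0" for n :: real
        using that by simp
      from this[of "norm v + norm w"] have "norm v + norm w < 2 * (norm v + norm w + 1)"
        by simp
      then show ?thesis using t by (rule mult_strict_left_mono)
    qed
    also have "\<dots> = \<delta>" using nn by (simp add: t_def)
    finally show ?thesis by (simp add: dist_norm add.assoc)
  qed
  have 1: "a + s *\<^sub>R v + r *\<^sub>R w \<in> U" if "\<bar>s\<bar> \<le> t" "\<bar>r\<bar> \<le> t" for s r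
    using close[OF that] \<delta>(2) by simp
  have 2: "a + s *\<^sub>R w + r *\<^sub>R v \<in> U" if "\<bar>s\<bar> \<le> t" "\<bar>r\<bar> \<le> t" for s r
    using close[OF that] \<delta>(2) by (simp add: add.commute)
  obtain s r where sr: "0 < s" "s < t" "0 < r" "r < t"
    "f (a + t *\<^sub>R v + t *\<^sub>R w) - f (a + t *\<^sub>R v) - f (a + t *\<^sub>R w) + f a = t * (t * A v w (a + s *\<^sub>R v + r *\<^sub>R w))"
    using second_difference_mvt[OF U t 1] unfolding A_def by blast
  obtain s' r' where sr': "0 < s'" "s' < t" "0 < r'" "r' < t"
    "f (a + t *\<^sub>R w + t *\<^sub>R v) - f (a + t *\<^sub>R w) - f (a + t *\<^sub>R v) + f a = t * (t * A w v (a + s' *\<^sub>R w + r' *\<^sub>R v))"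
    using second_difference_mvt[OF U t 2] unfolding A_def by blast
  have sw: "a + t *\<^sub>R w + t *\<^sub>R v = a + t *\<^sub>R v + t *\<^sub>R w" by simp
  have "t * (t * A v w (a + s *\<^sub>R v + r *\<^sub>R w)) = t * (t * A w v (a + s' *\<^sub>R w + r' *\<^sub>R v))"
    using sr(5) sr'(5) unfolding sw by linarith
  then have "A v w (a + s *\<^sub>R v + r *\<^sub>R w) = A w v (a + s' *\<^sub>R w + r' *\<^sub>R v)"
    using t by simp
  moreover have "dist (A v w (a + s *\<^sub>R v + r *\<^sub>R w)) (A v w a) < e"
    using \<delta>(2) close[of s r v w] sr by simp
  moreover have "dist (A w v (a + s' *\<^sub>R w + r' *\<^sub>R v)) (A w v a) < e"
    using \<delta>(2) close[of s' r' w v] sr' by simp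
  ultimately show False
    by (auto simp: e_def dist_real_def abs_if split: if_splits)
qed

lemma mixed_derivatives_commute:
  fixes f :: "'a::real_normed_vector \<Rightarrow> 'b::euclidean_space"
  assumes U: "open U" "Ck_on (Suc (Suc 0)) U f" and a: "a \<in> U"
  shows "frechet_derivative (\<lambda>x. frechet_derivative f (at x) v) (at a) w
       = frechet_derivative (\<lambda>x. frechet_derivative f (at x) w) (at a) v"
proof (rule euclidean_eqI)
  fix b :: 'b
  have bl: "bounded_linear (\<lambda>x::'a. x)" "bounded_linear (\<lambda>y. y \<bullet> b)"
    by (simp_all add: bounded_linear_ident bounded_linear_inner_left)
  have "Ck_on (Suc (Suc 0)) U (\<lambda>x. f x \<bullet> b)"
    using Ck_on_linear_comp[OF bl U] by simp
  note * = mixed_derivatives_commute_real[OF U(1) this a, of v w]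
  have d: "f differentiable (at x)" "(\<lambda>x. frechet_derivative f (at x) v) differentiable (at x)" if "x \<in> U" for x v
    using Ck_on_2D[OF U(2,1) that] by (auto simp: differentiable_def)
  have 1: "frechet_derivative (\<lambda>x. f x \<bullet> b) (at x) v = frechet_derivative f (at x) v \<bullet> b" if "x \<in> U" for x v
    using frechet_derivative_linear_comp[OF bl d(1)[OF that]] by simp
  have 2: "frechet_derivative (\<lambda>x. frechet_derivative (\<lambda>x. f x \<bullet> b) (at x) v) (at a) w
     = frechet_derivative (\<lambda>x. frechet_derivative f (at x) v) (at a) w \<bullet> b" for v w
    using frechet_derivative_cong_open[OF U(1) a 1] frechet_derivative_linear_comp[OF bl d(2)[OF a]] by simp
  show "frechet_derivative (\<lambda>x. frechet_derivative f (at x) v) (at a) w \<bullet> b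
       = frechet_derivative (\<lambda>x. frechet_derivative f (at x) w) (at a) v \<bullet> b"
    using * unfolding 2 .
qed

section \<open>C1 functions and cutoffs\<close>

lemma C1I:
  assumes "open S" "\<And>x. x \<in> S \<Longrightarrow> (f has_derivative D x) (at x)" "\<And>v. continuous_on S (\<lambda>x. D x v)"
  shows "Ck_on (Suc 0) S f"
proof -
  have "frechet_derivative f (at x) = D x" if "x \<in> S" for x
    using frechet_derivative_at[OF assms(2)[OF that]] by simp
  then have "continuous_on S (\<lambda>x. frechet_derivative f (at x) v)" for v
    by (intro continuous_on_eq[OF assms(3)[of v]]) auto
  moreover have "f differentiable_on S"
    using assms(1,2) by (auto simp: differentiable_on_eq_differentiable_at differentiable_def)
  ultimately show ?thesis by simp
qed

lemma C1D:
  assumes "Ck_on (Suc 0) S f" "open S"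
  shows "x \<in> S \<Longrightarrow> (f has_derivative frechet_derivative f (at x)) (at x)"
    "continuous_on S (\<lambda>x. frechet_derivative f (at x) v)" "continuous_on S f"
  using assms Ck_on_continuous[OF assms(1)]
  by (auto simp: differentiable_on_eq_differentiable_at simp flip: frechet_derivative_works)

lemma C1_scaleR:
  fixes f :: "'a::real_normed_vector \<Rightarrow> real"
  assumes "open S" "Ck_on (Suc 0) S f" "Ck_on (Suc 0) S Z"
  shows "Ck_on (Suc 0) S (\<lambda>x. f x *\<^sub>R Z x)"
proof (rule C1I[OF assms(1)])
  fix x assume "x \<in> S"
  show "((\<lambda>x. f x *\<^sub>R Z x) has_derivative
      (\<lambda>h. f x *\<^sub>R frechet_derivative Z (at x) h + frechet_derivative f (at x) h *\<^sub>R Z x)) (at x)"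
    by (intro has_derivative_scaleR C1D(1)[OF assms(2,1)] C1D(1)[OF assms(3,1)] \<open>x \<in> S\<close>)
qed (intro continuous_intros C1D[OF assms(2,1)] C1D[OF assms(3,1)])

lemma C1_inverse:
  fixes f :: "'a::real_normed_vector \<Rightarrow> real"
  assumes "open S" "Ck_on (Suc 0) S f" "\<And>x. x \<in> S \<Longrightarrow> f x \<noteq> 0"
  shows "Ck_on (Suc 0) S (\<lambda>x. inverse (f x))"
proof (rule C1I[OF assms(1)])
  fix x assume "x \<in> S"
  show "((\<lambda>x. inverse (f x)) has_derivative
      (\<lambda>h. - (inverse (f x) * frechet_derivative f (at x) h * inverse (f x)))) (at x)"
    by (intro Deriv.has_derivative_inverse C1D(1)[OF assms(2,1)] \<open>x \<in> S\<close> assms(3))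
qed (use assms(3) in \<open>intro continuous_intros C1D[OF assms(2,1)], auto\<close>)

lemma C1_sum:
  assumes "open S" "\<And>i. i \<in> I \<Longrightarrow> Ck_on (Suc 0) S (f i)"
  shows "Ck_on (Suc 0) S (\<lambda>x. \<Sum>i\<in>I. f i x)"
proof (rule C1I[OF assms(1)])
  fix x assume "x \<in> S"
  show "((\<lambda>x. \<Sum>i\<in>I. f i x) has_derivative (\<lambda>h. \<Sum>i\<in>I. frechet_derivative (f i) (at x) h)) (at x)"
    by (intro has_derivative_sum C1D(1)[OF assms(2,1)] \<open>x \<in> S\<close>)
qed (intro continuous_intros C1D[OF assms(2,1)])

lemma C1_Un:
  assumes "open S" "open T" "Ck_on (Suc 0) S f" "Ck_on (Suc 0) T f"
  shows "Ck_on (Suc 0) (S \<union> T) f"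
proof (rule C1I[of _ _ "\<lambda>x. frechet_derivative f (at x)"])
  fix x assume "x \<in> S \<union> T"
  then show "(f has_derivative frechet_derivative f (at x)) (at x)"
    using C1D(1)[OF assms(3,1)] C1D(1)[OF assms(4,2)] by auto
qed (intro open_Un assms continuous_on_open_Un C1D(2)[OF assms(3,1)] C1D(2)[OF assms(4,2)])+

text \<open>The square of the positive part is the profile of the bumps and of the radial cutoff.
  The first variation differentiates a field once, so C1 is the regularity to aim for.\<close>

lemma max_0_square_has_real_derivative:
  "((\<lambda>t::real. (max 0 t)\<^sup>2) has_real_derivative 2 * max 0 t) (at t)"
proof -
  consider "t > 0" | "t < 0" | "t = 0" by linarith
  then show ?thesis
  proof cases
    case 1
    have "((\<lambda>t::real. t\<^sup>2) has_real_derivative 2 * t) (at t)"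
      by (auto intro!: derivative_eq_intros)
    then have "((\<lambda>t::real. (max 0 t)\<^sup>2) has_real_derivative 2 * t) (at t)"
      by (rule has_field_derivative_transform_within_open[where S="{0<..}"]) (use 1 in auto)
    then show ?thesis using 1 by simp
  next
    case 2
    have "((\<lambda>t::real. 0) has_real_derivative 0) (at t)" by simp
    then have "((\<lambda>t::real. (max 0 t)\<^sup>2) has_real_derivative 0) (at t)"
      by (rule has_field_derivative_transform_within_open[where S="{..<0}"]) (use 2 in auto)
    then show ?thesis using 2 by simp
  next
    case 3
    have "((\<lambda>h. ((max 0 (0 + h))\<^sup>2 - (max 0 0)\<^sup>2) / h) \<longlongrightarrow> 0) (at (0::real))"
    proof (rule Lim_null_comparison)
      show "\<forall>\<^sub>F h in at (0::real). norm (((max 0 (0 + h))\<^sup>2 - (max 0 0)\<^sup>2) / h) \<le> \<bar>h\<bar>"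
        by (rule always_eventually) (auto simp: max_def power2_eq_square)
      show "((\<lambda>h. \<bar>h\<bar>) \<longlongrightarrow> 0) (at (0::real))"
        using tendsto_rabs[OF tendsto_ident_at, of "0::real" UNIV] by simp
    qed
    then show ?thesis using 3 by (simp add: DERIV_def)
  qed
qed

lemma C1_bump:
  fixes x :: "'a::real_inner"
  shows "Ck_on (Suc 0) UNIV (\<lambda>y. (max 0 (r - (y - x) \<bullet> (y - x)))\<^sup>2)"
proof (rule C1I[OF open_UNIV])
  fix y
  have 1: "((\<lambda>y. r - (y - x) \<bullet> (y - x)) has_derivative (\<lambda>h. - (2 * ((y - x) \<bullet> h)))) (at y)"
    by (auto intro!: derivative_eq_intros simp: inner_commute)
  show "((\<lambda>y. (max 0 (r - (y - x) \<bullet> (y - x)))\<^sup>2) has_derivative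
      (\<lambda>h. 2 * max 0 (r - (y - x) \<bullet> (y - x)) * - (2 * ((y - x) \<bullet> h)))) (at y)"
    using has_derivative_compose[OF 1 max_0_square_has_real_derivative[unfolded has_field_derivative_def]] .
qed (intro continuous_intros)

lemma has_derivative_eq_0_outside:
  assumes D: "(Z has_derivative D) (at x)" and C: "closed C" "x \<notin> C" and Z: "\<And>y. y \<notin> C \<Longrightarrow> Z y = 0"
  shows "D = (\<lambda>h. 0)"
proof -
  have "((\<lambda>y. 0) has_derivative D) (at x)"
    by (rule has_derivative_transform_within_open[OF D, where s="- C"]) (use C Z in auto)
  then show ?thesis using has_derivative_unique[OF _ has_derivative_const] by blast
qed

section \<open>Integration by parts in a parametrized patch\<close>

lemma integral_translation_invariant:
  fixes Y :: "'a::euclidean_space \<Rightarrow> real"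
  assumes "integrable lborel Y"
  shows "integrable lborel (\<lambda>u. Y (u + c))" "integral\<^sup>L lborel (\<lambda>u. Y (u + c)) = integral\<^sup>L lborel Y"
proof -
  have m: "(\<lambda>u. u + c) \<in> measurable lborel borel" by simp
  have d: "distr lborel borel (\<lambda>u. u + c) = lborel"
  proof -
    have "(\<lambda>u. u + c) = (+) c" by (simp add: fun_eq_iff add.commute)
    then show ?thesis using lborel_distr_plus[of c] by simp
  qed
  have Ym: "Y \<in> borel_measurable borel" using assms by auto
  show "integrable lborel (\<lambda>u. Y (u + c))"
    using integrable_distr_eq[OF m Ym] assms by (simp add: d)
  show "integral\<^sup>L lborel (\<lambda>u. Y (u + c)) = integral\<^sup>L lborel Y"
    using integral_distr[OF m Ym] by (simp add: d)
qed

text \<open>Difference quotients of a compactly supported function integrate to 0 by translation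
  invariance, and they converge to the derivative under a common integrable bound.\<close>

lemma integral_directional_derivative_eq_0:
  fixes Y :: "'a::euclidean_space \<Rightarrow> real"
  assumes D: "\<And>u. (Y has_derivative D u) (at u)" and cont: "continuous_on UNIV (\<lambda>u. D u e)"
    and Q: "compact Q" "\<And>u. u \<notin> Q \<Longrightarrow> Y u = 0"
  shows "integrable lborel (\<lambda>u. D u e)" "integral\<^sup>L lborel (\<lambda>u. D u e) = 0"
proof -
  have contY: "continuous_on UNIV Y"
    using D by (intro continuous_at_imp_continuous_on ballI has_derivative_continuous)
  have D0: "D u e = 0" if "u \<notin> Q" for u
  proof -
    have "((\<lambda>u. 0) has_derivative D u) (at u)"
      by (rule has_derivative_transform_within_open[OF D, where s="- Q"])
        (use that Q compact_imp_closed in auto)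
    then have "D u = (\<lambda>h. 0)" using has_derivative_unique[OF _ has_derivative_const] by blast
    then show ?thesis by simp
  qed
  have "compact ((\<lambda>u. D u e) ` Q)"
    using cont Q by (meson compact_continuous_image continuous_on_subset subset_UNIV)
  then have "bounded ((\<lambda>u. D u e) ` Q)" by (rule compact_imp_bounded)
  then obtain B where B: "\<And>u. u \<in> Q \<Longrightarrow> \<bar>D u e\<bar> \<le> B"
    by (auto simp: bounded_real)
  have B': "\<bar>D u e\<bar> \<le> max B 0" for u
    using B[of u] D0[of u] by (cases "u \<in> Q") auto
  obtain r where r: "\<And>u. u \<in> Q \<Longrightarrow> norm u \<le> r"
    using compact_imp_bounded[OF Q(1)] by (auto simp: bounded_iff)
  have "integrable lborel (\<lambda>u. indicator Q u *\<^sub>R Y u)"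
    by (rule borel_integrable_compact) (use Q contY in \<open>auto intro: continuous_on_subset\<close>)
  also have "(\<lambda>u. indicator Q u *\<^sub>R Y u) = Y"
    using Q(2) by (fastforce simp: indicator_def fun_eq_iff)
  finally have intY: "integrable lborel Y" .
  define s where "s k u = (Y (u + (1 / real (Suc k)) *\<^sub>R e) - Y u) * real (Suc k)" for k u
  have int_s: "integral\<^sup>L lborel (s k) = 0" for k
    unfolding s_def using integral_translation_invariant[OF intY] intY by simp
  have line: "((\<lambda>t. Y (u + t *\<^sub>R e)) has_real_derivative D (u + t *\<^sub>R e) e) (at t)" for u t
    by (rule has_real_derivative_line[OF D])
  have mvt: "\<exists>z. 0 < z \<and> z < 1 / real (Suc k) \<and> s k u = D (u + z *\<^sub>R e) e" for k u
  proof -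
    have "\<exists>z>0. z < 1 / real (Suc k) \<and> Y (u + (1 / real (Suc k)) *\<^sub>R e) - Y (u + 0 *\<^sub>R e)
        = (1 / real (Suc k) - 0) * D (u + z *\<^sub>R e) e"
      by (intro MVT2 line) simp
    then show ?thesis by (auto simp: s_def)
  qed
  have s0: "norm u \<le> r + norm e" if "s k u \<noteq> 0" for k u
  proof -
    obtain z where z: "0 < z" "z < 1 / real (Suc k)" "s k u = D (u + z *\<^sub>R e) e"
      using mvt by blast
    then have "norm (u + z *\<^sub>R e) \<le> r" using that D0 r by metis
    moreover have "1 / real (Suc k) \<le> 1" by simp
    then have "\<bar>z\<bar> \<le> 1" using z(1,2) by linarith
    then have "\<bar>z\<bar> * norm e \<le> 1 * norm e" by (intro mult_right_mono) auto
    ultimately show ?thesis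
      using norm_triangle_ineq4[of "u + z *\<^sub>R e" "z *\<^sub>R e"] by simp
  qed
  have lim: "(\<lambda>k. s k u) \<longlonglongrightarrow> D u e" for u
  proof -
    have "((\<lambda>h. (Y (u + h *\<^sub>R e) - Y u) / h) \<longlongrightarrow> D u e) (at 0)"
      using line[of u 0] by (simp add: DERIV_def)
    moreover have "filterlim (\<lambda>k. 1 / real (Suc k)) (at 0) sequentially"
      unfolding filterlim_at
      using LIMSEQ_Suc[OF lim_const_over_n[of 1]] by (auto simp: eventually_sequentially)
    ultimately have "(\<lambda>k. (Y (u + (1 / real (Suc k)) *\<^sub>R e) - Y u) / (1 / real (Suc k))) \<longlonglongrightarrow> D u e"
      by (rule filterlim_compose)
    then show ?thesis by (simp add: s_def)
  qed
  have meas: "(\<lambda>u. D u e) \<in> borel_measurable lborel" "s k \<in> borel_measurable lborel" for k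
  proof -
    show "(\<lambda>u. D u e) \<in> borel_measurable lborel"
      using cont by (simp add: borel_measurable_continuous_onI)
    have "continuous_on UNIV (s k)" unfolding s_def
      by (intro continuous_intros continuous_on_compose2[OF contY]) auto
    then show "s k \<in> borel_measurable lborel" by (simp add: borel_measurable_continuous_onI)
  qed
  \<comment> \<open>By the mean value theorem each difference quotient is a value of the derivative
    at a point at distance at most \<open>norm e\<close>, so all of them share one bound and one
    ball containing their supports.\<close>
  have w: "integrable lborel (\<lambda>u::'a. max B 0 * indicator (cball 0 (r + norm e)) u)"
    using emeasure_lborel_cball_finite[of 0 "r + norm e"]
    by (intro integrable_mult_right integrable_real_indicator) auto
  have bound: "AE u in lborel. norm (s k u) \<le> max B 0 * indicator (cball 0 (r + norm e)) u" for k
  proof (rule AE_I2)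
    fix u
    show "norm (s k u) \<le> max B 0 * indicator (cball 0 (r + norm e)) u"
    proof (cases "s k u = 0")
      case False
      then have "u \<in> cball 0 (r + norm e)" using s0 by simp
      moreover have "\<bar>s k u\<bar> \<le> max B 0" using mvt[of k u] B' by metis
      ultimately show ?thesis by simp
    qed simp
  qed
  note dom = meas(1) meas(2) w AE_I2[of lborel, OF lim] bound
  show "integrable lborel (\<lambda>u. D u e)"
    by (rule integrable_dominated_convergence[OF dom])
  have "(\<lambda>k. integral\<^sup>L lborel (s k)) \<longlonglongrightarrow> integral\<^sup>L lborel (\<lambda>u. D u e)"
    by (rule integral_dominated_convergence[OF dom])
  then show "integral\<^sup>L lborel (\<lambda>u. D u e) = 0"
    by (simp add: int_s LIMSEQ_const_iff)
qed

text \<open>Extension by zero: \<open>Q\<close> is compact inside \<open>U\<close>, so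
  \<open>U\<close> and the complement of \<open>Q\<close> are open and cover the space, and the
  extended function is differentiable on each of them.\<close>

lemma integral_directional_derivative_patch_eq_0:
  fixes Y :: "'a::euclidean_space \<Rightarrow> real"
  assumes U: "open U" and D: "\<And>u. u \<in> U \<Longrightarrow> (Y has_derivative D u) (at u)"
    and cont: "continuous_on U (\<lambda>u. D u e)"
    and Q: "compact Q" "Q \<subseteq> U" "\<And>u. u \<in> U - Q \<Longrightarrow> Y u = 0"
  defines "g \<equiv> \<lambda>u. if u \<in> U then D u e else 0"
  shows "integrable lborel g" "integral\<^sup>L lborel g = 0"
proof -
  define Y' where "Y' u = (if u \<in> U then Y u else 0)" for u
  define D' where "D' u = (if u \<in> U then D u else (\<lambda>h. 0))" for u
  have opn: "open (- Q)" using Q(1) compact_imp_closed by blast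
  have zero: "(Y' has_derivative (\<lambda>h. 0)) (at u)" if "u \<notin> Q" for u
    by (rule has_derivative_transform_within_open[OF has_derivative_const opn])
      (use that Q(3) in \<open>auto simp: Y'_def\<close>)
  have inU: "(Y' has_derivative D u) (at u)" if "u \<in> U" for u
    by (rule has_derivative_transform_within_open[OF D[OF that] U that]) (simp add: Y'_def)
  have D': "(Y' has_derivative D' u) (at u)" for u
    using inU zero Q(2) by (auto simp: D'_def)
  have D'0: "D' u = (\<lambda>h. 0)" if "u \<notin> Q" for u
    using has_derivative_unique[OF D' zero[OF that]] .
  have g: "g = (\<lambda>u. D' u e)" by (auto simp: g_def D'_def)
  have "continuous_on (U \<union> - Q) (\<lambda>u. D' u e)"
  proof (rule continuous_on_open_Un[OF U opn])
    show "continuous_on U (\<lambda>u. D' u e)"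
      using cont by (rule continuous_on_eq) (simp add: D'_def)
    show "continuous_on (- Q) (\<lambda>u. D' u e)"
      by (rule continuous_on_eq[of _ "\<lambda>u. 0"]) (simp_all add: D'0)
  qed
  moreover have "U \<union> - Q = UNIV" using Q(2) by blast
  ultimately have c: "continuous_on UNIV (\<lambda>u. D' u e)" by simp
  have "Y' u = 0" if "u \<notin> Q" for u using that Q(3) by (simp add: Y'_def)
  then show "integrable lborel g" "integral\<^sup>L lborel g = 0"
    unfolding g using integral_directional_derivative_eq_0[OF D' c Q(1)] by auto
qed

section \<open>Shrinker patches and the first variation density\<close>

definition pd :: "2 \<Rightarrow> (real^2 \<Rightarrow> 'b::real_normed_vector) \<Rightarrow> real^2 \<Rightarrow> 'b" where
  "pd k f u = frechet_derivative f (at u) (axis k 1)"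

lemma real2_expand: "h = h $ 1 *\<^sub>R axis 1 1 + h $ 2 *\<^sub>R (axis 2 1 :: real^2)"
  by (simp add: vec_eq_iff forall_2 axis_def)

lemma has_derivative_pd:
  assumes "f differentiable (at u)"
  shows "(f has_derivative (\<lambda>h. h $ 1 *\<^sub>R pd 1 f u + h $ 2 *\<^sub>R pd 2 f u)) (at u)"
proof -
  have 1: "(f has_derivative frechet_derivative f (at u)) (at u)"
    using assms by (simp add: frechet_derivative_works)
  then have "linear (frechet_derivative f (at u))" by (simp add: has_derivative_linear)
  then have "frechet_derivative f (at u) h = h $ 1 *\<^sub>R pd 1 f u + h $ 2 *\<^sub>R pd 2 f u" for h
    unfolding pd_def by (subst real2_expand) (simp add: linear_add linear_cmul)
  then have "frechet_derivative f (at u) = (\<lambda>h. h $ 1 *\<^sub>R pd 1 f u + h $ 2 *\<^sub>R pd 2 f u)" by blast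
  with 1 show ?thesis by simp
qed

definition unit_normal :: "(real^2 \<Rightarrow> real^3) \<Rightarrow> real^2 \<Rightarrow> real^3" where
  "unit_normal X u = sgn (cross3 (pd 1 X u) (pd 2 X u))"

text \<open>The last conjunct is \<open>H = (X \<bullet> \<nu>) / 2\<close> in dimension two: the left hand side is
  \<open>H\<close> times the cross product of the coordinate tangent vectors.\<close>

definition shrinker_patch :: "(real^2) set \<Rightarrow> (real^2 \<Rightarrow> real^3) \<Rightarrow> bool" where
  "shrinker_patch U X \<longleftrightarrow> open U \<and> Ck_on (Suc (Suc 0)) U X \<and> Ck_on (Suc 0) U (unit_normal X) \<and>
     (\<forall>u\<in>U. cross3 (pd 1 X u) (pd 2 X u) \<noteq> 0 \<and>
       cross3 (pd 1 (unit_normal X) u) (pd 2 X u) + cross3 (pd 1 X u) (pd 2 (unit_normal X) u)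
         = ((X u \<bullet> unit_normal X u) / 2) *\<^sub>R cross3 (pd 1 X u) (pd 2 X u))"

text \<open>The density of the first variation of area along the field \<open>Z\<close>, with the area element
  \<open>norm (cross3 a b)\<close> included, corrected by the curvature term of a self-shrinker.\<close>

definition variation ::
  "(real^3 \<Rightarrow> real^3) \<Rightarrow> (real^3 \<Rightarrow> real^3 \<Rightarrow> real^3) \<Rightarrow> real^3 \<Rightarrow> real^3 \<Rightarrow> real^3 \<Rightarrow> real" where
  "variation Z DZ x a b =
     ((cross3 (DZ x a) b + cross3 a (DZ x b)) \<bullet> cross3 a b
       - (x \<bullet> cross3 a b) * (Z x \<bullet> cross3 a b) / 2) / norm (cross3 a b)"

abbreviation patch_variation ::
  "(real^3 \<Rightarrow> real^3) \<Rightarrow> (real^3 \<Rightarrow> real^3 \<Rightarrow> real^3) \<Rightarrow> (real^2 \<Rightarrow> real^3) \<Rightarrow> real^2 \<Rightarrow> real" where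
  "patch_variation Z DZ X u \<equiv> variation Z DZ (X u) (pd 1 X u) (pd 2 X u)"

lemma bounded_bilinear_cross3: "bounded_bilinear cross3"
  using bilinear_cross bilinear_conv_bounded_bilinear by blast

lemmas cross3_has_derivative [derivative_intros] = bounded_bilinear.FDERIV[OF bounded_bilinear_cross3]
lemmas cross3_continuous_on [continuous_intros] = bounded_bilinear.continuous_on[OF bounded_bilinear_cross3]

lemma shrinker_patchD:
  assumes "shrinker_patch U X" "u \<in> U"
  shows "(X has_derivative (\<lambda>h. h $ 1 *\<^sub>R pd 1 X u + h $ 2 *\<^sub>R pd 2 X u)) (at u)"
    and "(pd k X has_derivative (\<lambda>h. h $ 1 *\<^sub>R pd 1 (pd k X) u + h $ 2 *\<^sub>R pd 2 (pd k X) u)) (at u)"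
    and "(unit_normal X has_derivative
          (\<lambda>h. h $ 1 *\<^sub>R pd 1 (unit_normal X) u + h $ 2 *\<^sub>R pd 2 (unit_normal X) u)) (at u)"
    and "pd 1 (pd 2 X) u = pd 2 (pd 1 X) u"
  using assms
  by (auto simp: shrinker_patch_def differentiable_on_eq_differentiable_at pd_def[abs_def]
      intro!: has_derivative_pd[unfolded pd_def[abs_def]] mixed_derivatives_commute[where U=U])

lemma shrinker_patch_continuous:
  assumes "shrinker_patch U X"
  shows "continuous_on U X" "continuous_on U (pd k X)" "continuous_on U (pd j (pd k X))"
    "continuous_on U (unit_normal X)" "continuous_on U (pd k (unit_normal X))"
proof -
  show "continuous_on U X" "continuous_on U (unit_normal X)"
    using assms by (auto simp: shrinker_patch_def simp del: Ck_on.simps intro: Ck_on_continuous)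
  have "Ck_on (Suc 0) U (pd k X)"
    using assms by (simp add: shrinker_patch_def pd_def[abs_def])
  then show "continuous_on U (pd k X)" by (rule Ck_on_continuous)
  show "continuous_on U (pd j (pd k X))" "continuous_on U (pd k (unit_normal X))"
    using assms by (auto simp: shrinker_patch_def pd_def[abs_def])
qed

text \<open>The two groups are the product rule for the first partial derivative of
  \<open>cross3 Z X_2 \<bullet> \<nu>\<close> and the second partial derivative of
  \<open>cross3 X_1 Z \<bullet> \<nu>\<close>, so the density is a divergence in the parameters.
  Terms with second derivatives of \<open>X\<close> cancel by symmetry; those with derivatives of
  \<open>\<nu>\<close> combine to the curvature term through the shrinker equation.\<close>

lemma patch_variation_eq:
  assumes X: "shrinker_patch U X" "u \<in> U"
  shows "patch_variation Z DZ X u =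
    (cross3 (DZ (X u) (pd 1 X u)) (pd 2 X u) \<bullet> unit_normal X u
      + cross3 (Z (X u)) (pd 1 (pd 2 X) u) \<bullet> unit_normal X u
      + cross3 (Z (X u)) (pd 2 X u) \<bullet> pd 1 (unit_normal X) u)
    + (cross3 (pd 2 (pd 1 X) u) (Z (X u)) \<bullet> unit_normal X u
      + cross3 (pd 1 X u) (DZ (X u) (pd 2 X u)) \<bullet> unit_normal X u
      + cross3 (pd 1 X u) (Z (X u)) \<bullet> pd 2 (unit_normal X) u)"
proof -
  let ?\<nu> = "unit_normal X u" and ?a = "pd 1 X u" and ?b = "pd 2 X u" and ?Z = "Z (X u)"
  let ?N = "cross3 ?a ?b"
  have N: "?N \<noteq> 0" and H: "cross3 (pd 1 (unit_normal X) u) ?b + cross3 ?a (pd 2 (unit_normal X) u)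
         = ((X u \<bullet> ?\<nu>) / 2) *\<^sub>R ?N"
    using X by (auto simp: shrinker_patch_def)
  have \<nu>: "v \<bullet> ?\<nu> = (v \<bullet> ?N) / norm ?N" for v
    by (simp add: unit_normal_def sgn_div_norm divide_inverse)
  have B: "cross3 ?Z (pd 1 (pd 2 X) u) \<bullet> ?\<nu> + cross3 (pd 2 (pd 1 X) u) ?Z \<bullet> ?\<nu> = 0"
    using shrinker_patchD(4)[OF X] cross_skew[of ?Z "pd 2 (pd 1 X) u"] by simp
  have A: "cross3 ?Z ?b \<bullet> pd 1 (unit_normal X) u + cross3 ?a ?Z \<bullet> pd 2 (unit_normal X) u
     = - (?Z \<bullet> (cross3 (pd 1 (unit_normal X) u) ?b + cross3 ?a (pd 2 (unit_normal X) u)))"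
    by (simp add: cross3_simps)
  have "cross3 ?Z ?b \<bullet> pd 1 (unit_normal X) u + cross3 ?a ?Z \<bullet> pd 2 (unit_normal X) u
     = - ((X u \<bullet> ?N) * (?Z \<bullet> ?N) / 2 / norm ?N)"
    unfolding A H by (simp add: \<nu>)
  moreover have "patch_variation Z DZ X u = cross3 (DZ (X u) ?a) ?b \<bullet> ?\<nu> + cross3 ?a (DZ (X u) ?b) \<bullet> ?\<nu>
      - (X u \<bullet> ?N) * (?Z \<bullet> ?N) / 2 / norm ?N"
    unfolding variation_def \<nu> by (simp add: inner_add_left add_divide_distrib diff_divide_distrib)
  ultimately show ?thesis using B by linarith
qed

text \<open>The divergence form of the density integrates to 0 because both components of the field
  vanish off the compact set \<open>Q\<close>; \<open>D1\<close> and \<open>D2\<close> are the full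
  derivatives of these components.\<close>

lemma integral_patch_variation_eq_0:
  assumes X: "shrinker_patch U X"
    and Z: "\<And>x. (Z has_derivative DZ x) (at x)" "\<And>v. continuous_on UNIV (\<lambda>x. DZ x v)"
    and Q: "compact Q" "Q \<subseteq> U" "\<And>u. u \<in> U - Q \<Longrightarrow> Z (X u) = 0"
  defines "g \<equiv> \<lambda>u. if u \<in> U then patch_variation Z DZ X u else 0"
  shows "integrable lborel g" "integral\<^sup>L lborel g = 0"
proof -
  have U: "open U" using X by (simp add: shrinker_patch_def)
  note d = shrinker_patchD[OF X] and c = shrinker_patch_continuous[OF X]
  have lin: "linear (DZ x)" for x using Z(1) has_derivative_linear by blast
  have contZ: "continuous_on UNIV Z"
    using Z(1) by (intro continuous_at_imp_continuous_on ballI has_derivative_continuous)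
  have cZ: "continuous_on U (\<lambda>u. Z (X u))"
    by (rule continuous_on_compose2[OF contZ c(1)]) auto
  have cDZ: "continuous_on U (\<lambda>u. DZ (X u) (f u))" if f: "continuous_on U f" for f
  proof -
    have "continuous_on U (\<lambda>u. \<Sum>b\<in>Basis. (f u \<bullet> b) *\<^sub>R DZ (X u) b)"
      by (intro continuous_intros f continuous_on_compose2[OF Z(2) c(1)]) auto
    moreover have "DZ (X u) (f u) = (\<Sum>b\<in>Basis. (f u \<bullet> b) *\<^sub>R DZ (X u) b)" for u
      by (subst euclidean_representation[of "f u", symmetric])
        (simp only: linear_sum[OF lin] linear_cmul[OF lin])
    ultimately show ?thesis by simp
  qed
  have dZX: "((\<lambda>u. Z (X u)) has_derivative
      (\<lambda>h. DZ (X u) (h $ 1 *\<^sub>R pd 1 X u + h $ 2 *\<^sub>R pd 2 X u))) (at u)" if "u \<in> U" for u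
    by (rule has_derivative_compose[OF d(1)[OF that] Z(1)])
  define D1 where "D1 u h = cross3 (DZ (X u) (h $ 1 *\<^sub>R pd 1 X u + h $ 2 *\<^sub>R pd 2 X u)) (pd 2 X u) \<bullet> unit_normal X u
      + cross3 (Z (X u)) (h $ 1 *\<^sub>R pd 1 (pd 2 X) u + h $ 2 *\<^sub>R pd 2 (pd 2 X) u) \<bullet> unit_normal X u
      + cross3 (Z (X u)) (pd 2 X u) \<bullet> (h $ 1 *\<^sub>R pd 1 (unit_normal X) u + h $ 2 *\<^sub>R pd 2 (unit_normal X) u)"
    for u and h :: "real^2"
  define D2 where "D2 u h = cross3 (h $ 1 *\<^sub>R pd 1 (pd 1 X) u + h $ 2 *\<^sub>R pd 2 (pd 1 X) u) (Z (X u)) \<bullet> unit_normal X u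
      + cross3 (pd 1 X u) (DZ (X u) (h $ 1 *\<^sub>R pd 1 X u + h $ 2 *\<^sub>R pd 2 X u)) \<bullet> unit_normal X u
      + cross3 (pd 1 X u) (Z (X u)) \<bullet> (h $ 1 *\<^sub>R pd 1 (unit_normal X) u + h $ 2 *\<^sub>R pd 2 (unit_normal X) u)"
    for u and h :: "real^2"
  have Y1: "((\<lambda>u. cross3 (Z (X u)) (pd 2 X u) \<bullet> unit_normal X u) has_derivative D1 u) (at u)" if "u \<in> U" for u
    by (rule has_derivative_eq_rhs[OF has_derivative_inner[OF cross3_has_derivative[OF dZX d(2)] d(3)]])
      (use that in \<open>simp_all add: D1_def fun_eq_iff inner_add_left\<close>)
  have Y2: "((\<lambda>u. cross3 (pd 1 X u) (Z (X u)) \<bullet> unit_normal X u) has_derivative D2 u) (at u)" if "u \<in> U" for u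
    by (rule has_derivative_eq_rhs[OF has_derivative_inner[OF cross3_has_derivative[OF d(2) dZX] d(3)]])
      (use that in \<open>simp_all add: D2_def fun_eq_iff inner_add_left\<close>)
  have C1: "continuous_on U (\<lambda>u. D1 u (axis 1 1))" unfolding D1_def
    by (intro continuous_intros cDZ cZ c)
  have C2: "continuous_on U (\<lambda>u. D2 u (axis 2 1))" unfolding D2_def
    by (intro continuous_intros cDZ cZ c)
  note I1 = integral_directional_derivative_patch_eq_0[OF U Y1 C1 Q(1,2)]
  note I2 = integral_directional_derivative_patch_eq_0[OF U Y2 C2 Q(1,2)]
  have g: "g = (\<lambda>u. (if u \<in> U then D1 u (axis 1 1) else 0) + (if u \<in> U then D2 u (axis 2 1) else 0))"
    using patch_variation_eq[OF X] by (auto simp: g_def D1_def D2_def axis_def)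
  show "integrable lborel g" "integral\<^sup>L lborel g = 0"
    unfolding g using I1 I2 Q(3) by simp_all
qed

section \<open>The first variation formula on the whole surface\<close>

text \<open>The numerator scales with the square of the determinant and the denominator with its
  absolute value, so the density transforms as a change of variables requires and its integral does
  not depend on the parametrization.\<close>

lemma variation_lincomb:
  assumes lin: "linear (DZ x)"
  shows "variation Z DZ x (\<alpha> *\<^sub>R a + \<beta> *\<^sub>R b) (\<gamma> *\<^sub>R a + \<delta> *\<^sub>R b) = \<bar>\<alpha> * \<delta> - \<beta> * \<gamma>\<bar> * variation Z DZ x a b"
proof -
  define d where "d = \<alpha> * \<delta> - \<beta> * \<gamma>"
  have alt: "cross3 (\<alpha> *\<^sub>R p + \<beta> *\<^sub>R q) (\<gamma> *\<^sub>R r + \<delta> *\<^sub>R s) + cross3 (\<alpha> *\<^sub>R r + \<beta> *\<^sub>R s) (\<gamma> *\<^sub>R p + \<delta> *\<^sub>R q)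
     = d *\<^sub>R (cross3 p s + cross3 r q)" if "cross3 p r + cross3 r p = 0" "cross3 q s + cross3 s q = 0" for p q r s :: "real^3"
    by (simp add: cross3_simps d_def)
  have N: "cross3 (\<alpha> *\<^sub>R a + \<beta> *\<^sub>R b) (\<gamma> *\<^sub>R a + \<delta> *\<^sub>R b) = d *\<^sub>R cross3 a b"
    by (simp add: cross3_simps d_def)
  have A: "cross3 (DZ x (\<alpha> *\<^sub>R a + \<beta> *\<^sub>R b)) (\<gamma> *\<^sub>R a + \<delta> *\<^sub>R b)
       + cross3 (\<alpha> *\<^sub>R a + \<beta> *\<^sub>R b) (DZ x (\<gamma> *\<^sub>R a + \<delta> *\<^sub>R b))
     = d *\<^sub>R (cross3 (DZ x a) b + cross3 a (DZ x b))"
    unfolding linear_add[OF lin] linear_cmul[OF lin]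
    by (simp add: cross3_simps d_def)
  show ?thesis
  proof (cases "d = 0")
    case True
    then show ?thesis unfolding variation_def N A by (simp add: d_def)
  next
    case False
    have "variation Z DZ x (\<alpha> *\<^sub>R a + \<beta> *\<^sub>R b) (\<gamma> *\<^sub>R a + \<delta> *\<^sub>R b) =
       (d * d) * ((cross3 (DZ x a) b + cross3 a (DZ x b)) \<bullet> cross3 a b
       - (x \<bullet> cross3 a b) * (Z x \<bullet> cross3 a b) / 2) / (\<bar>d\<bar> * norm (cross3 a b))"
      unfolding variation_def N A by (simp add: algebra_simps)
    also have "\<dots> = \<bar>d\<bar> * variation Z DZ x a b"
    proof -
      have "d * d / \<bar>d\<bar> = \<bar>d\<bar>" using False by (cases "d > 0") auto
      then have "d * d * E / (\<bar>d\<bar> * n) = \<bar>d\<bar> * (E / n)" for E n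
        by (metis times_divide_times_eq)
      then show ?thesis unfolding variation_def .
    qed
    finally show ?thesis by (simp add: d_def)
  qed
qed

lemma variation_sum:
  "variation (\<lambda>x. \<Sum>i\<in>I. Z i x) (\<lambda>x v. \<Sum>i\<in>I. DZ i x v) x a b = (\<Sum>i\<in>I. variation (Z i) (DZ i) x a b)"
proof (induction I rule: infinite_finite_induct)
  case (insert i I)
  then show ?case
    by (simp add: variation_def cross_add_left cross_add_right inner_add_left algebra_simps
        add_divide_distrib diff_divide_distrib)
qed (simp_all add: variation_def)

lemma change_of_variables_real:
  fixes f :: "real^'m::{finite,wellorder} \<Rightarrow> real" and g :: "real^'m::_ \<Rightarrow> real^'m::_"
  assumes S: "S \<in> sets lebesgue"
    and der_g: "\<And>x. x \<in> S \<Longrightarrow> (g has_derivative g' x) (at x within S)"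
    and inj: "inj_on g S" and f: "f absolutely_integrable_on (g ` S)"
  shows "(\<lambda>x. \<bar>det (matrix (g' x))\<bar> * f (g x)) absolutely_integrable_on S"
    and "(LINT x:S|lebesgue. \<bar>det (matrix (g' x))\<bar> * f (g x)) = (LINT y:g ` S|lebesgue. f y)"
proof -
  have "(\<lambda>x. \<bar>det (matrix (g' x))\<bar> *\<^sub>R vec (f (g x)) :: real ^ 1) absolutely_integrable_on S \<and>
           integral S (\<lambda>x. \<bar>det (matrix (g' x))\<bar> *\<^sub>R vec (f (g x))) = (vec (integral (g ` S) f) :: real ^ 1)
         \<longleftrightarrow> (\<lambda>x. vec (f x) :: real ^ 1) absolutely_integrable_on (g ` S) \<and>
           integral (g ` S) (\<lambda>x. vec (f x)) = (vec (integral (g ` S) f) :: real ^ 1)"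
    by (rule has_absolute_integral_change_of_variables[OF S der_g inj])
  then have *: "(\<lambda>x. \<bar>det (matrix (g' x))\<bar> * f (g x)) absolutely_integrable_on S \<and>
      integral S (\<lambda>x. \<bar>det (matrix (g' x))\<bar> * f (g x)) = integral (g ` S) f"
    using f by (simp add: absolutely_integrable_on_1_iff integral_on_1_eq)
  then show "(\<lambda>x. \<bar>det (matrix (g' x))\<bar> * f (g x)) absolutely_integrable_on S" by blast
  then show "(LINT x:S|lebesgue. \<bar>det (matrix (g' x))\<bar> * f (g x)) = (LINT y:g ` S|lebesgue. f y)"
    using * set_lebesgue_integral_eq_integral(2)[OF f] by (simp add: set_lebesgue_integral_eq_integral(2))
qed

text \<open>An injective linear map is bounded below, and near \<open>u\<close> this bound dominates
  the remainder of the derivative.\<close>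

lemma has_derivative_inj_isolated:
  fixes X :: "'a::euclidean_space \<Rightarrow> 'b::euclidean_space"
  assumes X: "(X has_derivative L) (at u)" and inj: "inj L"
  obtains d where "d > 0" "\<And>v. dist v u < d \<Longrightarrow> X v = X u \<Longrightarrow> v = u"
proof -
  have "linear L" using X has_derivative_linear by blast
  then obtain B where B: "B > 0" "\<And>h. B * norm h \<le> norm (L h)"
    using linear_inj_bounded_below_pos inj by blast
  then obtain d where d: "d > 0" "\<And>y. norm (y - u) < d \<Longrightarrow>
      norm (X y - X u - L (y - u)) \<le> B / 2 * norm (y - u)"
    using X unfolding has_derivative_at_alt by (metis half_gt_zero)
  have "v = u" if "dist v u < d" "X v = X u" for v
  proof -
    have "norm (L (v - u)) \<le> B / 2 * norm (v - u)"
      using d(2)[of v] that by (simp add: dist_norm)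
    then have "B * norm (v - u) \<le> 0" using B(2)[of "v - u"] by linarith
    then show ?thesis using B(1) by (simp add: mult_le_0_iff)
  qed
  then show ?thesis using that d(1) by blast
qed

lemma set_integral_eq_on_support:
  assumes "S \<subseteq> T" "\<And>u. u \<in> T - S \<Longrightarrow> f u = (0::real)"
  shows "set_integrable L T f \<longleftrightarrow> set_integrable L S f" "(LINT u:T|L. f u) = (LINT u:S|L. f u)"
proof -
  have "(\<lambda>u. indicator T u *\<^sub>R f u) = (\<lambda>u. indicator S u *\<^sub>R f u)"
    using assms by (auto simp: fun_eq_iff indicator_def)
  then show "set_integrable L T f \<longleftrightarrow> set_integrable L S f" "(LINT u:T|L. f u) = (LINT u:S|L. f u)"
    by (simp_all add: set_integrable_def set_lebesgue_integral_def)
qed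

text \<open>A surface given by a supply of patches: \<open>small\<close> makes their images a base
  of the topology, so that patches can be fitted into prescribed open sets. Differentiable
  transitions are what the change of variables formula asks for, and each patch has finite
  area.\<close>

locale shrinker_surface =
  fixes M :: "'p topology" and G :: "'p \<Rightarrow> real^3" and P :: "((real^2) set \<times> (real^2 \<Rightarrow> 'p)) set"
  assumes Hausdorff: "Hausdorff_space M" and countable: "second_countable M"
    and proper: "proper_map M euclidean G"
    and patch: "\<And>U \<psi>. (U, \<psi>) \<in> P \<Longrightarrow> shrinker_patch U (G \<circ> \<psi>)"
    and openin: "\<And>U \<psi>. (U, \<psi>) \<in> P \<Longrightarrow> openin M (\<psi> ` U)"
    and homeo: "\<And>U \<psi>. (U, \<psi>) \<in> P \<Longrightarrow> homeomorphic_map (top_of_set U) (subtopology M (\<psi> ` U)) \<psi>"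
    and small: "\<And>p W. p \<in> topspace M \<Longrightarrow> openin M W \<Longrightarrow> p \<in> W \<Longrightarrow> \<exists>(U, \<psi>)\<in>P. p \<in> \<psi> ` U \<and> \<psi> ` U \<subseteq> W"
    and transition: "\<And>U \<psi> V \<xi> u. (U, \<psi>) \<in> P \<Longrightarrow> (V, \<xi>) \<in> P \<Longrightarrow> u \<in> U \<Longrightarrow> \<psi> u \<in> \<xi> ` V \<Longrightarrow>
      (\<lambda>u. the_inv_into V \<xi> (\<psi> u)) differentiable (at u)"
    and area_integrable: "\<And>U \<psi>. (U, \<psi>) \<in> P \<Longrightarrow>
      set_integrable lborel U (\<lambda>u. norm (cross3 (pd 1 (G \<circ> \<psi>) u) (pd 2 (G \<circ> \<psi>) u)))"
begin

lemma patch_open: "(U, \<psi>) \<in> P \<Longrightarrow> open U"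
  using patch by (auto simp: shrinker_patch_def)

lemma patch_inj: "(U, \<psi>) \<in> P \<Longrightarrow> inj_on \<psi> U"
  using homeo by (force simp: homeomorphic_eq_everything_map)

lemma patch_continuous_map: "(U, \<psi>) \<in> P \<Longrightarrow> continuous_map (top_of_set U) M \<psi>"
  using homeo homeomorphic_imp_continuous_map continuous_map_in_subtopology by blast

lemma open_patch_preimage:
  assumes "(U, \<psi>) \<in> P" "openin M W"
  shows "open {u \<in> U. \<psi> u \<in> W}"
proof -
  have "openin (top_of_set U) {u \<in> topspace (top_of_set U). \<psi> u \<in> W}"
    using patch_continuous_map[OF assms(1)] assms(2) openin_continuous_map_preimage by blast
  then show ?thesis
    using patch_open[OF assms(1)] by (simp add: openin_open_eq)
qed

lemma patch_subset: "(U, \<psi>) \<in> P \<Longrightarrow> \<psi> ` U \<subseteq> topspace M"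
  using openin openin_subset by blast

lemma isolated_in_fibre:
  assumes p: "p \<in> topspace M"
  obtains W where "openin M W" "p \<in> W" "\<And>q. q \<in> W \<Longrightarrow> G q = G p \<Longrightarrow> q = p"
proof -
  obtain U \<psi> where U: "(U, \<psi>) \<in> P" "p \<in> \<psi> ` U"
    using small[OF p openin_topspace p] by auto
  then obtain u where u: "u \<in> U" "p = \<psi> u" by auto
  define L where "L h = h $ 1 *\<^sub>R pd 1 (G \<circ> \<psi>) u + h $ 2 *\<^sub>R pd 2 (G \<circ> \<psi>) u" for h :: "real^2"
  have L: "((G \<circ> \<psi>) has_derivative L) (at u)"
    using shrinker_patchD(1)[OF patch[OF U(1)] u(1)] by (simp add: L_def[abs_def])
  have N: "cross3 (pd 1 (G \<circ> \<psi>) u) (pd 2 (G \<circ> \<psi>) u) \<noteq> 0"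
    using patch[OF U(1)] u(1) by (auto simp: shrinker_patch_def)
  \<comment> \<open>Cross products with the coordinate tangent vectors isolate the two coefficients
    of \<open>h\<close>.\<close>
  have "h = 0" if "L h = 0" for h
  proof -
    have "h $ 1 *\<^sub>R cross3 (pd 1 (G \<circ> \<psi>) u) (pd 2 (G \<circ> \<psi>) u) = cross3 (L h) (pd 2 (G \<circ> \<psi>) u)"
      "h $ 2 *\<^sub>R cross3 (pd 1 (G \<circ> \<psi>) u) (pd 2 (G \<circ> \<psi>) u) = cross3 (pd 1 (G \<circ> \<psi>) u) (L h)"
      by (simp_all add: L_def cross_add_left cross_add_right cross_mult_left cross_mult_right)
    then have "h $ 1 = 0" "h $ 2 = 0" using that N by simp_all
    then show ?thesis by (simp add: vec_eq_iff forall_2)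
  qed
  then have "inj L" using L has_derivative_linear linear_injective_0 by blast
  then obtain d where d: "d > 0" "\<And>v. dist v u < d \<Longrightarrow> (G \<circ> \<psi>) v = (G \<circ> \<psi>) u \<Longrightarrow> v = u"
    using has_derivative_inj_isolated[OF L] by metis
  define B where "B = U \<inter> ball u d"
  have "openin (top_of_set U) B"
    unfolding B_def by (simp add: openin_open_Int)
  then have "openin (subtopology M (\<psi> ` U)) (\<psi> ` B)"
    using homeomorphic_imp_open_map[OF homeo[OF U(1)]] by (simp add: open_map_def)
  then have "openin M (\<psi> ` B)"
    using openin[OF U(1)] openin_trans_full by blast
  moreover have "p \<in> \<psi> ` B" using u d(1) by (auto simp: B_def)
  moreover have "q = p" if q: "q \<in> \<psi> ` B" "G q = G p" for q
  proof -
    obtain v where v: "v \<in> B" "q = \<psi> v" using q(1) by auto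
    then show ?thesis using d(2)[of v] q(2) u(2) by (simp add: B_def dist_commute)
  qed
  ultimately show ?thesis using that by blast
qed

text \<open>The fibre is compact by properness and discrete by the immersion property.\<close>

lemma finite_fibre: "finite {p \<in> topspace M. G p = x}"
proof -
  let ?F = "{p \<in> topspace M. G p = x}"
  have comp: "compactin M ?F"
    using compactin_proper_map_preimage[OF proper, of "{x}"] by simp
  have "\<forall>p\<in>?F. \<exists>W. openin M W \<and> p \<in> W \<and> (\<forall>q\<in>W. G q = G p \<longrightarrow> q = p)"
    using isolated_in_fibre by (metis (mono_tags, lifting) mem_Collect_eq)
  then obtain W where W: "\<And>p. p \<in> ?F \<Longrightarrow> openin M (W p) \<and> p \<in> W p \<and> (\<forall>q\<in>W p. G q = G p \<longrightarrow> q = p)"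
    by metis
  have "\<exists>\<F>. finite \<F> \<and> \<F> \<subseteq> W ` ?F \<and> ?F \<subseteq> \<Union>\<F>"
    using W by (intro compactinD[OF comp]) auto
  then obtain \<F> where F: "finite \<F>" "\<F> \<subseteq> W ` ?F" "?F \<subseteq> \<Union>\<F>" by blast
  then obtain F0 where F0: "finite F0" "F0 \<subseteq> ?F" "\<F> = W ` F0"
    using finite_subset_image[OF F(1,2)] by blast
  have "?F \<subseteq> F0"
  proof
    fix q assume q: "q \<in> ?F"
    then obtain p where "p \<in> F0" "q \<in> W p" using F F0 by auto
    then show "q \<in> F0" using W[of p] q F0(2) by auto
  qed
  then show ?thesis using F0(1) finite_subset by blast
qed

definition "img s = snd s ` fst s"

text \<open>The finitely many fibre points get disjoint patches. The rest of the surface is closed,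
  and so is its image under a proper map; this image misses \<open>x\<close>, hence a ball around
  \<open>x\<close>.\<close>

lemma sheets:
  obtains e S where "e > 0" "finite S" "S \<subseteq> P"
    "\<And>s t. s \<in> S \<Longrightarrow> t \<in> S \<Longrightarrow> s \<noteq> t \<Longrightarrow> img s \<inter> img t = {}"
    "\<And>p. p \<in> topspace M \<Longrightarrow> dist x (G p) \<le> e \<Longrightarrow> p \<in> \<Union> (img ` S)"
proof -
  let ?F = "{p \<in> topspace M. G p = x}"
  have fin: "finite ?F" by (rule finite_fibre)
  have "\<forall>p q. p \<in> topspace M \<and> q \<in> topspace M \<and> p \<noteq> q \<longrightarrow>
      (\<exists>A B. openin M A \<and> openin M B \<and> p \<in> A \<and> q \<in> B \<and> disjnt A B)"
    using Hausdorff unfolding Hausdorff_space_def by blast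
  then obtain A B where AB: "\<And>p q. p \<in> topspace M \<Longrightarrow> q \<in> topspace M \<Longrightarrow> p \<noteq> q \<Longrightarrow>
      openin M (A p q) \<and> openin M (B p q) \<and> p \<in> A p q \<and> q \<in> B p q \<and> disjnt (A p q) (B p q)"
    by metis
  \<comment> \<open>\<open>A\<close> and \<open>B\<close> are chosen for ordered pairs, so
    \<open>A p q\<close> and \<open>B q p\<close> are both neighbourhoods of \<open>p\<close>. With
    both of them, \<open>O' p\<close> lies in \<open>A p q\<close> and \<open>O' q\<close> in
    \<open>B p q\<close>.\<close>
  define O' where "O' p = topspace M \<inter> (\<Inter>q\<in>?F - {p}. A p q \<inter> B q p)" for p
  have O'open: "openin M (O' p)" if "p \<in> ?F" for p
  proof (cases "?F - {p} = {}")
    case True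
    then show ?thesis unfolding O'_def by (simp only: True) simp
  next
    case False
    then show ?thesis unfolding O'_def
      using AB that fin False by (intro openin_Int openin_INT2 openin_topspace) auto
  qed
  have O'in: "p \<in> O' p" if "p \<in> ?F" for p
    unfolding O'_def using AB that by auto
  have O'disj: "O' p \<inter> O' q = {}" if "p \<in> ?F" "q \<in> ?F" "p \<noteq> q" for p q
  proof -
    have "O' p \<subseteq> A p q" "O' q \<subseteq> B p q" unfolding O'_def using that by auto
    then show ?thesis using AB[of p q] that by (auto simp: disjnt_def)
  qed
  have "\<forall>p\<in>?F. \<exists>s\<in>P. p \<in> img s \<and> img s \<subseteq> O' p"
  proof
    fix p assume p: "p \<in> ?F"
    then have "p \<in> topspace M" by simp
    from small[OF this O'open[OF p] O'in[OF p]]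
    obtain U \<psi> where "(U, \<psi>) \<in> P" "p \<in> \<psi> ` U" "\<psi> ` U \<subseteq> O' p" by auto
    then show "\<exists>s\<in>P. p \<in> img s \<and> img s \<subseteq> O' p"
      by (intro bexI[of _ "(U, \<psi>)"]) (simp_all add: img_def)
  qed
  then obtain s where s: "\<And>p. p \<in> ?F \<Longrightarrow> s p \<in> P \<and> p \<in> img (s p) \<and> img (s p) \<subseteq> O' p"
    by metis
  define N where "N = topspace M - \<Union> (img ` s ` ?F)"
  have "openin M (\<Union> (img ` s ` ?F))"
  proof (rule openin_Union)
    fix W assume "W \<in> img ` s ` ?F"
    then obtain p where p: "p \<in> ?F" "W = img (s p)" by auto
    obtain U \<psi> where U: "s p = (U, \<psi>)" by fastforce
    then have "(U, \<psi>) \<in> P" using s[OF p(1)] by simp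
    then show "openin M W" using openin p(2) U by (simp add: img_def)
  qed
  then have "closedin M N" by (simp add: N_def closedin_diff)
  then have cl: "closed (G ` N)"
    using proper_imp_closed_map[OF proper] by (simp add: closed_map_def)
  have "x \<notin> G ` N" using s by (auto simp: N_def)
  then obtain e where e: "e > 0" "ball x e \<subseteq> - G ` N"
    using cl openE[of "- G ` N" x] by auto
  have disj: "img a \<inter> img b = {}" if ab: "a \<in> s ` ?F" "b \<in> s ` ?F" "a \<noteq> b" for a b
  proof -
    obtain p q where pq: "p \<in> ?F" "q \<in> ?F" "a = s p" "b = s q" using ab by auto
    then have "p \<noteq> q" using ab(3) by auto
    then show ?thesis using O'disj[of p q] s[of p] s[of q] pq by blast
  qed
  have cover: "p \<in> \<Union> (img ` s ` ?F)" if p: "p \<in> topspace M" "dist x (G p) \<le> e / 2" for p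
  proof (rule ccontr)
    assume "\<not> ?thesis"
    then have "G p \<in> G ` N" using p(1) by (auto simp: N_def)
    moreover have "G p \<in> ball x e" using p(2) e(1) by simp
    ultimately show False using e(2) by blast
  qed
  show ?thesis
    by (rule that[of "e / 2" "s ` ?F"]) (use e(1) fin s disj cover in auto)
qed

lemma countable_cover:
  assumes "topspace M \<noteq> {}"
  obtains c :: "nat \<Rightarrow> (real^2) set \<times> (real^2 \<Rightarrow> 'p)"
  where "range c \<subseteq> P" "(\<Union>i. img (c i)) = topspace M"
proof -
  have "Lindelof_space M" using countable by (rule second_countable_imp_Lindelof_space)
  moreover have "\<And>W. W \<in> img ` P \<Longrightarrow> openin M W"
    using openin by (auto simp: img_def)
  moreover have top: "\<Union> (img ` P) = topspace M"
  proof (intro equalityI subsetI)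
    fix p assume p: "p \<in> topspace M"
    from small[OF p openin_topspace p] obtain U \<psi> where "(U, \<psi>) \<in> P" "p \<in> \<psi> ` U" by auto
    then show "p \<in> \<Union> (img ` P)" unfolding img_def by (intro UN_I[of "(U, \<psi>)"]) auto
  next
    fix p assume "p \<in> \<Union> (img ` P)"
    then obtain U \<psi> where "(U, \<psi>) \<in> P" "p \<in> \<psi> ` U" by (auto simp: img_def)
    then show "p \<in> topspace M" using patch_subset by blast
  qed
  ultimately obtain \<V> where V: "countable \<V>" "\<V> \<subseteq> img ` P" "\<Union> \<V> = topspace M"
    using Lindelof_spaceD[of M "img ` P"] by metis
  then obtain P0 where P0: "countable P0" "P0 \<subseteq> P" "\<V> = img ` P0"
    using countable_subset_image[of \<V> img P] by auto
  have "P0 \<noteq> {}" using V(3) P0(3) assms by (metis Union_empty image_empty)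
  then have "range (from_nat_into P0) = P0"
    using P0(1) by (rule range_from_nat_into)
  then show ?thesis
    using that[of "from_nat_into P0"] P0 V by (metis image_image)
qed

abbreviation dens where "dens Z DZ \<psi> \<equiv> patch_variation Z DZ (G \<circ> \<psi>)"

lemma dens_transition:
  assumes s: "(U, \<psi>) \<in> P" "(V, \<xi>) \<in> P" "u \<in> U" "\<psi> u \<in> \<xi> ` V" and lin: "\<And>x. linear (DZ x)"
  defines "\<tau> \<equiv> \<lambda>u. the_inv_into V \<xi> (\<psi> u)"
  shows "dens Z DZ \<psi> u = \<bar>det (matrix (frechet_derivative \<tau> (at u)))\<bar> * dens Z DZ \<xi> (\<tau> u)"
proof -
  let ?D = "frechet_derivative \<tau> (at u)" and ?X = "G \<circ> \<xi>" and ?Y = "G \<circ> \<psi>"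
  define W where "W = {w \<in> U. \<psi> w \<in> \<xi> ` V}"
  have W: "open W" "u \<in> W"
    using open_patch_preimage[OF s(1) openin[OF s(2)]] s by (auto simp: W_def)
  have inj: "inj_on \<xi> V" by (rule patch_inj[OF s(2)])
  have \<tau>: "\<tau> w \<in> V" "\<xi> (\<tau> w) = \<psi> w" if "w \<in> W" for w
    using that inj by (auto simp: W_def \<tau>_def the_inv_into_f_f)
  have D: "(\<tau> has_derivative ?D) (at u)"
    using transition[OF s(1-4)] unfolding \<tau>_def frechet_derivative_works .
  note X = shrinker_patchD(1)[OF patch[OF s(2)] \<tau>(1)[OF W(2)]]
  have comp: "((\<lambda>w. ?X (\<tau> w)) has_derivative (\<lambda>h. ?D h $ 1 *\<^sub>R pd 1 ?X (\<tau> u) + ?D h $ 2 *\<^sub>R pd 2 ?X (\<tau> u))) (at u)"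
    by (rule has_derivative_compose[OF D X])
  have "(?Y has_derivative (\<lambda>h. ?D h $ 1 *\<^sub>R pd 1 ?X (\<tau> u) + ?D h $ 2 *\<^sub>R pd 2 ?X (\<tau> u))) (at u)"
    by (rule has_derivative_transform_within_open[OF comp W]) (simp add: \<tau>)
  then have pdY: "pd k ?Y u = ?D (axis k 1) $ 1 *\<^sub>R pd 1 ?X (\<tau> u) + ?D (axis k 1) $ 2 *\<^sub>R pd 2 ?X (\<tau> u)" for k
    by (simp add: pd_def frechet_derivative_at[symmetric])
  have "?Y u = ?X (\<tau> u)" using \<tau>(2)[OF W(2)] by simp
  moreover have "det (matrix ?D) = ?D (axis 1 1) $ 1 * ?D (axis 2 1) $ 2 - ?D (axis 1 1) $ 2 * ?D (axis 2 1) $ 1"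
    by (simp add: det_2 matrix_def mult.commute)
  ultimately show ?thesis
    unfolding pdY by (simp only: variation_lincomb[OF lin])
qed

end

section \<open>Integration over the surface by disjoint pieces\<close>

locale shrinker_cover = shrinker_surface +
  fixes c :: "nat \<Rightarrow> (real^2) set \<times> (real^2 \<Rightarrow> 'a)"
  assumes cP: "c i \<in> P" and c_cover: "(\<Union>i. img (c i)) = topspace M"
begin

abbreviation "ps i \<equiv> snd (c i)"
abbreviation "cdom i \<equiv> fst (c i)"

text \<open>The pieces partition the surface, and \<open>D i\<close> is a piece seen in its own
  chart. An integral over the surface is a sum of integrals over the \<open>D i\<close>, so all
  integration takes place in the parameter plane.\<close>

definition "piece i = img (c i) - (\<Union>j<i. img (c j))"
definition "D i = {u \<in> cdom i. ps i u \<in> piece i}"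

lemma cP': "(cdom i, ps i) \<in> P" using cP by simp

lemma openin_img: "s \<in> P \<Longrightarrow> openin M (img s)"
  unfolding img_def using openin by (metis prod.collapse)

lemma preimage_piece: "(V, \<xi>) \<in> P \<Longrightarrow> {v \<in> V. \<xi> v \<in> piece i} \<in> sets borel"
proof -
  assume s: "(V, \<xi>) \<in> P"
  have "{v \<in> V. \<xi> v \<in> piece i} = {v \<in> V. \<xi> v \<in> img (c i)} - {v \<in> V. \<xi> v \<in> (\<Union>j<i. img (c j))}"
    by (auto simp: piece_def)
  moreover have "openin M (\<Union>j<i. img (c j))"
    by (intro openin_Union) (auto intro: openin_img cP)
  then have "open {v \<in> V. \<xi> v \<in> img (c i)}" "open {v \<in> V. \<xi> v \<in> (\<Union>j<i. img (c j))}"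
    by (intro open_patch_preimage[OF s] openin_img cP, intro open_patch_preimage[OF s])
  ultimately show ?thesis by (simp add: borel_open sets.Diff)
qed

lemma D_borel: "D i \<in> sets borel"
  unfolding D_def by (rule preimage_piece[OF cP'])

lemma piece_disjoint:
  assumes "i \<noteq> j"
  shows "piece i \<inter> piece j = {}"
proof (cases "i < j")
  case True
  then show ?thesis by (auto simp: piece_def)
next
  case False
  then have "j < i" using assms by simp
  then show ?thesis by (auto simp: piece_def)
qed

lemma UN_piece: "(\<Union>i<k. piece i) = (\<Union>i<k. img (c i))"
proof (intro equalityI subsetI)
  fix p assume "p \<in> (\<Union>i<k. img (c i))"
  then obtain i where i: "i < k" "p \<in> img (c i)" by auto
  define j where "j = (LEAST j. p \<in> img (c j))"
  have "p \<in> img (c j)" "j \<le> i" "\<And>m. m < j \<Longrightarrow> p \<notin> img (c m)"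
    using i(2) not_less_Least unfolding j_def by (auto intro: LeastI Least_le)
  then show "p \<in> (\<Union>i<k. piece i)" using i(1) by (auto simp: piece_def intro!: bexI[of _ j])
qed (auto simp: piece_def)

text \<open>\<open>S\<close> and \<open>T\<close> are the same part of the surface in two charts;
  the transition map is a bijection between them and the density transforms with its
  Jacobian.\<close>

lemma sheet_integral:
  fixes i :: nat
  assumes s: "(V, \<xi>) \<in> P" and lin: "\<And>x. linear (DZ x)"
    and int: "set_integrable lebesgue V (dens Z DZ \<xi>)"
  defines "S \<equiv> {u \<in> D i. ps i u \<in> \<xi> ` V}" and "T \<equiv> {v \<in> V. \<xi> v \<in> piece i}"
  shows "set_integrable lebesgue S (dens Z DZ (ps i))"
    "(LINT u:S|lebesgue. dens Z DZ (ps i) u) = (LINT v:T|lebesgue. dens Z DZ \<xi> v)"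
proof -
  define \<tau> where "\<tau> u = the_inv_into V \<xi> (ps i u)" for u
  have inj: "inj_on \<xi> V" "inj_on (ps i) (cdom i)" using patch_inj s cP' by blast+
  have \<tau>: "\<tau> u \<in> V" "\<xi> (\<tau> u) = ps i u" if "u \<in> S" for u
    using that inj(1) by (auto simp: S_def \<tau>_def the_inv_into_f_f)
  have SD: "u \<in> cdom i" "ps i u \<in> \<xi> ` V" "ps i u \<in> piece i" if "u \<in> S" for u
    using that by (auto simp: S_def D_def)
  have "S = D i \<inter> {u \<in> cdom i. ps i u \<in> img (V, \<xi>)}"
    by (auto simp: S_def D_def img_def)
  moreover have "open {u \<in> cdom i. ps i u \<in> img (V, \<xi>)}"
    by (rule open_patch_preimage[OF cP' openin_img[OF s]])
  ultimately have Sb: "S \<in> sets borel" using D_borel by auto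
  have Sl: "S \<in> sets lebesgue" using Sb by simp
  have der: "(\<tau> has_derivative frechet_derivative \<tau> (at u)) (at u within S)" if "u \<in> S" for u
    using transition[OF cP' s SD(1,2)[OF that]] has_derivative_at_withinI
    unfolding \<tau>_def frechet_derivative_works by blast
  have inj\<tau>: "inj_on \<tau> S"
  proof (rule inj_onI)
    fix u v assume uv: "u \<in> S" "v \<in> S" "\<tau> u = \<tau> v"
    then have "ps i u = ps i v" using \<tau>(2) by metis
    then show "u = v" using inj(2) SD(1) uv by (auto dest: inj_onD)
  qed
  have img\<tau>: "\<tau> ` S = T"
  proof (intro equalityI subsetI)
    fix v assume "v \<in> \<tau> ` S"
    then show "v \<in> T" using \<tau> SD(3) by (auto simp: T_def)
  next
    fix v assume v: "v \<in> T"
    then have "\<xi> v \<in> img (c i)" by (auto simp: T_def piece_def)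
    then obtain u where u: "u \<in> cdom i" "ps i u = \<xi> v" by (auto simp: img_def)
    then have "u \<in> S" using v by (auto simp: S_def D_def T_def)
    moreover have "\<tau> u = v" using v inj(1) by (simp add: \<tau>_def u(2) T_def the_inv_into_f_f)
    ultimately show "v \<in> \<tau> ` S" by blast
  qed
  have "T \<in> sets lebesgue" using preimage_piece[OF s] by (simp add: T_def)
  then have intT: "set_integrable lebesgue T (dens Z DZ \<xi>)"
    by (rule set_integrable_subset[OF int]) (auto simp: T_def)
  have eq: "dens Z DZ (ps i) u = \<bar>det (matrix (frechet_derivative \<tau> (at u)))\<bar> * dens Z DZ \<xi> (\<tau> u)"
    if "u \<in> S" for u
    using dens_transition[OF cP' s SD(1,2)[OF that] lin] unfolding \<tau>_def[abs_def] .
  note cov = change_of_variables_real[OF Sl der inj\<tau>, of "dens Z DZ \<xi>", unfolded img\<tau>, OF _ intT]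
  show "set_integrable lebesgue S (dens Z DZ (ps i))"
    using cov(1) eq by (simp cong: set_integrable_cong)
  have "(LINT u:S|lebesgue. dens Z DZ (ps i) u)
      = (LINT u:S|lebesgue. \<bar>det (matrix (frechet_derivative \<tau> (at u)))\<bar> * dens Z DZ \<xi> (\<tau> u))"
    using Sl eq by (intro set_lebesgue_integral_cong) auto
  then show "(LINT u:S|lebesgue. dens Z DZ (ps i) u) = (LINT v:T|lebesgue. dens Z DZ \<xi> v)"
    using cov(2) by simp
qed

text \<open>The sum over pieces is rearranged into a sum over sheets. On each sheet the field has
  compact support, so its integral there vanishes. The first \<open>k\<close> pieces contain the
  preimage of the support, so nothing is lost in the finite sum.\<close>

lemma local_first_variation:
  assumes Z: "\<And>x. (Z has_derivative DZ x) (at x)" "\<And>v. continuous_on UNIV (\<lambda>x. DZ x v)"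
    and C: "compact C" "\<And>x. x \<notin> C \<Longrightarrow> Z x = 0"
    and S: "finite S" "S \<subseteq> P" "\<And>s t. s \<in> S \<Longrightarrow> t \<in> S \<Longrightarrow> s \<noteq> t \<Longrightarrow> img s \<inter> img t = {}"
      "\<And>p. p \<in> topspace M \<Longrightarrow> G p \<in> C \<Longrightarrow> p \<in> \<Union> (img ` S)"
    and k: "\<And>p. p \<in> topspace M \<Longrightarrow> G p \<in> C \<Longrightarrow> p \<in> (\<Union>i<k. img (c i))"
  shows "\<And>i. set_integrable lebesgue (D i) (dens Z DZ (ps i))"
    "(\<Sum>i<k. LINT u:D i|lebesgue. dens Z DZ (ps i) u) = 0"
proof -
  have lin: "linear (DZ x)" for x using Z(1) has_derivative_linear by blast
  have closed: "closed C" using C(1) compact_imp_closed by blast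
  have DZ0: "DZ x v = 0" if "x \<notin> C" for x v
    using has_derivative_eq_0_outside[OF Z(1) closed that C(2)] by metis
  have dens0: "dens Z DZ \<psi> u = 0" if "G (\<psi> u) \<notin> C" for \<psi> u
    using DZ0[OF that] C(2)[OF that] by (simp add: variation_def)
  have sheet: "set_integrable lebesgue (fst s) (dens Z DZ (snd s)) \<and>
      (LINT v:fst s|lebesgue. dens Z DZ (snd s) v) = 0" if s: "s \<in> S" for s
  proof -
    obtain V \<xi> where V: "s = (V, \<xi>)" by fastforce
    have VP: "(V, \<xi>) \<in> P" using s S(2) V by auto
    \<comment> \<open>Within one sheet the preimage of \<open>C\<close> is the full compact preimage
      minus the other sheets, which are open; hence it is compact.\<close>
    define K where "K = {p \<in> topspace M. G p \<in> C} - \<Union> (img ` (S - {s}))"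
    define Q where "Q = {v \<in> V. G (\<xi> v) \<in> C}"
    have "compactin M {p \<in> topspace M. G p \<in> C}"
      using compactin_proper_map_preimage[OF proper, of C] C(1) by simp
    moreover have "openin M (\<Union> (img ` (S - {s})))"
      using S(2) by (intro openin_Union) (auto intro: openin_img)
    moreover have "K = {p \<in> topspace M. G p \<in> C} \<inter> (topspace M - \<Union> (img ` (S - {s})))"
      by (auto simp: K_def)
    ultimately have comp: "compactin M K"
      using closed_Int_compactin[of M "topspace M - \<Union> (img ` (S - {s}))" "{p \<in> topspace M. G p \<in> C}"]
      by (simp add: closedin_diff Int_commute)
    have Vs: "\<xi> ` V = img s" by (simp add: V img_def)
    have KQ: "\<xi> ` Q = K"
    proof (intro equalityI subsetI)
      fix p assume p: "p \<in> \<xi> ` Q"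
      then have "p \<in> img s" "G p \<in> C" using Vs by (auto simp: Q_def)
      moreover have "p \<in> topspace M" using \<open>p \<in> img s\<close> patch_subset[OF VP] Vs by auto
      ultimately show "p \<in> K" using S(3) s unfolding K_def by fastforce
    next
      fix p assume p: "p \<in> K"
      then have "p \<in> img s" using S(4)[of p] by (auto simp: K_def)
      then obtain v where "v \<in> V" "p = \<xi> v" using Vs by auto
      then show "p \<in> \<xi> ` Q" using p by (auto simp: Q_def K_def)
    qed
    have "K \<subseteq> \<xi> ` V" using KQ by (auto simp: Q_def)
    then have "compactin (subtopology M (\<xi> ` V)) (\<xi> ` Q)"
      using comp KQ by (simp add: compactin_subtopology)
    moreover have "Q \<subseteq> V" by (auto simp: Q_def)
    ultimately have "compactin (top_of_set V) Q"
      using homeomorphic_map_compactness[OF homeo[OF VP], of Q] by simp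
    then have Qc: "compact Q" by (simp add: compactin_subtopology)
    define g where "g v = (if v \<in> V then dens Z DZ \<xi> v else 0)" for v
    have "(G \<circ> \<xi>) v \<notin> C" if "v \<in> V - Q" for v using that by (simp add: Q_def)
    then have Z0: "Z ((G \<circ> \<xi>) v) = 0" if "v \<in> V - Q" for v using C(2) that by blast
    have g: "integrable lborel g" "integral\<^sup>L lborel g = 0"
      using integral_patch_variation_eq_0[OF patch[OF VP] Z Qc \<open>Q \<subseteq> V\<close> Z0]
      unfolding g_def[abs_def] by auto
    then have "integrable lebesgue g" "integral\<^sup>L lebesgue g = 0"
      by (auto simp: integrable_completion integral_completion)
    moreover have "(\<lambda>v. indicator V v *\<^sub>R dens Z DZ \<xi> v) = g"
      by (auto simp: g_def indicator_def fun_eq_iff)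
    ultimately show ?thesis
      by (simp add: V set_integrable_def set_lebesgue_integral_def)
  qed
  define Si where "Si i s = {u \<in> D i. ps i u \<in> img s}" for i and s :: "(real^2) set \<times> (real^2 \<Rightarrow> 'a)"
  define Ti where "Ti i s = {v \<in> fst s. snd s v \<in> piece i}" for i and s :: "(real^2) set \<times> (real^2 \<Rightarrow> 'a)"
  have sh: "set_integrable lebesgue (Si i s) (dens Z DZ (ps i))"
    "(LINT u:Si i s|lebesgue. dens Z DZ (ps i) u) = (LINT v:Ti i s|lebesgue. dens Z DZ (snd s) v)"
    if s: "s \<in> S" for i s
  proof -
    have "(fst s, snd s) \<in> P" using s S(2) by auto
    from sheet_integral[OF this lin conjunct1[OF sheet[OF s]], of i]
    show "set_integrable lebesgue (Si i s) (dens Z DZ (ps i))"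
      "(LINT u:Si i s|lebesgue. dens Z DZ (ps i) u) = (LINT v:Ti i s|lebesgue. dens Z DZ (snd s) v)"
      by (simp_all add: Si_def Ti_def img_def)
  qed
  have Sim: "Si i s \<in> sets lebesgue" if s: "s \<in> S" for i s
  proof -
    have "Si i s = D i \<inter> {u \<in> cdom i. ps i u \<in> img s}" by (auto simp: Si_def D_def)
    moreover have "open {u \<in> cdom i. ps i u \<in> img s}"
      using s S(2) by (intro open_patch_preimage[OF cP'] openin_img) auto
    ultimately show ?thesis using D_borel by auto
  qed
  have Tim: "Ti i s \<in> sets lebesgue" if s: "s \<in> S" for i s
    using preimage_piece[of "fst s" "snd s" i] s S(2) by (auto simp: Ti_def)
  have supp: "u \<in> (\<Union>s\<in>S. Si i s)" if "u \<in> D i" "dens Z DZ (ps i) u \<noteq> 0" for u i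
  proof -
    have "ps i u \<in> topspace M"
      using that(1) patch_subset[OF cP'] by (auto simp: D_def)
    then show ?thesis using S(4)[of "ps i u"] dens0 that by (auto simp: Si_def)
  qed
  have sub: "(\<Union>s\<in>S. Si i s) \<subseteq> D i" for i by (auto simp: Si_def)
  have off: "dens Z DZ (ps i) u = 0" if "u \<in> D i - (\<Union>s\<in>S. Si i s)" for u i
    using supp that by blast
  have redL: "(LINT u:D i|lebesgue. dens Z DZ (ps i) u) = (LINT u:(\<Union>s\<in>S. Si i s)|lebesgue. dens Z DZ (ps i) u)" for i
    by (rule set_integral_eq_on_support(2)[OF sub off])
  have "set_integrable lebesgue (\<Union>s\<in>S. Si i s) (dens Z DZ (ps i))" for i
    using S(1) sh(1) Sim by (intro set_integrable_UN) auto
  then show "set_integrable lebesgue (D i) (dens Z DZ (ps i))" for i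
    using set_integral_eq_on_support(1)[OF sub[of i], of "dens Z DZ (ps i)" lebesgue] off[where i=i]
    by blast
  have disj: "disjoint_family_on (Si i) S" for i
    using S(3) by (force simp: disjoint_family_on_def Si_def)
  have "(\<Sum>i<k. LINT u:D i|lebesgue. dens Z DZ (ps i) u)
      = (\<Sum>i<k. \<Sum>s\<in>S. LINT u:Si i s|lebesgue. dens Z DZ (ps i) u)"
    unfolding redL by (intro sum.cong refl set_integral_finite_Union S(1) disj sh(1) Sim)
  also have "\<dots> = (\<Sum>i<k. \<Sum>s\<in>S. LINT v:Ti i s|lebesgue. dens Z DZ (snd s) v)"
    by (intro sum.cong refl sh(2))
  also have "\<dots> = (\<Sum>s\<in>S. \<Sum>i<k. LINT v:Ti i s|lebesgue. dens Z DZ (snd s) v)"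
    by (rule sum.swap)
  also have "\<dots> = (\<Sum>s\<in>S. 0)"
  proof (rule sum.cong[OF refl])
    fix s assume s: "s \<in> S"
    have sP: "(fst s, snd s) \<in> P" using s S(2) by auto
    have subV: "(\<Union>i<k. Ti i s) \<subseteq> fst s" by (auto simp: Ti_def)
    have offV: "dens Z DZ (snd s) v = 0" if v: "v \<in> fst s - (\<Union>i<k. Ti i s)" for v
    proof (rule dens0, rule notI)
      assume "G (snd s v) \<in> C"
      moreover have "snd s v \<in> topspace M" using patch_subset[OF sP] v by auto
      ultimately have "snd s v \<in> (\<Union>i<k. piece i)" using k UN_piece by blast
      then show False using v by (auto simp: Ti_def)
    qed
    have "set_integrable lebesgue (Ti i s) (dens Z DZ (snd s))" for i
      using conjunct1[OF sheet[OF s]] Tim[OF s]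
      by (rule set_integrable_subset) (auto simp: Ti_def)
    moreover have "disjoint_family_on (\<lambda>i. Ti i s) {..<k}"
      using piece_disjoint by (fastforce simp: disjoint_family_on_def Ti_def)
    ultimately have "(\<Sum>i<k. LINT v:Ti i s|lebesgue. dens Z DZ (snd s) v)
        = (LINT v:(\<Union>i<k. Ti i s)|lebesgue. dens Z DZ (snd s) v)"
      using Tim[OF s] by (intro set_integral_finite_Union[symmetric]) auto
    also have "\<dots> = (LINT v:fst s|lebesgue. dens Z DZ (snd s) v)"
      using set_integral_eq_on_support(2)[OF subV offV] by simp
    also have "\<dots> = 0" using sheet[OF s] by blast
    finally show "(\<Sum>i<k. LINT v:Ti i s|lebesgue. dens Z DZ (snd s) v) = 0" .
  qed
  finally show "(\<Sum>i<k. LINT u:D i|lebesgue. dens Z DZ (ps i) u) = 0" by simp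
qed

abbreviation "dZ Z \<equiv> \<lambda>x. frechet_derivative Z (at x)"

text \<open>A partition of unity in the ambient space: with bumps \<open>b x\<close> around finitely
  many centres and their sum \<open>s\<close>, the field is the sum of the fields \<open>b x\<close>
  times \<open>Z / s\<close>, each supported in a ball over which the surface splits into
  sheets.\<close>

lemma first_variation:
  fixes Z :: "real^3 \<Rightarrow> real^3"
  assumes Z: "Ck_on (Suc 0) UNIV Z" and R: "\<And>x. norm x > R \<Longrightarrow> Z x = 0"
    and k: "\<And>p. p \<in> topspace M \<Longrightarrow> norm (G p) \<le> R \<Longrightarrow> p \<in> (\<Union>i<k. img (c i))"
  shows "\<And>i. set_integrable lebesgue (D i) (dens Z (dZ Z) (ps i))"
    "(\<Sum>i<k. LINT u:D i|lebesgue. dens Z (dZ Z) (ps i) u) = 0"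
proof -
  define good where "good x e S \<longleftrightarrow> e > 0 \<and> finite S \<and> S \<subseteq> P \<and>
    (\<forall>s\<in>S. \<forall>t\<in>S. s \<noteq> t \<longrightarrow> img s \<inter> img t = {}) \<and>
    (\<forall>p\<in>topspace M. dist x (G p) \<le> e \<longrightarrow> p \<in> \<Union> (img ` S))" for x e S
  have "\<forall>x. \<exists>e S. good x e S"
  proof
    fix x
    obtain e S where "e > 0" "finite S" "S \<subseteq> P"
      "\<And>s t. s \<in> S \<Longrightarrow> t \<in> S \<Longrightarrow> s \<noteq> t \<Longrightarrow> img s \<inter> img t = {}"
      "\<And>p. p \<in> topspace M \<Longrightarrow> dist x (G p) \<le> e \<Longrightarrow> p \<in> \<Union> (img ` S)"
      by (rule sheets[of x]) (blast intro: that)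
    then have "good x e S" unfolding good_def by (intro conjI ballI impI)
    then show "\<exists>e S. good x e S" by blast
  qed
  then obtain e S where "\<And>x. good x (e x) (S x)" by metis
  note good = this[unfolded good_def]
  have eS: "e x > 0" "finite (S x)" "S x \<subseteq> P"
    "s \<in> S x \<Longrightarrow> t \<in> S x \<Longrightarrow> s \<noteq> t \<Longrightarrow> img s \<inter> img t = {}"
    "p \<in> topspace M \<Longrightarrow> dist x (G p) \<le> e x \<Longrightarrow> p \<in> \<Union> (img ` S x)" for x s t p
    using good[of x] by (simp_all only: simp_thms)
  have "\<exists>X0\<subseteq>cball 0 R. finite X0 \<and> cball 0 R \<subseteq> (\<Union>x\<in>X0. ball x (e x))"
    by (rule compactE_image[OF compact_cball, of "cball 0 R" "\<lambda>x. ball x (e x)"])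
      (use eS(1) in auto)
  then obtain X0 where X0: "finite X0" "cball 0 R \<subseteq> (\<Union>x\<in>X0. ball x (e x))" by blast
  define O' where "O' = (\<Union>x\<in>X0. ball x (e x))"
  define b where "b x y = (max 0 ((e x)\<^sup>2 - (y - x) \<bullet> (y - x)))\<^sup>2" for x y :: "real^3"
  define s where "s y = (\<Sum>x\<in>X0. b x y)" for y
  \<comment> \<open>Division by \<open>s\<close> is safe on \<open>O'\<close>, where
    \<open>s\<close> is positive. \<open>Z'\<close> is C1 everywhere because \<open>O'\<close>
    contains the closed ball of radius \<open>R\<close> and \<open>Z\<close> vanishes outside
    it.\<close>
  define Z' where "Z' y = (if y \<in> O' then inverse (s y) *\<^sub>R Z y else 0)" for y
  define Zx where "Zx x y = b x y *\<^sub>R Z' y" for x y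
  have O'open: "open O'" by (auto simp: O'_def)
  have b0: "b x y = 0" if "dist x y > e x" for x y
  proof -
    have "(e x)\<^sup>2 \<le> (dist x y)\<^sup>2" using that eS(1)[of x] by (intro power_mono) auto
    then show ?thesis by (simp add: b_def power2_norm_eq_inner dist_norm norm_minus_commute[of x y])
  qed
  have bpos: "b x y > 0" if "y \<in> ball x (e x)" for x y
  proof -
    have "(dist x y)\<^sup>2 < (e x)\<^sup>2" using that by (intro power_strict_mono) auto
    then show ?thesis by (simp add: b_def power2_norm_eq_inner dist_norm norm_minus_commute[of x y])
  qed
  have spos: "s y > 0" if "y \<in> O'" for y
  proof -
    obtain x where x: "x \<in> X0" "y \<in> ball x (e x)" using \<open>y \<in> O'\<close> by (auto simp: O'_def)
    show ?thesis unfolding s_def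
      by (rule sum_pos2[where i=x]) (use X0(1) x bpos[OF x(2)] in \<open>simp_all add: b_def\<close>)
  qed
  have bC1: "Ck_on (Suc 0) UNIV (b x)" for x
    unfolding b_def[abs_def] by (rule C1_bump)
  have sC1: "Ck_on (Suc 0) UNIV s"
    unfolding s_def[abs_def] by (intro C1_sum bC1) auto
  have "Ck_on (Suc 0) O' (\<lambda>y. inverse (s y) *\<^sub>R Z y)"
    using spos by (intro C1_scaleR C1_inverse O'open Ck_on_subset[OF sC1] Ck_on_subset[OF Z])
      (auto simp: less_imp_neq[symmetric])
  then have "Ck_on (Suc 0) O' Z'"
    by (subst Ck_on_cong[OF O'open]) (auto simp: Z'_def)
  moreover have "Ck_on (Suc 0) (- cball 0 R) Z'"
  proof -
    have "Ck_on (Suc 0) (- cball 0 R) (\<lambda>y::real^3. 0 :: real^3)"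
      by (rule C1I[of _ _ "\<lambda>x v. 0"]) auto
    then show ?thesis
      by (subst Ck_on_cong[of _ _ "\<lambda>y. 0"]) (auto simp: Z'_def R)
  qed
  ultimately have "Ck_on (Suc 0) (O' \<union> - cball 0 R) Z'"
    using O'open by (intro C1_Un) auto
  moreover have "O' \<union> - cball 0 R = UNIV" using X0(2) by (auto simp: O'_def)
  ultimately have Z'C1: "Ck_on (Suc 0) UNIV Z'" by simp
  then have ZxC1: "Ck_on (Suc 0) UNIV (Zx x)" for x
    unfolding Zx_def[abs_def] by (intro C1_scaleR bC1) auto
  have ZR: "Z' y = 0" if "norm y > R" for y using R[OF that] by (simp add: Z'_def)
  have sumZ: "Z = (\<lambda>y. \<Sum>x\<in>X0. Zx x y)"
  proof
    fix y
    have "(\<Sum>x\<in>X0. Zx x y) = s y *\<^sub>R Z' y" by (simp add: Zx_def s_def scaleR_left.sum)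
    also have "\<dots> = Z y"
    proof (cases "y \<in> O'")
      case True
      then show ?thesis using spos[OF True] by (simp add: Z'_def)
    next
      case False
      then have "norm y > R" using X0(2) by (force simp: O'_def)
      then show ?thesis using R False by (simp add: Z'_def)
    qed
    finally show "Z y = (\<Sum>x\<in>X0. Zx x y)" by simp
  qed
  have dsum: "dZ Z y = (\<lambda>v. \<Sum>x\<in>X0. dZ (Zx x) y v)" for y
  proof (rule frechet_derivative_at[symmetric])
    show "(Z has_derivative (\<lambda>v. \<Sum>x\<in>X0. dZ (Zx x) y v)) (at y)"
      unfolding sumZ by (intro has_derivative_sum C1D(1)[OF ZxC1]) auto
  qed
  have dens: "dens Z (dZ Z) \<psi> u = (\<Sum>x\<in>X0. dens (Zx x) (dZ (Zx x)) \<psi> u)" for \<psi> u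
  proof -
    have "dZ Z = (\<lambda>y v. \<Sum>x\<in>X0. dZ (Zx x) y v)" using dsum by (rule ext)
    then have "variation Z (dZ Z) = variation (\<lambda>y. \<Sum>x\<in>X0. Zx x y) (\<lambda>y v. \<Sum>x\<in>X0. dZ (Zx x) y v)"
      by (rule arg_cong2[of _ _ _ _ variation, OF sumZ])
    then show ?thesis by (simp only: variation_sum)
  qed
  define C where "C x = cball x (e x) \<inter> cball 0 R" for x :: "real^3"
  have cC: "compact (C x)" for x by (simp add: C_def compact_Int)
  have cZ: "Zx x y = 0" if "y \<notin> C x" for x y
    using that b0[of x y] ZR[of y] by (auto simp: Zx_def C_def not_le)
  have cS: "p \<in> \<Union> (img ` S x)" if "p \<in> topspace M" "G p \<in> C x" for x p
    using eS(5)[OF that(1), of x] that(2) by (simp add: C_def)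
  have ck: "p \<in> (\<Union>i<k. img (c i))" if "p \<in> topspace M" "G p \<in> C x" for x p
    using k[OF that(1)] that(2) by (simp add: C_def)
  have loc: "set_integrable lebesgue (D i) (dens (Zx x) (dZ (Zx x)) (ps i))"
    "(\<Sum>i<k. LINT u:D i|lebesgue. dens (Zx x) (dZ (Zx x)) (ps i) u) = 0" for x i
    by (rule local_first_variation[where C="C x" and S="S x" and k=k];
        (rule C1D(1)[OF ZxC1 open_UNIV UNIV_I] C1D(2)[OF ZxC1 open_UNIV] cC eS(2) eS(3)
          | blast intro: cZ cS ck dest: eS(4)))+
  show "set_integrable lebesgue (D i) (dens Z (dZ Z) (ps i))" for i
    unfolding dens using loc(1) by (simp add: set_integrable_def sum_distrib_left)
  have "(\<Sum>i<k. LINT u:D i|lebesgue. dens Z (dZ Z) (ps i) u)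
    = (\<Sum>i<k. \<Sum>x\<in>X0. LINT u:D i|lebesgue. dens (Zx x) (dZ (Zx x)) (ps i) u)"
    unfolding dens using loc(1)
    by (intro sum.cong refl) (simp add: set_integrable_def set_lebesgue_integral_def sum_distrib_left)
  also have "\<dots> = (\<Sum>x\<in>X0. \<Sum>i<k. LINT u:D i|lebesgue. dens (Zx x) (dZ (Zx x)) (ps i) u)"
    by (rule sum.swap)
  finally show "(\<Sum>i<k. LINT u:D i|lebesgue. dens Z (dZ Z) (ps i) u) = 0"
    using loc(2) by simp
qed

end

section \<open>Quadratic area growth\<close>

text \<open>\<open>q\<close> is the square of the normal part of \<open>x\<close> and
  \<open>f - q\<close> that of the tangential part. The tangential divergence of the field is
  \<open>2 \<psi> + 2 \<psi>' (f - q)\<close>, and the curvature term contributes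
  \<open>- q \<psi> / 2\<close>.\<close>

lemma variation_radial:
  fixes x a b :: "real^3" and \<psi> \<psi>' :: "real \<Rightarrow> real"
  assumes N: "cross3 a b \<noteq> 0"
  defines "f \<equiv> x \<bullet> x" and "q \<equiv> (x \<bullet> cross3 a b)\<^sup>2 / (norm (cross3 a b))\<^sup>2"
  shows "variation (\<lambda>x. \<psi> (x \<bullet> x) *\<^sub>R x) (\<lambda>x v. \<psi> (x \<bullet> x) *\<^sub>R v + (2 * \<psi>' (x \<bullet> x) * (x \<bullet> v)) *\<^sub>R x) x a b
     = norm (cross3 a b) * (2 * \<psi> f + 2 * \<psi>' f * (f - q) - q * \<psi> f / 2)"
proof -
  let ?N = "cross3 a b"
  define n where "n = norm ?N"
  have n: "n \<noteq> 0" "?N \<bullet> ?N = n\<^sup>2" using N by (simp_all add: n_def power2_norm_eq_inner)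
  have dots: "cross3 u b \<bullet> cross3 a b = (u \<bullet> a) * (b \<bullet> b) - (u \<bullet> b) * (a \<bullet> b)"
    "cross3 a u \<bullet> cross3 a b = (a \<bullet> a) * (u \<bullet> b) - (a \<bullet> b) * (u \<bullet> a)" for u
    by (simp_all add: cross3_simps)
  have nn: "n\<^sup>2 = (a \<bullet> a) * (b \<bullet> b) - (a \<bullet> b)\<^sup>2"
    using dots(1)[of a] n(2) by (simp add: power2_eq_square)
  \<comment> \<open>The bracket is \<open>n^2\<close> times the square of the tangential part of
    \<open>x\<close>, written with the Gram matrix of \<open>a\<close> and \<open>b\<close>.\<close>
  have gram: "(x \<bullet> ?N)\<^sup>2 = f * n\<^sup>2 - ((x \<bullet> a) * ((x \<bullet> a) * (b \<bullet> b) - (x \<bullet> b) * (a \<bullet> b))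
      + (x \<bullet> b) * ((a \<bullet> a) * (x \<bullet> b) - (a \<bullet> b) * (x \<bullet> a)))"
    unfolding nn f_def by (simp add: cross3_simps power2_eq_square)
  have "(cross3 (\<psi> f *\<^sub>R a + (2 * \<psi>' f * (x \<bullet> a)) *\<^sub>R x) b + cross3 a (\<psi> f *\<^sub>R b + (2 * \<psi>' f * (x \<bullet> b)) *\<^sub>R x)) \<bullet> ?N
     = 2 * \<psi> f * n\<^sup>2 + 2 * \<psi>' f * ((x \<bullet> a) * (cross3 x b \<bullet> ?N) + (x \<bullet> b) * (cross3 a x \<bullet> ?N))"
    by (simp only: cross_add_left cross_add_right cross_mult_left cross_mult_right inner_add_left
        inner_scaleR_left n(2)) (simp add: algebra_simps)
  also have "\<dots> = 2 * \<psi> f * n\<^sup>2 + 2 * \<psi>' f * (f * n\<^sup>2 - (x \<bullet> ?N)\<^sup>2)"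
    unfolding dots gram by simp
  finally have "variation (\<lambda>x. \<psi> (x \<bullet> x) *\<^sub>R x) (\<lambda>x v. \<psi> (x \<bullet> x) *\<^sub>R v + (2 * \<psi>' (x \<bullet> x) * (x \<bullet> v)) *\<^sub>R x) x a b
    = (2 * \<psi> f * n\<^sup>2 + 2 * \<psi>' f * (f * n\<^sup>2 - (x \<bullet> ?N)\<^sup>2) - \<psi> f * (x \<bullet> ?N)\<^sup>2 / 2) / n"
    by (simp add: variation_def f_def n_def power2_eq_square)
  also have "(x \<bullet> ?N)\<^sup>2 = q * n\<^sup>2" using n by (simp add: q_def n_def)
  also have "2 * \<psi> f * n\<^sup>2 + 2 * \<psi>' f * (f * n\<^sup>2 - q * n\<^sup>2) - \<psi> f * (q * n\<^sup>2) / 2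
      = n * (n * (2 * \<psi> f + 2 * \<psi>' f * (f - q) - q * \<psi> f / 2))"
    by (simp add: power2_eq_square algebra_simps)
  finally show ?thesis
    unfolding n_def[symmetric] using n(1) by simp
qed

text \<open>The integrand for the radial field is affine in the squared tangential part of \<open>x\<close>, so
  it suffices to bound its two extreme values.\<close>

lemma radial_integrand_le:
  fixes f q \<psi> \<psi>' e :: real
  assumes "0 \<le> q" "q \<le> f" and "\<psi> * (2 - f / 2) \<le> e" "2 * (\<psi> + f * \<psi>') \<le> e"
  shows "2 * \<psi> + 2 * \<psi>' * (f - q) - q * \<psi> / 2 \<le> e"
proof (cases "f = 0")
  case True
  then show ?thesis using assms by simp
next
  case False
  then have f: "f > 0" using assms by linarith
  have "f * (2 * \<psi> + 2 * \<psi>' * (f - q) - q * \<psi> / 2)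
      = q * (\<psi> * (2 - f / 2)) + (f - q) * (2 * (\<psi> + f * \<psi>'))"
    by (simp add: algebra_simps)
  also have "\<dots> \<le> q * e + (f - q) * e"
    using assms by (intro add_mono mult_left_mono) auto
  also have "\<dots> = f * e" by (simp add: algebra_simps)
  finally show ?thesis using f by simp
qed

text \<open>Like \<open>1 / f\<close> at infinity but regular at the origin. The product
  \<open>f * kappa f = 1 + (f - 1) / (f^2 + 1)\<close> decreases for \<open>f > 1 + sqrt 2\<close>
  and is at least 1 for \<open>f \<ge> 1\<close>. So the derivative of \<open>f * kappa f\<close>
  has the right sign for large \<open>f\<close>, and a cutoff factor adds a gain bounded
  below.\<close>

definition kappa :: "real \<Rightarrow> real" where "kappa f = (f + 1) / (f\<^sup>2 + 1)"
definition kappa' :: "real \<Rightarrow> real" where "kappa' f = (1 - 2 * f - f\<^sup>2) / (f\<^sup>2 + 1)\<^sup>2"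
text \<open>The cutoff is C1 across the sphere of radius \<open>R\<close>. Its slope adds a negative
  term of order \<open>R^-2\<close> to the derivative of \<open>f * radial R f\<close>, and this
  term is what measures the area.\<close>

definition radial :: "real \<Rightarrow> real \<Rightarrow> real" where
  "radial R f = kappa f * (max 0 (1 - f / R\<^sup>2))\<^sup>2"
definition radial' :: "real \<Rightarrow> real \<Rightarrow> real" where
  "radial' R f = kappa' f * (max 0 (1 - f / R\<^sup>2))\<^sup>2 - kappa f * (2 / R\<^sup>2) * max 0 (1 - f / R\<^sup>2)"

lemma sq_plus_1_pos: "(f::real)\<^sup>2 + 1 > 0"
  by (simp add: add_nonneg_pos)

lemma sq_plus_1_nonzero: "(f::real)\<^sup>2 + 1 \<noteq> 0"
  using sq_plus_1_pos[of f] by simp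

lemma kappa_has_derivative: "(kappa has_real_derivative kappa' f) (at f)"
proof -
  have "((\<lambda>f::real. (f + 1) / (f\<^sup>2 + 1)) has_real_derivative
      (1 * (f\<^sup>2 + 1) - (f + 1) * (2 * f)) / ((f\<^sup>2 + 1) * (f\<^sup>2 + 1))) (at f)"
    using sq_plus_1_pos[of f] by (auto intro!: derivative_eq_intros)
  moreover have "(1 * (f\<^sup>2 + 1) - (f + 1) * (2 * f)) / ((f\<^sup>2 + 1) * (f\<^sup>2 + 1)) = kappa' f"
    by (simp add: kappa'_def power2_eq_square algebra_simps)
  ultimately show ?thesis by (simp add: kappa_def[abs_def])
qed

lemma radial_has_derivative: "(radial R has_real_derivative radial' R f) (at f)"
proof -
  have 1: "((\<lambda>f. 1 - f / R\<^sup>2) has_real_derivative - (1 / R\<^sup>2)) (at f)"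
    by (auto simp: divide_inverse intro!: derivative_eq_intros)
  have "((\<lambda>f. (max 0 (1 - f / R\<^sup>2))\<^sup>2) has_real_derivative 2 * max 0 (1 - f / R\<^sup>2) * - (1 / R\<^sup>2)) (at f)"
    using DERIV_chain2[OF max_0_square_has_real_derivative 1] .
  from DERIV_mult[OF kappa_has_derivative this] show ?thesis
    by (simp add: radial_def[abs_def] radial'_def algebra_simps)
qed

text \<open>The thresholds: for \<open>f \<ge> 8\<close> one has
  \<open>f / 2 - 2 \<ge> f / 4\<close>, and \<open>f * kappa f\<close> is decreasing; for
  \<open>f \<le> R^2 / 2\<close> the cutoff \<open>m\<close> is at least 1/2, so its slope gives
  \<open>- 4 m / R^2 \<le> - 2 / R^2\<close>; and \<open>R^2 \<ge> 32\<close> gives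
  \<open>2 / R^2 \<le> 1 / 16 \<le> m^2 / 4\<close>. For \<open>f < 8\<close> the crude bound 4 is
  enough.\<close>

lemma radial_extremes:
  fixes f R :: real
  assumes f: "f \<ge> 0" and R: "R\<^sup>2 \<ge> 32"
  defines "e \<equiv> (if f < 8 then 4 else if f \<le> R\<^sup>2 / 2 then - (2 / R\<^sup>2) else 0)"
  shows "radial R f * (2 - f / 2) \<le> e" "2 * (radial R f + f * radial' R f) \<le> e"
proof -
  define m where "m = max 0 (1 - f / R\<^sup>2)"
  have R0: "R\<^sup>2 > 0" using R by linarith
  have m: "0 \<le> m" "m \<le> 1" "m\<^sup>2 \<le> 1" using f R0 by (auto simp: m_def power_le_one)
  have d: "f\<^sup>2 + 1 > 0" by (rule sq_plus_1_pos)
  have k0: "kappa f \<ge> 0" using f d by (simp add: kappa_def)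
  have e1: "2 * (radial R f + f * radial' R f)
      = 2 * ((1 + 2 * f - f\<^sup>2) / (f\<^sup>2 + 1)\<^sup>2 * m\<^sup>2 - f * kappa f * (2 / R\<^sup>2) * m)"
  proof -
    have "kappa f + f * kappa' f = (1 + 2 * f - f\<^sup>2) / (f\<^sup>2 + 1)\<^sup>2"
    proof -
      have "kappa f = (f + 1) * (f\<^sup>2 + 1) / (f\<^sup>2 + 1)\<^sup>2"
        using d by (simp add: kappa_def power2_eq_square)
      then have "kappa f + f * kappa' f = ((f + 1) * (f\<^sup>2 + 1) + f * (1 - 2 * f - f\<^sup>2)) / (f\<^sup>2 + 1)\<^sup>2"
        by (simp add: kappa'_def add_divide_distrib)
      also have "(f + 1) * (f\<^sup>2 + 1) + f * (1 - 2 * f - f\<^sup>2) = 1 + 2 * f - f\<^sup>2"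
        by (simp add: power2_eq_square algebra_simps)
      finally show ?thesis .
    qed
    moreover have "2 * (radial R f + f * radial' R f) = 2 * ((kappa f + f * kappa' f) * m\<^sup>2 - f * kappa f * (2 / R\<^sup>2) * m)"
      unfolding radial_def radial'_def m_def[symmetric] by (simp add: algebra_simps)
    ultimately show ?thesis by simp
  qed
  consider "f < 8" | "f \<ge> 8" by linarith
  then have "radial R f * (2 - f / 2) \<le> e \<and> 2 * (radial R f + f * radial' R f) \<le> e"
  proof cases
    case 1
    have f2: "2 * f \<le> f\<^sup>2 + 1"
      using zero_le_power2[of "f - 1"] by (simp add: power2_eq_square algebra_simps)
    have "f + 1 \<le> 2 * (f\<^sup>2 + 1)"
      using f2 f zero_le_power2[of f] by (smt (verit))
    then have k2: "kappa f \<le> 2" using d by (simp add: kappa_def pos_divide_le_eq)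
    have "radial R f \<le> 2 * 1"
      unfolding radial_def m_def[symmetric] by (intro mult_mono k2 m) (use k0 m in auto)
    then have "radial R f * (2 - f / 2) \<le> 2 * 2 - radial R f * (f / 2)" by (simp add: algebra_simps)
    moreover have "radial R f \<ge> 0" using k0 by (simp add: radial_def)
    then have "radial R f * (f / 2) \<ge> 0" using f by simp
    moreover have "(1 + 2 * f - f\<^sup>2) / (f\<^sup>2 + 1)\<^sup>2 \<le> 2"
    proof -
      have "1 + 2 * f - f\<^sup>2 \<le> 2 * (f\<^sup>2 + 1)"
        using f2 zero_le_power2[of f] by (smt (verit))
      also have "\<dots> \<le> 2 * (f\<^sup>2 + 1)\<^sup>2"
      proof -
        have "(f\<^sup>2 + 1) * 1 \<le> (f\<^sup>2 + 1) * (f\<^sup>2 + 1)" using d by (intro mult_left_mono) auto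
        then show ?thesis by (simp add: power2_eq_square)
      qed
      finally show ?thesis using d by (simp add: pos_divide_le_eq)
    qed
    then have "(1 + 2 * f - f\<^sup>2) / (f\<^sup>2 + 1)\<^sup>2 * m\<^sup>2 \<le> 2 * 1"
      using m mult_right_mono[of _ 2 "m\<^sup>2"] by fastforce
    moreover have "f * kappa f * (2 / R\<^sup>2) * m \<ge> 0" using f k0 m by simp
    ultimately show ?thesis using 1 e1 by (simp add: e_def)
  next
    case 2
    have ff: "f\<^sup>2 \<ge> 8 * f" using 2 by (simp add: power2_eq_square)
    have fk: "f * kappa f \<ge> 1"
      using 2 d by (simp add: kappa_def pos_le_divide_eq power2_eq_square algebra_simps)
    have "(1 + 2 * f - f\<^sup>2) / (f\<^sup>2 + 1)\<^sup>2 * m\<^sup>2 \<le> 0"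
      using ff 2 by (intro mult_nonpos_nonneg divide_nonpos_nonneg) auto
    moreover have "f * kappa f * (2 / R\<^sup>2 * m) \<ge> 1 * (2 / R\<^sup>2 * m)"
      using fk m by (intro mult_right_mono) auto
    ultimately have e1': "2 * (radial R f + f * radial' R f) \<le> - (4 / R\<^sup>2 * m)"
      unfolding e1 by (simp add: mult.assoc)
    have "kappa f * (f / 2 - 2) \<ge> 1 / 4"
    proof -
      have "kappa f * (f / 2 - 2) = f * kappa f * (1 / 2 - 2 / f)" using 2 by (simp add: field_simps)
      also have "\<dots> \<ge> 1 * (1 / 4)"
        using fk 2 by (intro mult_mono) (auto simp: field_simps)
      finally show ?thesis by simp
    qed
    then have "1 / 4 * m\<^sup>2 \<le> kappa f * (f / 2 - 2) * m\<^sup>2" by (intro mult_right_mono) auto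
    then have e0': "radial R f * (2 - f / 2) \<le> - (m\<^sup>2 / 4)"
      unfolding radial_def m_def[symmetric] by (simp add: algebra_simps)
    show ?thesis
    proof (cases "f \<le> R\<^sup>2 / 2")
      case True
      then have "f / R\<^sup>2 \<le> 1 / 2" using R0 by (simp add: field_simps)
      then have mh: "m \<ge> 1 / 2" unfolding m_def by (intro max.coboundedI2) simp
      have "4 / R\<^sup>2 * m \<ge> 4 / R\<^sup>2 * (1 / 2)" using mh by (intro mult_left_mono) auto
      then have "2 * (radial R f + f * radial' R f) \<le> - (2 / R\<^sup>2)" using e1' by simp
      moreover have "(1 / 2)\<^sup>2 \<le> m\<^sup>2" using mh by (intro power_mono) auto
      then have "1 / 4 \<le> m\<^sup>2" by (simp add: power2_eq_square)
      moreover have "2 / R\<^sup>2 \<le> 1 / 16" using R R0 by (simp add: pos_divide_le_eq)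
      moreover have "a \<le> - (d / 4) \<Longrightarrow> 1 / 4 \<le> d \<Longrightarrow> b \<le> 1 / 16 \<Longrightarrow> a \<le> - b" for a b d :: real
        by simp
      ultimately have "2 * (radial R f + f * radial' R f) \<le> - (2 / R\<^sup>2)"
        "radial R f * (2 - f / 2) \<le> - (2 / R\<^sup>2)"
        using e0' by blast+
      moreover have "e = - (2 / R\<^sup>2)" using 2 True by (simp add: e_def)
      ultimately show ?thesis by simp
    next
      case False
      then have "e = 0" using 2 by (simp add: e_def)
      moreover have "- (4 / R\<^sup>2 * m) \<le> 0" "- (m\<^sup>2 / 4) \<le> 0" using m by auto
      ultimately show ?thesis using order_trans[OF e1'] order_trans[OF e0'] by simp
    qed
  qed
  then show "radial R f * (2 - f / 2) \<le> e" "2 * (radial R f + f * radial' R f) \<le> e" by auto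
qed

lemma radial_field:
  defines "Z \<equiv> \<lambda>R (x::real^3). radial R (x \<bullet> x) *\<^sub>R x"
  shows "(Z R has_derivative (\<lambda>v. radial R (x \<bullet> x) *\<^sub>R v + (2 * radial' R (x \<bullet> x) * (x \<bullet> v)) *\<^sub>R x)) (at x)"
    and "R > 0 \<Longrightarrow> Ck_on (Suc 0) UNIV (Z R)"
    and "R > 0 \<Longrightarrow> norm x > R \<Longrightarrow> Z R x = 0"
proof -
  have 1: "((\<lambda>x::real^3. x \<bullet> x) has_derivative (\<lambda>v. 2 * (x \<bullet> v))) (at x)" for x
    by (auto intro!: derivative_eq_intros simp: inner_commute)
  have 2: "((\<lambda>x::real^3. radial R (x \<bullet> x)) has_derivative (\<lambda>v. radial' R (x \<bullet> x) * (2 * (x \<bullet> v)))) (at x)" for x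
    using has_derivative_compose[OF 1 radial_has_derivative[unfolded has_field_derivative_def]] .
  show D: "(Z R has_derivative (\<lambda>v. radial R (x \<bullet> x) *\<^sub>R v + (2 * radial' R (x \<bullet> x) * (x \<bullet> v)) *\<^sub>R x)) (at x)" for x
    unfolding Z_def by (rule has_derivative_eq_rhs[OF has_derivative_scaleR[OF 2 has_derivative_ident]])
      (simp add: fun_eq_iff algebra_simps)
  show "Ck_on (Suc 0) UNIV (Z R)" if R: "R > 0"
  proof -
    have c: "continuous_on UNIV (\<lambda>x::real^3. radial R (x \<bullet> x))" "continuous_on UNIV (\<lambda>x::real^3. radial' R (x \<bullet> x))"
      unfolding radial_def radial'_def kappa_def kappa'_def
      by (intro continuous_intros ballI; use R sq_plus_1_nonzero in simp)+
    show ?thesis by (rule C1I[OF open_UNIV D]) (intro continuous_intros c)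
  qed
  assume R: "R > 0" "norm x > R"
  then have "R\<^sup>2 \<le> x \<bullet> x" using power_mono[of R "norm x" 2] by (simp add: power2_norm_eq_inner)
  then have "1 - (x \<bullet> x) / R\<^sup>2 \<le> 0" using R by (simp add: field_simps)
  then show "Z R x = 0" by (simp add: Z_def radial_def max_def)
qed

context shrinker_cover
begin

abbreviation "X i \<equiv> G \<circ> ps i"

definition "area_elt i u = norm (cross3 (pd 1 (X i) u) (pd 2 (X i) u))"

definition region :: "nat \<Rightarrow> (real^3) set \<Rightarrow> (real^2) set" where
  "region i B = {u \<in> D i. X i u \<in> B}"

lemma D_subset: "D i \<subseteq> cdom i" by (auto simp: D_def)

lemma region_borel:
  assumes "B \<in> sets borel"
  shows "region i B \<in> sets borel"
proof -
  have U: "open (cdom i)" by (rule patch_open[OF cP'])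
  have "continuous_on (cdom i) (X i)" using shrinker_patch_continuous(1)[OF patch[OF cP']] .
  then have "(\<lambda>u. if u \<in> cdom i then X i u else 0) \<in> borel_measurable borel"
    using U by (intro borel_measurable_continuous_on_if) auto
  then have "(\<lambda>u. if u \<in> cdom i then X i u else 0) -` B \<inter> space borel \<in> sets borel"
    using assms by (rule measurable_sets)
  moreover have "region i B = D i \<inter> ((\<lambda>u. if u \<in> cdom i then X i u else 0) -` B \<inter> space borel)"
    using subsetD[OF D_subset[of i]] by (auto simp: region_def)
  ultimately show ?thesis using D_borel by auto
qed

lemma area_elt_integrable:
  assumes "B \<in> sets borel"
  shows "set_integrable lebesgue (region i B) (area_elt i)"
proof -
  have "set_integrable lborel (cdom i) (area_elt i)"
    using area_integrable[OF cP'] unfolding area_elt_def[abs_def] .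
  then have "set_integrable lebesgue (cdom i) (area_elt i)"
    unfolding set_integrable_def by (auto simp: integrable_completion)
  then show ?thesis
    by (rule set_integrable_subset) (use region_borel[OF assms] D_subset in \<open>auto simp: region_def\<close>)
qed

lemma finite_cover:
  obtains k where "\<And>p. p \<in> topspace M \<Longrightarrow> norm (G p) \<le> R \<Longrightarrow> p \<in> (\<Union>i<k. img (c i))"
proof -
  let ?F = "{p \<in> topspace M. G p \<in> cball 0 R}"
  have "compactin M ?F"
    using compactin_proper_map_preimage[OF proper, of "cball 0 R"] by simp
  moreover have "\<And>W. W \<in> range (\<lambda>i. img (c i)) \<Longrightarrow> openin M W" using openin_img[OF cP] by auto
  moreover have "?F \<subseteq> \<Union> (range (\<lambda>i. img (c i)))" using c_cover by auto
  ultimately have "\<exists>\<F>. finite \<F> \<and> \<F> \<subseteq> range (\<lambda>i. img (c i)) \<and> ?F \<subseteq> \<Union>\<F>"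
    by (rule compactinD)
  then obtain \<F> where F: "finite \<F>" "\<F> \<subseteq> range (\<lambda>i. img (c i))" "?F \<subseteq> \<Union>\<F>" by blast
  obtain I where I: "finite I" "\<F> = (\<lambda>i. img (c i)) ` I"
    using finite_subset_image[OF F(1,2)] by blast
  obtain k where k: "\<forall>i\<in>I. i < k"
    using finite_nat_set_iff_bounded[THEN iffD1, OF I(1)] by blast
  show ?thesis
  proof (rule that[of k])
    fix p assume "p \<in> topspace M" "norm (G p) \<le> R"
    then have "p \<in> \<Union>\<F>" using F(3) by auto
    then obtain i where "i \<in> I" "p \<in> img (c i)" using I(2) by auto
    then show "p \<in> (\<Union>i<k. img (c i))" using k by auto
  qed
qed

lemma dens_radial_le:
  assumes R: "R\<^sup>2 \<ge> 32" "R > 0" and u: "u \<in> cdom i"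
  defines "Z \<equiv> \<lambda>x::real^3. radial R (x \<bullet> x) *\<^sub>R x" and "f \<equiv> X i u \<bullet> X i u"
  shows "dens Z (dZ Z) (ps i) u
    \<le> area_elt i u * (if f < 8 then 4 else if f \<le> R\<^sup>2 / 2 then - (2 / R\<^sup>2) else 0)"
proof -
  let ?N = "cross3 (pd 1 (X i) u) (pd 2 (X i) u)"
  define q where "q = (X i u \<bullet> ?N)\<^sup>2 / (norm ?N)\<^sup>2"
  have N: "?N \<noteq> 0" using patch[OF cP'] u by (auto simp: shrinker_patch_def)
  have "dZ Z = (\<lambda>x v. radial R (x \<bullet> x) *\<^sub>R v + (2 * radial' R (x \<bullet> x) * (x \<bullet> v)) *\<^sub>R x)"
    using frechet_derivative_at[OF radial_field(1)] unfolding Z_def by (metis (no_types, lifting) ext)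
  then have "dens Z (dZ Z) (ps i) u
      = norm ?N * (2 * radial R f + 2 * radial' R f * (f - q) - q * radial R f / 2)"
    unfolding Z_def f_def q_def using variation_radial[OF N, where \<psi>="radial R" and \<psi>'="radial' R" and x="X i u"] by simp
  also have "\<dots> \<le> norm ?N * (if f < 8 then 4 else if f \<le> R\<^sup>2 / 2 then - (2 / R\<^sup>2) else 0)"
  proof (intro mult_left_mono norm_ge_zero radial_integrand_le)
    show "0 \<le> q" by (simp add: q_def)
    show "q \<le> f"
    proof -
      have "(X i u \<bullet> ?N)\<^sup>2 \<le> f * (?N \<bullet> ?N)" unfolding f_def by (rule Cauchy_Schwarz_ineq)
      then show ?thesis using N by (simp add: q_def power2_norm_eq_inner pos_divide_le_eq)
    qed
    show "radial R f * (2 - f / 2) \<le> (if f < 8 then 4 else if f \<le> R\<^sup>2 / 2 then - (2 / R\<^sup>2) else 0)"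
      "2 * (radial R f + f * radial' R f) \<le> (if f < 8 then 4 else if f \<le> R\<^sup>2 / 2 then - (2 / R\<^sup>2) else 0)"
      using radial_extremes[of f R] R by (auto simp: f_def)
  qed
  finally show ?thesis by (simp add: area_elt_def)
qed

text \<open>Integrated, the bound on the density says that \<open>2 / R^2\<close> times the area of
  the shell is at most 4 times the area of the part with \<open>x \<bullet> x < 8\<close>. The
  latter is a fixed finite number, and \<open>C\<close> is twice this number.\<close>

lemma area_growth:
  obtains C where "C \<ge> 0" "\<And>R k. R\<^sup>2 \<ge> 32 \<Longrightarrow> R > 0 \<Longrightarrow>
    (\<And>p. p \<in> topspace M \<Longrightarrow> norm (G p) \<le> R \<Longrightarrow> p \<in> (\<Union>i<k. img (c i))) \<Longrightarrow>
    (\<Sum>i<k. LINT u:region i {x. 8 \<le> x \<bullet> x \<and> x \<bullet> x \<le> R\<^sup>2 / 2}|lebesgue. area_elt i u) \<le> C * R\<^sup>2"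
proof -
  define B1 :: "(real^3) set" where "B1 = {x. x \<bullet> x < 8}"
  define a1 where "a1 i = (LINT u:region i B1|lebesgue. area_elt i u)" for i
  have "open B1" unfolding B1_def by (intro open_Collect_less continuous_intros)
  then have B1: "B1 \<in> sets borel" by (rule borel_open)
  \<comment> \<open>Radius 3 suffices since 8 < 9. Pieces from index \<open>k0\<close> on do not
    meet the inner region, so \<open>C\<close> can be chosen independently of \<open>k\<close> and
    \<open>R\<close>.\<close>
  obtain k0 where k0: "\<And>p. p \<in> topspace M \<Longrightarrow> norm (G p) \<le> 3 \<Longrightarrow> p \<in> (\<Union>i<k0. img (c i))"
    using finite_cover[of 3] by blast
  have empty: "region i B1 = {}" if i: "i \<ge> k0" for i
  proof (rule ccontr)
    assume "region i B1 \<noteq> {}"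
    then obtain u where u: "u \<in> D i" "X i u \<in> B1" by (auto simp: region_def)
    have "(norm (X i u))\<^sup>2 \<le> 3\<^sup>2" using u(2) by (simp add: B1_def power2_norm_eq_inner)
    then have "norm (X i u) \<le> 3" by (rule power2_le_imp_le) simp
    then have "norm (G (ps i u)) \<le> 3" by simp
    moreover have "ps i u \<in> topspace M" using u(1) patch_subset[OF cP'] D_subset by blast
    ultimately have "ps i u \<in> (\<Union>i<k0. img (c i))" using k0 by blast
    then show False using u(1) i by (auto simp: D_def piece_def)
  qed
  have a1_nonneg: "a1 i \<ge> 0" for i
    unfolding a1_def set_lebesgue_integral_def by (intro integral_nonneg_AE) (auto simp: area_elt_def)
  define C where "C = 2 * (\<Sum>i<k0. a1 i)"
  have "C \<ge> 0" by (simp add: C_def sum_nonneg a1_nonneg)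
  have "(\<Sum>i<k. LINT u:region i {x. 8 \<le> x \<bullet> x \<and> x \<bullet> x \<le> R\<^sup>2 / 2}|lebesgue. area_elt i u) \<le> C * R\<^sup>2"
    if R: "R\<^sup>2 \<ge> 32" "R > 0" and k: "\<And>p. p \<in> topspace M \<Longrightarrow> norm (G p) \<le> R \<Longrightarrow> p \<in> (\<Union>i<k. img (c i))"
    for R k
  proof -
    define Z where "Z = (\<lambda>x::real^3. radial R (x \<bullet> x) *\<^sub>R x)"
    define B2 :: "(real^3) set" where "B2 = {x. 8 \<le> x \<bullet> x \<and> x \<bullet> x \<le> R\<^sup>2 / 2}"
    have "B2 = {x. 8 \<le> x \<bullet> x} \<inter> {x. x \<bullet> x \<le> R\<^sup>2 / 2}" by (auto simp: B2_def)
    also have "closed \<dots>" by (intro closed_Int closed_Collect_le continuous_intros)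
    finally have B2: "B2 \<in> sets borel" by (rule borel_closed)
    define a2 where "a2 i = (LINT u:region i B2|lebesgue. area_elt i u)" for i
    have Z: "Ck_on (Suc 0) UNIV Z" "\<And>x. norm x > R \<Longrightarrow> Z x = 0"
      using radial_field(2)[of R] radial_field(3)[of R] R(2) unfolding Z_def by auto
    have fv: "set_integrable lebesgue (D i) (dens Z (dZ Z) (ps i))"
      "(\<Sum>i<k. LINT u:D i|lebesgue. dens Z (dZ Z) (ps i) u) = 0" for i
      by (rule first_variation[OF Z(1), of R k]; (rule Z(2) k, assumption+))+
    have le: "(LINT u:D i|lebesgue. dens Z (dZ Z) (ps i) u) \<le> 4 * a1 i - 2 / R\<^sup>2 * a2 i" for i
    proof -
      have i1: "integrable lebesgue (\<lambda>u. indicator (region i B1) u * area_elt i u)"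
        and i2: "integrable lebesgue (\<lambda>u. indicator (region i B2) u * area_elt i u)"
        using area_elt_integrable[OF B1] area_elt_integrable[OF B2] by (simp_all add: set_integrable_def)
      have "(LINT u:D i|lebesgue. dens Z (dZ Z) (ps i) u)
        \<le> (LINT u|lebesgue. 4 * (indicator (region i B1) u * area_elt i u)
            - 2 / R\<^sup>2 * (indicator (region i B2) u * area_elt i u))"
        unfolding set_lebesgue_integral_def
      proof (rule integral_mono)
        show "integrable lebesgue (\<lambda>u. indicator (D i) u *\<^sub>R dens Z (dZ Z) (ps i) u)"
          using fv(1)[of i] by (simp only: set_integrable_def)
        show "integrable lebesgue (\<lambda>u. 4 * (indicator (region i B1) u * area_elt i u)
            - 2 / R\<^sup>2 * (indicator (region i B2) u * area_elt i u))"
          by (intro Bochner_Integration.integrable_diff integrable_mult_right i1 i2)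
        fix u
        show "indicator (D i) u *\<^sub>R dens Z (dZ Z) (ps i) u
          \<le> 4 * (indicator (region i B1) u * area_elt i u) - 2 / R\<^sup>2 * (indicator (region i B2) u * area_elt i u)"
        proof (cases "u \<in> D i")
          case True
          then have "dens Z (dZ Z) (ps i) u \<le> area_elt i u * (if X i u \<bullet> X i u < 8 then 4
              else if X i u \<bullet> X i u \<le> R\<^sup>2 / 2 then - (2 / R\<^sup>2) else 0)"
            unfolding Z_def using D_subset by (intro dens_radial_le R) auto
          then show ?thesis
            using True by (auto simp: region_def B1_def B2_def indicator_def algebra_simps)
        next
          case False
          then show ?thesis by (simp add: region_def)
        qed
      qed
      also have "\<dots> = 4 * a1 i - 2 / R\<^sup>2 * a2 i"
        using i1 i2 by (simp add: a1_def a2_def set_lebesgue_integral_def)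
      finally show ?thesis .
    qed
    have "0 = (\<Sum>i<k. LINT u:D i|lebesgue. dens Z (dZ Z) (ps i) u)" using fv(2) by simp
    also have "\<dots> \<le> (\<Sum>i<k. 4 * a1 i - 2 / R\<^sup>2 * a2 i)" by (intro sum_mono le)
    also have "\<dots> = 4 * (\<Sum>i<k. a1 i) - 2 / R\<^sup>2 * (\<Sum>i<k. a2 i)"
      by (simp add: sum_subtractf sum_distrib_left)
    also have "(\<Sum>i<k. a1 i) \<le> (\<Sum>i<k0. a1 i)"
    proof -
      have "(\<Sum>i<k. a1 i) \<le> (\<Sum>i<max k k0. a1 i)"
        by (intro sum_mono2) (auto simp: a1_nonneg)
      also have "\<dots> = (\<Sum>i<k0. a1 i)"
        by (rule sum.mono_neutral_right) (auto simp: a1_def empty set_lebesgue_integral_def)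
      finally show ?thesis .
    qed
    finally have "2 / R\<^sup>2 * (\<Sum>i<k. a2 i) \<le> 4 * (\<Sum>i<k0. a1 i)" by simp
    then have "(\<Sum>i<k. a2 i) \<le> C * R\<^sup>2"
      using R by (simp add: C_def field_simps)
    then show ?thesis by (simp add: a2_def B2_def)
  qed
  with \<open>C \<ge> 0\<close> show ?thesis using that by blast
qed

end

section \<open>Area bounds for tubes mapped to the plane of squared distances\<close>

lemma tube_map_eq: "tube_map y z = (z \<bullet> z) *\<^sub>R axis 1 1 + (z \<bullet> z - (z \<bullet> y)\<^sup>2) *\<^sub>R axis 2 1"
  by (simp add: tube_map_def vec_eq_iff forall_2 axis_def)

text \<open>The components have gradients \<open>2 x\<close> and
  \<open>2 x - 2 (x \<bullet> y) y\<close>, whose cross product is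
  \<open>- 4 (x \<bullet> y) (x \<times> y)\<close>; the determinant is its inner product with
  \<open>cross3 a b\<close>.\<close>

lemma tube_map_has_derivative:
  fixes X :: "real^2 \<Rightarrow> real^3"
  assumes X: "(X has_derivative (\<lambda>h. h $ 1 *\<^sub>R a + h $ 2 *\<^sub>R b)) (at u)"
  obtains g' where "((\<lambda>u. tube_map y (X u)) has_derivative g') (at u)"
    "det (matrix g') = - (4 * (X u \<bullet> y) * (cross3 (X u) y \<bullet> cross3 a b))"
proof -
  let ?d = "\<lambda>h::real^2. h $ 1 *\<^sub>R a + h $ 2 *\<^sub>R b"
  let ?g' = "\<lambda>h::real^2. (2 * (X u \<bullet> ?d h)) *\<^sub>R axis 1 1
    + (2 * (X u \<bullet> ?d h) - 2 * (X u \<bullet> y) * (?d h \<bullet> y)) *\<^sub>R axis 2 1 :: real^2"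
  have 1: "((\<lambda>u. X u \<bullet> X u) has_derivative (\<lambda>h. 2 * (X u \<bullet> ?d h))) (at u)"
    by (rule has_derivative_eq_rhs[OF has_derivative_inner[OF X X]]) (simp add: fun_eq_iff inner_commute)
  have 2: "((\<lambda>u. X u \<bullet> y) has_derivative (\<lambda>h. ?d h \<bullet> y)) (at u)"
    by (rule has_derivative_eq_rhs[OF has_derivative_inner[OF X has_derivative_const]]) simp
  have 3: "((\<lambda>u. (X u \<bullet> y)\<^sup>2) has_derivative (\<lambda>h. 2 * (X u \<bullet> y) * (?d h \<bullet> y))) (at u)"
    unfolding power2_eq_square
    by (rule has_derivative_eq_rhs[OF has_derivative_mult[OF 2 2]]) (simp add: fun_eq_iff algebra_simps)
  have "((\<lambda>u. tube_map y (X u)) has_derivative ?g') (at u)"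
    unfolding tube_map_eq
    by (intro has_derivative_add has_derivative_scaleR_left has_derivative_diff 1 3)
  moreover have "det (matrix ?g') = - (4 * (X u \<bullet> y) * (cross3 (X u) y \<bullet> cross3 a b))"
  proof -
    have dots: "cross3 x y \<bullet> cross3 a b = (x \<bullet> a) * (y \<bullet> b) - (x \<bullet> b) * (y \<bullet> a)" for x
      by (simp add: cross3_simps)
    show ?thesis unfolding dots
      by (simp add: det_2 matrix_def axis_def inner_commute[of _ y] algebra_simps)
  qed
  ultimately show ?thesis using that by blast
qed

context shrinker_cover
begin

lemma closed_tube_UNIV: "tube UNIV \<rho> (y::real^3) \<in> sets borel"
  using compact_tube[OF closed_UNIV] compact_imp_closed borel_closed by blast

text \<open>On the tube \<open>|x \<bullet> y| \<le> 2 \<rho>\<close>, and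
  \<open>|x \<times> y|\<close> is the distance to the line through \<open>y\<close>, at most 4. So
  the Jacobian is at most 4 times \<open>2 \<rho>\<close> times 4 times the area element.\<close>

lemma image_region_measure_le:
  assumes y: "norm y = 1" and \<rho>: "\<rho> \<ge> 4"
  shows "(\<lambda>u. tube_map y (X i u)) ` region i (tube UNIV \<rho> y) \<in> lmeasurable"
    "measure lebesgue ((\<lambda>u. tube_map y (X i u)) ` region i (tube UNIV \<rho> y))
      \<le> 32 * \<rho> * (LINT u:region i (tube UNIV \<rho> y)|lebesgue. area_elt i u)"
proof -
  let ?T = "region i (tube UNIV \<rho> y)"
  let ?a = "pd 1 (X i)" and ?b = "pd 2 (X i)"
  let ?det = "\<lambda>u. 4 * (X i u \<bullet> y) * (cross3 (X i u) y \<bullet> cross3 (?a u) (?b u))"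
  have Tb: "?T \<in> sets borel" by (rule region_borel[OF closed_tube_UNIV])
  have Tl: "?T \<in> sets lebesgue" using Tb by simp
  have Tc: "u \<in> cdom i" "X i u \<in> tube UNIV \<rho> y" if "u \<in> ?T" for u
    using that D_subset by (auto simp: region_def)
  have "\<forall>u\<in>cdom i. \<exists>g'. ((\<lambda>u. tube_map y (X i u)) has_derivative g') (at u) \<and> \<bar>det (matrix g')\<bar> = \<bar>?det u\<bar>"
  proof
    fix u assume "u \<in> cdom i"
    show "\<exists>g'. ((\<lambda>u. tube_map y (X i u)) has_derivative g') (at u) \<and> \<bar>det (matrix g')\<bar> = \<bar>?det u\<bar>"
    proof (rule tube_map_has_derivative[OF shrinker_patchD(1)[OF patch[OF cP'] \<open>u \<in> cdom i\<close>], of y])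
      fix g' assume "((\<lambda>u. tube_map y (X i u)) has_derivative g') (at u)" "det (matrix g') = - ?det u"
      then show ?thesis by (intro exI[of _ g'] conjI) (simp_all only: abs_minus_cancel)
    qed
  qed
  from bchoice[OF this]
  obtain g' where g'0: "\<forall>u\<in>cdom i. ((\<lambda>u. tube_map y (X i u)) has_derivative g' u) (at u)
      \<and> \<bar>det (matrix (g' u))\<bar> = \<bar>?det u\<bar>" ..
  have g': "((\<lambda>u. tube_map y (X i u)) has_derivative g' u) (at u)"
    "\<bar>det (matrix (g' u))\<bar> = \<bar>?det u\<bar>" if "u \<in> cdom i" for u
    using bspec[OF g'0 that] by simp_all
  have bound: "\<bar>?det u\<bar> \<le> 32 * \<rho> * area_elt i u" if u: "u \<in> ?T" for u
  proof -
    let ?x = "X i u"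
    have t: "norm ?x \<le> 2 * \<rho>" "?x \<bullet> ?x - (?x \<bullet> y)\<^sup>2 \<le> 16"
      using Tc(2)[OF u] by (auto simp: tube_def)
    have "\<bar>?x \<bullet> y\<bar> \<le> 2 * \<rho>" using Cauchy_Schwarz_ineq2[of ?x y] t(1) y by simp
    moreover have "norm (cross3 ?x y) \<le> 4"
    proof (rule power2_le_imp_le)
      have "(norm (cross3 ?x y))\<^sup>2 = ?x \<bullet> ?x - (?x \<bullet> y)\<^sup>2"
        using norm_cross_dot[of ?x y] y by (simp add: power2_norm_eq_inner)
      then show "(norm (cross3 ?x y))\<^sup>2 \<le> 4\<^sup>2" using t(2) by simp
    qed simp
    moreover have "\<bar>cross3 ?x y \<bullet> cross3 (?a u) (?b u)\<bar> \<le> norm (cross3 ?x y) * area_elt i u"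
      unfolding area_elt_def by (rule Cauchy_Schwarz_ineq2)
    ultimately have "\<bar>?x \<bullet> y\<bar> * \<bar>cross3 ?x y \<bullet> cross3 (?a u) (?b u)\<bar> \<le> (2 * \<rho>) * (4 * area_elt i u)"
      by (intro mult_mono order_trans[OF \<open>_ \<le> norm (cross3 ?x y) * area_elt i u\<close>] mult_right_mono)
        (auto simp: area_elt_def)
    then show ?thesis by (simp add: abs_mult)
  qed
  have Jint: "set_integrable lebesgue ?T (\<lambda>u. 32 * \<rho> * area_elt i u)"
    using area_elt_integrable[OF closed_tube_UNIV, of i \<rho> y] by (rule set_integrable_mult_right)
  note c = shrinker_patch_continuous[OF patch[OF cP', of i]]
  have "continuous_on (cdom i) (\<lambda>u. \<bar>?det u\<bar>)"
    by (intro continuous_intros c)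
  then have "continuous_on ?T (\<lambda>u. \<bar>?det u\<bar>)"
    by (rule continuous_on_subset) (use Tc in auto)
  then have "set_borel_measurable borel ?T (\<lambda>u. \<bar>?det u\<bar>)"
    using Tb unfolding set_borel_measurable_def by (rule borel_measurable_continuous_on_indicator[rotated])
  then have "set_borel_measurable lebesgue ?T (\<lambda>u. \<bar>?det u\<bar>)"
    unfolding set_borel_measurable_def by (intro measurable_completion) simp
  then have det_int: "set_integrable lebesgue ?T (\<lambda>u. \<bar>?det u\<bar>)"
    using bound by (intro set_integrable_bound[OF Jint]) (auto intro!: AE_I2 intro: order_trans[OF _ abs_ge_self])
  have "set_integrable lebesgue ?T (\<lambda>u. \<bar>det (matrix (g' u))\<bar>)"
    using det_int g'(2) Tc(1) by (simp cong: set_integrable_cong)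
  then have int: "(\<lambda>u. \<bar>det (matrix (g' u))\<bar>) integrable_on ?T"
    "integral ?T (\<lambda>u. \<bar>det (matrix (g' u))\<bar>) = (LINT u:?T|lebesgue. \<bar>det (matrix (g' u))\<bar>)"
    by (simp_all add: set_lebesgue_integral_eq_integral)
  have der: "((\<lambda>u. tube_map y (X i u)) has_derivative g' u) (at u within ?T)" if "u \<in> ?T" for u
    using g'(1)[OF Tc(1)[OF that]] has_derivative_at_withinI by blast
  show "(\<lambda>u. tube_map y (X i u)) ` ?T \<in> lmeasurable"
    by (rule measurable_differentiable_image[OF Tl der int(1)])
  have "measure lebesgue ((\<lambda>u. tube_map y (X i u)) ` ?T) \<le> integral ?T (\<lambda>u. \<bar>det (matrix (g' u))\<bar>)"
    by (rule measure_differentiable_image[OF Tl der int(1)])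
  also have "\<dots> = (LINT u:?T|lebesgue. \<bar>?det u\<bar>)"
    unfolding int(2) using g'(2) Tc(1) Tl by (intro set_lebesgue_integral_cong) auto
  also have "\<dots> \<le> (LINT u:?T|lebesgue. 32 * \<rho> * area_elt i u)"
    by (rule set_integral_mono[OF det_int Jint bound])
  also have "\<dots> = 32 * \<rho> * (LINT u:?T|lebesgue. area_elt i u)"
    by (rule set_integral_mult_right)
  finally show "measure lebesgue ((\<lambda>u. tube_map y (X i u)) ` ?T) \<le> \<dots>" .
qed

lemma tube_measure_le:
  assumes y: "norm y = 1" and \<rho>: "\<rho> \<ge> 4"
    and k: "\<And>p. p \<in> topspace M \<Longrightarrow> norm (G p) \<le> 3 * \<rho> \<Longrightarrow> p \<in> (\<Union>i<k. img (c i))"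
  shows "measure lebesgue (tube_map y ` tube (G ` topspace M) \<rho> y)
    \<le> 32 * \<rho> * (\<Sum>i<k. LINT u:region i (tube UNIV \<rho> y)|lebesgue. area_elt i u)"
proof -
  have eq: "tube_map y ` tube (G ` topspace M) \<rho> y
      = (\<Union>i<k. (\<lambda>u. tube_map y (X i u)) ` region i (tube UNIV \<rho> y))"
  proof (intro equalityI subsetI)
    fix q assume "q \<in> tube_map y ` tube (G ` topspace M) \<rho> y"
    then obtain p where p: "p \<in> topspace M" "G p \<in> tube UNIV \<rho> y" "q = tube_map y (G p)"
      by (auto simp: tube_def)
    have "norm (G p) \<le> 3 * \<rho>" using p(2) \<rho> by (auto simp: tube_def)
    then have "p \<in> (\<Union>i<k. piece i)" using k[OF p(1)] UN_piece by blast
    then obtain i where i: "i < k" "p \<in> piece i" by auto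
    then obtain u where "u \<in> cdom i" "ps i u = p" by (auto simp: piece_def img_def)
    then have "u \<in> region i (tube UNIV \<rho> y)" using i p(2) by (simp add: region_def D_def)
    then show "q \<in> (\<Union>i<k. (\<lambda>u. tube_map y (X i u)) ` region i (tube UNIV \<rho> y))"
      using i(1) p(3) \<open>ps i u = p\<close> by (auto intro!: bexI[of _ i] image_eqI[of _ _ u])
  next
    fix q assume "q \<in> (\<Union>i<k. (\<lambda>u. tube_map y (X i u)) ` region i (tube UNIV \<rho> y))"
    then obtain i u where iu: "u \<in> D i" "X i u \<in> tube UNIV \<rho> y" "q = tube_map y (X i u)"
      by (auto simp: region_def)
    then have "ps i u \<in> topspace M" using D_subset patch_subset[OF cP'] by blast
    then show "q \<in> tube_map y ` tube (G ` topspace M) \<rho> y"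
      using iu by (intro image_eqI[of _ _ "X i u"]) (auto simp: tube_def)
  qed
  have "measure lebesgue (tube_map y ` tube (G ` topspace M) \<rho> y)
      \<le> (\<Sum>i<k. measure lebesgue ((\<lambda>u. tube_map y (X i u)) ` region i (tube UNIV \<rho> y)))"
    unfolding eq using image_region_measure_le(1)[OF y \<rho>]
    by (intro measure_UNION_le) auto
  also have "\<dots> \<le> (\<Sum>i<k. 32 * \<rho> * (LINT u:region i (tube UNIV \<rho> y)|lebesgue. area_elt i u))"
    by (intro sum_mono image_region_measure_le y \<rho>)
  finally show ?thesis by (simp add: sum_distrib_left)
qed

text \<open>By \<open>cap_disjoint\<close> the tubes of separated directions do not overlap, so
  their areas add up to at most that of one shell. The radius \<open>3 \<rho>\<close> is chosen so
  that \<open>(3 \<rho>)^2 / 2\<close> exceeds \<open>(2 \<rho>)^2\<close>; the constant is 288 = 32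
  times 9.\<close>

lemma sum_tube_measure_le:
  obtains C where "C \<ge> 0" "\<And>\<rho> Y. \<lbrakk>\<rho> \<ge> 4; finite Y; \<And>y. y \<in> Y \<Longrightarrow> norm y = 1;
      \<And>y y'. y \<in> Y \<Longrightarrow> y' \<in> Y \<Longrightarrow> y \<noteq> y' \<Longrightarrow> dist y y' > 12 / \<rho>\<rbrakk> \<Longrightarrow>
    (\<Sum>y\<in>Y. measure lebesgue (tube_map y ` tube (G ` topspace M) \<rho> y)) \<le> C * \<rho> ^ 3"
proof (rule area_growth)
  fix C assume C: "C \<ge> 0" "\<And>R k. R\<^sup>2 \<ge> 32 \<Longrightarrow> R > 0 \<Longrightarrow>
    (\<And>p. p \<in> topspace M \<Longrightarrow> norm (G p) \<le> R \<Longrightarrow> p \<in> (\<Union>i<k. img (c i))) \<Longrightarrow>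
    (\<Sum>i<k. LINT u:region i {x. 8 \<le> x \<bullet> x \<and> x \<bullet> x \<le> R\<^sup>2 / 2}|lebesgue. area_elt i u) \<le> C * R\<^sup>2"
  have "(\<Sum>y\<in>Y. measure lebesgue (tube_map y ` tube (G ` topspace M) \<rho> y)) \<le> (288 * C) * \<rho> ^ 3"
    if \<rho>: "\<rho> \<ge> 4" and Y: "finite Y" "\<And>y. y \<in> Y \<Longrightarrow> norm y = 1"
      "\<And>y y'. y \<in> Y \<Longrightarrow> y' \<in> Y \<Longrightarrow> y \<noteq> y' \<Longrightarrow> dist y y' > 12 / \<rho>" for \<rho> Y
  proof -
    define B where "B = {x::real^3. 8 \<le> x \<bullet> x \<and> x \<bullet> x \<le> (3 * \<rho>)\<^sup>2 / 2}"
    have "B = {x. 8 \<le> x \<bullet> x} \<inter> {x. x \<bullet> x \<le> (3 * \<rho>)\<^sup>2 / 2}" by (auto simp: B_def)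
    also have "closed \<dots>" by (intro closed_Int closed_Collect_le continuous_intros)
    finally have Bb: "B \<in> sets borel" by (rule borel_closed)
    have \<rho>2: "\<rho>\<^sup>2 \<ge> 16" using \<rho> power_mono[of 4 \<rho> 2] by simp
    have sub: "tube UNIV \<rho> y \<subseteq> B" for y
    proof
      fix x assume "x \<in> tube UNIV \<rho> y"
      then have "\<rho>\<^sup>2 \<le> (norm x)\<^sup>2" "(norm x)\<^sup>2 \<le> (2 * \<rho>)\<^sup>2"
        using \<rho> power_mono[of \<rho> "norm x" 2] power_mono[of "norm x" "2 * \<rho>" 2] by (auto simp: tube_def)
      then show "x \<in> B" using \<rho>2 by (simp add: B_def power2_norm_eq_inner power_mult_distrib)
    qed
    obtain k where k: "\<And>p. p \<in> topspace M \<Longrightarrow> norm (G p) \<le> 3 * \<rho> \<Longrightarrow> p \<in> (\<Union>i<k. img (c i))"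
      using finite_cover[of "3 * \<rho>"] by blast
    have disj: "disjoint_family_on (\<lambda>y. region i (tube UNIV \<rho> y)) Y" for i
      unfolding disjoint_family_on_def
    proof (intro ballI impI, rule ccontr)
      fix y y' assume yy: "y \<in> Y" "y' \<in> Y" "y \<noteq> y'"
        and "region i (tube UNIV \<rho> y) \<inter> region i (tube UNIV \<rho> y') \<noteq> {}"
      then obtain x where x: "x \<in> tube UNIV \<rho> y" "x \<in> tube UNIV \<rho> y'" by (auto simp: region_def)
      have "dist y y' \<le> 12 / \<rho>"
        by (rule cap_disjoint[of \<rho> x]) (use \<rho> x Y(2) yy in \<open>auto simp: tube_def\<close>)
      then show False using Y(3)[OF yy] by simp
    qed
    have reg: "(\<Sum>y\<in>Y. LINT u:region i (tube UNIV \<rho> y)|lebesgue. area_elt i u)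
        \<le> (LINT u:region i B|lebesgue. area_elt i u)" for i
    proof -
      have m: "region i (tube UNIV \<rho> y) \<in> sets lebesgue" for y
        using region_borel[OF closed_tube_UNIV] by simp
      have U: "set_integrable lebesgue (\<Union>y\<in>Y. region i (tube UNIV \<rho> y)) (area_elt i)"
        using Y(1) m area_elt_integrable[OF closed_tube_UNIV] by (intro set_integrable_UN) auto
      have "(\<Sum>y\<in>Y. LINT u:region i (tube UNIV \<rho> y)|lebesgue. area_elt i u)
         = (LINT u:(\<Union>y\<in>Y. region i (tube UNIV \<rho> y))|lebesgue. area_elt i u)"
        using Y(1) disj m area_elt_integrable[OF closed_tube_UNIV]
        by (intro set_integral_finite_Union[symmetric]) auto
      also have "\<dots> \<le> (LINT u:region i B|lebesgue. area_elt i u)"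
        unfolding set_lebesgue_integral_def
      proof (rule integral_mono)
        show "integrable lebesgue (\<lambda>u. indicator (\<Union>y\<in>Y. region i (tube UNIV \<rho> y)) u *\<^sub>R area_elt i u)"
          using U by (simp only: set_integrable_def)
        show "integrable lebesgue (\<lambda>u. indicator (region i B) u *\<^sub>R area_elt i u)"
          using area_elt_integrable[OF Bb, of i] by (simp only: set_integrable_def)
        show "indicator (\<Union>y\<in>Y. region i (tube UNIV \<rho> y)) u *\<^sub>R area_elt i u
            \<le> indicator (region i B) u *\<^sub>R area_elt i u" for u
          using sub by (auto simp: indicator_def region_def area_elt_def)
      qed
      finally show ?thesis .
    qed
    have "(\<Sum>y\<in>Y. measure lebesgue (tube_map y ` tube (G ` topspace M) \<rho> y))
        \<le> (\<Sum>y\<in>Y. 32 * \<rho> * (\<Sum>i<k. LINT u:region i (tube UNIV \<rho> y)|lebesgue. area_elt i u))"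
      by (intro sum_mono tube_measure_le Y(2) \<rho> k)
    also have "\<dots> = 32 * \<rho> * (\<Sum>y\<in>Y. \<Sum>i<k. LINT u:region i (tube UNIV \<rho> y)|lebesgue. area_elt i u)"
      by (simp add: sum_distrib_left)
    also have "(\<Sum>y\<in>Y. \<Sum>i<k. LINT u:region i (tube UNIV \<rho> y)|lebesgue. area_elt i u)
      = (\<Sum>i<k. \<Sum>y\<in>Y. LINT u:region i (tube UNIV \<rho> y)|lebesgue. area_elt i u)"
      by (rule sum.swap)
    also have "32 * \<rho> * \<dots> \<le> 32 * \<rho> * (\<Sum>i<k. LINT u:region i B|lebesgue. area_elt i u)"
      using \<rho> by (intro mult_left_mono sum_mono reg) auto
    also have "\<dots> \<le> 32 * \<rho> * (C * (3 * \<rho>)\<^sup>2)"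
      unfolding B_def using \<rho> \<rho>2 by (intro mult_left_mono C(2) k) (auto simp: power_mult_distrib)
    also have "\<dots> = (288 * C) * \<rho> ^ 3" by (simp add: power2_eq_square power3_eq_cube)
    finally show ?thesis .
  qed
  note main = this
  show ?thesis
  proof (rule that[of "288 * C"])
    show "0 \<le> 288 * C" using \<open>0 \<le> C\<close> by (intro mult_nonneg_nonneg) simp_all
    fix \<rho> :: real and Y :: "(real^3) set"
    assume "\<rho> \<ge> 4" "finite Y" "\<And>y. y \<in> Y \<Longrightarrow> norm y = 1"
      "\<And>y y'. y \<in> Y \<Longrightarrow> y' \<in> Y \<Longrightarrow> y \<noteq> y' \<Longrightarrow> dist y y' > 12 / \<rho>"
    then show "(\<Sum>y\<in>Y. measure lebesgue (tube_map y ` tube (G ` topspace M) \<rho> y)) \<le> (288 * C) * \<rho> ^ 3"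
      by (rule main)
  qed
qed

end

section \<open>Patches of an immersed self-shrinking surface\<close>

text \<open>The inverse of the 2 by 2 Gram matrix is its adjugate over the determinant, here
  multiplied out. The formula is stated for any index type with two elements because the dimension
  is known only as a cardinality.\<close>

lemma mean_curvature_dim2:
  fixes X \<nu> :: "real^'n::finite \<Rightarrow> real^'m::finite"
  assumes i: "(UNIV :: 'n set) = {i1, i2}" "i1 \<noteq> i2"
  defines "a \<equiv> \<lambda>u. frechet_derivative X (at u) (axis i1 1)" and "b \<equiv> \<lambda>u. frechet_derivative X (at u) (axis i2 1)"
    and "\<nu>1 \<equiv> \<lambda>u. frechet_derivative \<nu> (at u) (axis i1 1)" and "\<nu>2 \<equiv> \<lambda>u. frechet_derivative \<nu> (at u) (axis i2 1)"
  assumes d: "(a u \<bullet> a u) * (b u \<bullet> b u) - (a u \<bullet> b u)\<^sup>2 \<noteq> 0"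
  shows "mean_curvature X \<nu> u * ((a u \<bullet> a u) * (b u \<bullet> b u) - (a u \<bullet> b u)\<^sup>2)
    = (\<nu>1 u \<bullet> a u) * (b u \<bullet> b u) - (\<nu>1 u \<bullet> b u) * (a u \<bullet> b u)
      + (a u \<bullet> a u) * (\<nu>2 u \<bullet> b u) - (a u \<bullet> b u) * (\<nu>2 u \<bullet> a u)"
proof -
  define e where "e = (a u \<bullet> a u) * (b u \<bullet> b u) - (a u \<bullet> b u)\<^sup>2"
  have e0: "e \<noteq> 0" using d by (simp add: e_def)
  define B :: "real^'n^'n" where "B = (\<chi> i j. (if i = j then (if i = i1 then b u \<bullet> b u else a u \<bullet> a u)
     else - (a u \<bullet> b u)) / e)"
  have sum: "(\<Sum>i\<in>UNIV. g i) = g i1 + g i2" for g :: "'n \<Rightarrow> real"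
    unfolding i(1) using i(2) by simp
  have all: "(\<forall>i::'n. Q i) \<longleftrightarrow> Q i1 \<and> Q i2" for Q
    using i(1) by (metis UNIV_I insertE singletonD)
  have g: "first_fundamental_form X u $ i1 $ i1 = a u \<bullet> a u" "first_fundamental_form X u $ i1 $ i2 = a u \<bullet> b u"
    "first_fundamental_form X u $ i2 $ i1 = a u \<bullet> b u" "first_fundamental_form X u $ i2 $ i2 = b u \<bullet> b u"
    by (simp_all add: first_fundamental_form_def a_def b_def inner_commute)
  have "first_fundamental_form X u ** B = mat 1"
    using i(2) e0 unfolding vec_eq_iff all
    by (auto simp: matrix_matrix_mult_def sum g B_def mat_def field_simps)
      (simp_all add: e_def power2_eq_square algebra_simps)
  then have inv: "matrix_inv (first_fundamental_form X u) = B" by (rule matrix_inv_eqI)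
  have "mean_curvature X \<nu> u * e = (\<nu>1 u \<bullet> a u) * (b u \<bullet> b u) - (\<nu>1 u \<bullet> b u) * (a u \<bullet> b u)
      + (a u \<bullet> a u) * (\<nu>2 u \<bullet> b u) - (a u \<bullet> b u) * (\<nu>2 u \<bullet> a u)"
    unfolding mean_curvature_def inv sum
    using i(2) e0 by (simp add: B_def a_def b_def \<nu>1_def \<nu>2_def field_simps)
  then show ?thesis by (simp add: e_def)
qed

text \<open>Since \<open>cross3 (cross3 a b) v = 0\<close>, equality holds in Cauchy-Schwarz, so
  \<open>v\<close> equals its projection onto \<open>cross3 a b\<close>.\<close>

lemma perp_cross3_parallel:
  fixes v a b :: "real^3"
  assumes N: "cross3 a b \<noteq> 0" and v: "v \<bullet> a = 0" "v \<bullet> b = 0"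
  shows "v = ((v \<bullet> cross3 a b) / (cross3 a b \<bullet> cross3 a b)) *\<^sub>R cross3 a b"
proof -
  let ?N = "cross3 a b"
  define c where "c = (v \<bullet> ?N) / (?N \<bullet> ?N)"
  have NN: "?N \<bullet> ?N \<noteq> 0" using N by simp
  have "cross3 ?N v = (a \<bullet> v) *\<^sub>R b - (b \<bullet> v) *\<^sub>R a"
    by (simp add: cross3_simps forall_3)
  then have "cross3 ?N v = 0" using v by (simp add: inner_commute)
  then have "(?N \<bullet> v)\<^sup>2 = (?N \<bullet> ?N) * (v \<bullet> v)"
    using norm_cross_dot[of ?N v] by (simp add: power_mult_distrib power2_norm_eq_inner)
  moreover have sq: "(v - c *\<^sub>R ?N) \<bullet> (v - c *\<^sub>R ?N) = v \<bullet> v - 2 * c * (v \<bullet> ?N) + c\<^sup>2 * (?N \<bullet> ?N)"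
    by (simp add: inner_diff_left inner_diff_right inner_commute[of ?N v] power2_eq_square algebra_simps)
  moreover have cN: "c * (?N \<bullet> ?N) = v \<bullet> ?N" using NN by (simp add: c_def)
  ultimately have "(v \<bullet> v) * (?N \<bullet> ?N) = (c * (v \<bullet> ?N)) * (?N \<bullet> ?N)"
    by (metis inner_commute mult.assoc mult.commute power2_eq_square)
  then have "v \<bullet> v = c * (v \<bullet> ?N)" using NN by simp
  then have "(v - c *\<^sub>R ?N) \<bullet> (v - c *\<^sub>R ?N) = 0"
    unfolding sq using cN by (simp add: power2_eq_square)
  then have "v - c *\<^sub>R ?N = 0" by simp
  then show ?thesis by (simp add: c_def)
qed

text \<open>The given normal may point against the cross product, but the sign
  \<open>\<sigma>\<close> relating the two is constant near \<open>u0\<close>. The curvature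
  equation is given only in its component along the cross product; it extends to the vector identity
  because the left side has no tangential part. A closed ball inside \<open>W\<close> yields finite
  area.\<close>

lemma shrinker_patch_of_param:
  fixes Y n :: "real^2 \<Rightarrow> real^3"
  assumes O: "open W" "u0 \<in> W" and Y: "Ck_on (Suc (Suc 0)) W Y" and n: "Ck_on (Suc 0) W n"
    and unit: "\<And>u. u \<in> W \<Longrightarrow> norm (n u) = 1" "\<And>u k. u \<in> W \<Longrightarrow> n u \<bullet> pd k Y u = 0"
    and N: "\<And>u. u \<in> W \<Longrightarrow> cross3 (pd 1 Y u) (pd 2 Y u) \<noteq> 0"
    and H: "\<And>u. u \<in> W \<Longrightarrow> (cross3 (pd 1 n u) (pd 2 Y u) + cross3 (pd 1 Y u) (pd 2 n u)) \<bullet> cross3 (pd 1 Y u) (pd 2 Y u)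
       = ((Y u \<bullet> n u) / 2) * (cross3 (pd 1 Y u) (pd 2 Y u) \<bullet> cross3 (pd 1 Y u) (pd 2 Y u))"
  obtains r where "r > 0" "cball u0 r \<subseteq> W" "shrinker_patch (ball u0 r) Y"
    "set_integrable lborel (ball u0 r) (\<lambda>u. norm (cross3 (pd 1 Y u) (pd 2 Y u)))"
proof -
  let ?N = "\<lambda>u. cross3 (pd 1 Y u) (pd 2 Y u)"
  have "Ck_on (Suc 0) W (pd k Y)" for k using Y by (simp add: pd_def[abs_def])
  then have cpd: "continuous_on W (pd k Y)" for k by (rule Ck_on_continuous)
  have cN: "continuous_on W ?N" by (intro continuous_intros cpd)
  have cn: "continuous_on W n" using n by (rule Ck_on_continuous)
  have par: "n u = ((n u \<bullet> ?N u) / (?N u \<bullet> ?N u)) *\<^sub>R ?N u" if "u \<in> W" for u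
    by (rule perp_cross3_parallel[OF N[OF that] unit(2)[OF that] unit(2)[OF that]])
  have nz: "n u \<bullet> ?N u \<noteq> 0" if "u \<in> W" for u
    using par[OF that] unit(1)[OF that] by auto
  define \<sigma> where "\<sigma> = sgn (n u0 \<bullet> ?N u0)"
  have \<sigma>: "\<sigma> * \<sigma> = 1" "\<bar>\<sigma>\<bar> = 1" "\<sigma> \<noteq> 0" using nz[OF O(2)] by (auto simp: \<sigma>_def sgn_if)
  define W' where "W' = W \<inter> (\<lambda>u. \<sigma> * (n u \<bullet> ?N u)) -` {0<..}"
  have "open W'" unfolding W'_def
    by (intro continuous_open_preimage O(1) continuous_intros cn cpd open_greaterThan)
  moreover have "u0 \<in> W'" using O(2) nz[OF O(2)] by (auto simp: W'_def \<sigma>_def sgn_if)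
  ultimately obtain r where r: "r > 0" "cball u0 r \<subseteq> W'" using open_contains_cball by blast
  let ?B = "ball u0 r"
  have BW: "?B \<subseteq> W" "cball u0 r \<subseteq> W" using r(2) by (auto simp: W'_def subset_iff)
  have un: "unit_normal Y u = \<sigma> *\<^sub>R n u" if u: "u \<in> ?B" for u
  proof -
    have uW: "u \<in> W" using u BW by blast
    define c where "c = (n u \<bullet> ?N u) / (?N u \<bullet> ?N u)"
    have pos: "\<sigma> * (n u \<bullet> ?N u) > 0" using u r(2) by (auto simp: W'_def subset_iff)
    have "\<sigma> * c > 0" using divide_pos_pos[OF pos, of "?N u \<bullet> ?N u"] N[OF uW] by (simp add: c_def)
    have "n u = c *\<^sub>R ?N u" unfolding c_def by (rule par[OF uW])
    from arg_cong[OF this, of "\<lambda>x. \<sigma> *\<^sub>R x"]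
    have ncN: "\<sigma> *\<^sub>R n u = (\<sigma> * c) *\<^sub>R ?N u" by simp
    have "\<sigma> *\<^sub>R n u = sgn (\<sigma> *\<^sub>R n u)"
      using unit(1)[OF uW] \<sigma>(2) by (simp add: sgn_div_norm)
    also have "\<dots> = sgn (?N u)" unfolding ncN sgn_scaleR using \<open>\<sigma> * c > 0\<close> by simp
    finally show ?thesis by (simp add: unit_normal_def)
  qed
  have "Ck_on (Suc 0) W (\<lambda>u. \<sigma>)"
    by (rule C1I[OF O(1), of _ "\<lambda>x h. 0"]) auto
  then have nB: "Ck_on (Suc 0) ?B (\<lambda>u. \<sigma> *\<^sub>R n u)"
    using Ck_on_subset[OF C1_scaleR[OF O(1) _ n] BW(1)] by blast
  then have unB: "Ck_on (Suc 0) ?B (unit_normal Y)"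
    using un by (subst Ck_on_cong[OF open_ball, of u0 r "unit_normal Y" "\<lambda>u. \<sigma> *\<^sub>R n u"]) auto
  have patch: "shrinker_patch ?B Y"
    unfolding shrinker_patch_def
  proof (intro conjI ballI)
    show "Ck_on (Suc (Suc 0)) ?B Y" by (rule Ck_on_subset[OF Y BW(1)])
    fix u assume u: "u \<in> ?B"
    then have uW: "u \<in> W" using BW by blast
    show "?N u \<noteq> 0" by (rule N[OF uW])
    have dn: "(n has_derivative frechet_derivative n (at u)) (at u)" by (rule C1D(1)[OF n O(1) uW])
    have pdn: "pd k (unit_normal Y) u = \<sigma> *\<^sub>R pd k n u" for k
    proof -
      have "((\<lambda>u. \<sigma> *\<^sub>R n u) has_derivative (\<lambda>h. \<sigma> *\<^sub>R frechet_derivative n (at u) h)) (at u)"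
        by (rule has_derivative_scaleR_right[OF dn])
      then have "frechet_derivative (\<lambda>u. \<sigma> *\<^sub>R n u) (at u) = (\<lambda>h. \<sigma> *\<^sub>R frechet_derivative n (at u) h)"
        using frechet_derivative_at[symmetric] by blast
      moreover have "frechet_derivative (unit_normal Y) (at u) = frechet_derivative (\<lambda>u. \<sigma> *\<^sub>R n u) (at u)"
        by (rule frechet_derivative_cong_open[OF open_ball u un])
      ultimately show ?thesis by (simp add: pd_def)
    qed
    \<comment> \<open>From \<open>n \<bullet> n = 1\<close>: the derivatives of the normal are
      tangential.\<close>
    have perp: "pd k n u \<bullet> n u = 0" for k
    proof -
      have "((\<lambda>u. n u \<bullet> n u) has_derivative
          (\<lambda>h. n u \<bullet> frechet_derivative n (at u) h + frechet_derivative n (at u) h \<bullet> n u)) (at u)"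
        by (rule has_derivative_inner[OF dn dn])
      moreover have "((\<lambda>u. n u \<bullet> n u) has_derivative (\<lambda>h. 0)) (at u)"
        by (rule has_derivative_transform_within_open[OF has_derivative_const O(1) uW, of 1])
          (use unit(1) in \<open>simp add: norm_eq_1\<close>)
      ultimately have "(\<lambda>h. n u \<bullet> frechet_derivative n (at u) h + frechet_derivative n (at u) h \<bullet> n u) = (\<lambda>h. 0)"
        by (rule has_derivative_unique)
      from fun_cong[OF this, of "axis k 1"] show ?thesis
        by (simp add: pd_def inner_commute)
    qed
    let ?v = "cross3 (pd 1 n u) (pd 2 Y u) + cross3 (pd 1 Y u) (pd 2 n u)"
    have v: "?v \<bullet> pd 1 Y u = 0 \<and> ?v \<bullet> pd 2 Y u = 0"
    proof -
      define c where "c = (n u \<bullet> ?N u) / (?N u \<bullet> ?N u)"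
      have "n u = c *\<^sub>R ?N u" unfolding c_def by (rule par[OF uW])
      moreover have "c \<noteq> 0" using nz[OF uW] N[OF uW] by (simp add: c_def)
      ultimately have "pd k n u \<bullet> ?N u = 0" for k using perp[of k] by simp
      moreover have "(cross3 p b + cross3 a q) \<bullet> a = - (p \<bullet> cross3 a b)"
        "(cross3 p b + cross3 a q) \<bullet> b = - (q \<bullet> cross3 a b)" for p q a b :: "real^3"
        by (simp_all add: cross3_simps)
      ultimately show ?thesis by simp
    qed
    have "?v = ((?v \<bullet> ?N u) / (?N u \<bullet> ?N u)) *\<^sub>R ?N u"
      by (rule perp_cross3_parallel[OF N[OF uW]]) (use v in auto)
    also have "(?v \<bullet> ?N u) / (?N u \<bullet> ?N u) = (Y u \<bullet> n u) / 2"
      unfolding H[OF uW] using N[OF uW] by simp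
    finally have "?v = ((Y u \<bullet> n u) / 2) *\<^sub>R ?N u" .
    from arg_cong[OF this, of "\<lambda>x. \<sigma> *\<^sub>R x"]
    have "\<sigma> *\<^sub>R ?v = (\<sigma> * ((Y u \<bullet> n u) / 2)) *\<^sub>R ?N u" by (simp only: scaleR_scaleR)
    then show "cross3 (pd 1 (unit_normal Y) u) (pd 2 Y u) + cross3 (pd 1 Y u) (pd 2 (unit_normal Y) u)
         = ((Y u \<bullet> unit_normal Y u) / 2) *\<^sub>R ?N u"
      unfolding pdn un[OF u] by (simp add: cross_mult_left cross_mult_right scaleR_add_right)
  qed (use unB in auto)
  have "integrable lborel (\<lambda>u. indicator (cball u0 r) u *\<^sub>R norm (?N u))"
    by (rule borel_integrable_compact)
      (auto intro!: continuous_on_norm continuous_on_subset[OF cN] BW)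
  then have "set_integrable lborel (cball u0 r) (\<lambda>u. norm (?N u))" by (simp add: set_integrable_def)
  then have "set_integrable lborel ?B (\<lambda>u. norm (?N u))"
    by (rule set_integrable_subset) auto
  then show ?thesis using that r(1) BW(2) patch by blast
qed

text \<open>Cross products live on \<open>real^3\<close>, while the ambient index type is only known
  to have three elements; relabelling the coordinates is an isometry.\<close>

lemma isometry_to_real3:
  assumes "CARD('m::finite) = 3"
  obtains T :: "real^'m \<Rightarrow> real^3" where "linear T" "\<And>x y. T x \<bullet> T y = x \<bullet> y"
proof -
  obtain b :: "3 \<Rightarrow> 'm" where b: "bij b"
    using finite_same_card_bij[of "UNIV :: 3 set" "UNIV :: 'm set"] assms by auto
  define T :: "real^'m \<Rightarrow> real^3" where "T x = (\<chi> k. x $ b k)" for x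
  have "linear T" by (auto simp: linear_iff T_def vec_eq_iff)
  moreover have "T x \<bullet> T y = x \<bullet> y" for x y
    using sum.reindex_bij_betw[of b UNIV UNIV "\<lambda>i. x $ i * y $ i"] b
    by (simp add: T_def inner_vec_def)
  ultimately show ?thesis using that by blast
qed

lemma cross3_ne_0:
  fixes a b :: "real^3"
  assumes "\<And>s t. s *\<^sub>R a + t *\<^sub>R b = 0 \<Longrightarrow> s = 0 \<and> t = 0"
  shows "cross3 a b \<noteq> 0"
proof
  assume N: "cross3 a b = 0"
  have "(b \<bullet> b) *\<^sub>R a + (- (a \<bullet> b)) *\<^sub>R b = cross3 b (cross3 a b)"
    by (simp add: cross3_simps forall_3)
  then have "b \<bullet> b = 0" using N assms[of "b \<bullet> b" "- (a \<bullet> b)"] by simp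
  then have "b = 0" by simp
  then show False using assms[of 0 1] by simp
qed

text \<open>The patches are charts precomposed with the relabelling \<open>S\<close> of the
  parameter plane and restricted to small open sets. Composition with \<open>T\<close> preserves all
  inner products, so the curvature equation carries over.\<close>

lemma shrinker_surface_of_atlas:
  fixes M :: "'p topology" and A :: "('n::finite, 'p) atlas" and F :: "'p \<Rightarrow> real^'m::finite"
    and T :: "real^'m \<Rightarrow> real^3"
  assumes n: "CARD('n) = 2" and M: "smooth_manifold M A"
    and imm: "smooth_immersion A F" and prp: "proper_map M euclidean F" and shr: "self_shrinker A F"
    and T: "linear T" "\<And>x y. T x \<bullet> T y = x \<bullet> y"
  obtains P where "shrinker_surface M (T \<circ> F) P"
proof -
  obtain i1 i2 :: 'n where i: "UNIV = {i1, i2}" "i1 \<noteq> i2" using n by (auto simp: card_2_iff)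
  have all: "(\<forall>i::'n. Q i) \<longleftrightarrow> Q i1 \<and> Q i2" for Q
    using i(1) by (metis UNIV_I insertE singletonD)
  define S :: "real^2 \<Rightarrow> real^'n" where "S h = h $ 1 *\<^sub>R axis i1 1 + h $ 2 *\<^sub>R axis i2 1" for h
  define R :: "real^'n \<Rightarrow> real^2" where "R w = w $ i1 *\<^sub>R axis 1 1 + w $ i2 *\<^sub>R axis 2 1" for w
  have S: "bounded_linear S" unfolding S_def
    by (intro bounded_linear_add bounded_linear_scaleR_const bounded_linear_vec_nth)
  have R: "bounded_linear R" unfolding R_def
    by (intro bounded_linear_add bounded_linear_scaleR_const bounded_linear_vec_nth)
  have RS: "R (S h) = h" for h
    using i(2) by (simp add: R_def S_def vec_eq_iff forall_2 axis_def)
  have SR: "S (R w) = w" for w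
    using i(2) unfolding vec_eq_iff all by (simp add: R_def S_def axis_def)
  have Sax: "S (axis 1 1) = axis i1 1" "S (axis 2 1) = axis i2 1" by (simp_all add: S_def axis_def)
  have injS: "inj S" using RS by (metis injI)
  have SRimg: "S ` U = R -` U" for U using RS SR by (auto simp: image_iff) (metis SR)
  have opS: "open (S ` U)" if "open U" for U
    unfolding SRimg using that R by (simp add: linear_continuous_on open_vimage)
  have Tb: "bounded_linear T" using T(1) by (simp add: linear_conv_bounded_linear)
  have Tnorm: "norm (T x) = norm x" for x by (simp add: norm_eq_sqrt_inner T(2))
  have T0: "x = 0" if "T x = 0" for x using Tnorm[of x] that by simp
  have injT: "inj T" using T0 T(1) linear_injective_0 by blast
  have atlas: "Hausdorff_space M" "second_countable M"
    "\<And>U \<phi>. (U, \<phi>) \<in> A \<Longrightarrow> open U \<and> openin M (\<phi> ` U) \<and>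
        homeomorphic_map (top_of_set U) (subtopology M (\<phi> ` U)) \<phi>"
    "(\<Union>(U, \<phi>)\<in>A. \<phi> ` U) = topspace M"
    "\<And>U \<phi> V \<psi>. (U, \<phi>) \<in> A \<Longrightarrow> (V, \<psi>) \<in> A \<Longrightarrow> smooth_on {u \<in> U. \<phi> u \<in> \<psi> ` V} (the_inv_into V \<psi> \<circ> \<phi>)"
    using M unfolding smooth_manifold_def smooth_atlas_def by auto
  have pre: "open {u \<in> U. \<phi> u \<in> W}" if "(U, \<phi>) \<in> A" "openin M W" for U \<phi> W
  proof -
    have "continuous_map (top_of_set U) M \<phi>"
      using atlas(3)[OF that(1)] homeomorphic_imp_continuous_map continuous_map_in_subtopology by blast
    then have "openin (top_of_set U) {u \<in> topspace (top_of_set U). \<phi> u \<in> W}"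
      using that(2) openin_continuous_map_preimage by blast
    then show ?thesis using atlas(3)[OF that(1)] by (simp add: openin_open_eq)
  qed
  have injA: "inj_on \<phi> U" if "(U, \<phi>) \<in> A" for U \<phi>
    using atlas(3)[OF that] by (auto simp: homeomorphic_eq_everything_map)
  have opA: "openin M (\<phi> ` V)" if "(U, \<phi>) \<in> A" "open V" "V \<subseteq> U" for U \<phi> V
  proof -
    have "openin (top_of_set U) V" using that by (simp add: open_subset)
    then have "openin (subtopology M (\<phi> ` U)) (\<phi> ` V)"
      using atlas(3)[OF that(1)] homeomorphic_imp_open_map by (auto simp: open_map_def)
    then show ?thesis using atlas(3)[OF that(1)] openin_trans_full by blast
  qed
  define P where "P = {(U, \<psi>). \<exists>U0 \<phi>. (U0, \<phi>) \<in> A \<and> \<psi> = \<phi> \<circ> S \<and> open U \<and> S ` U \<subseteq> U0 \<and>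
     shrinker_patch U ((T \<circ> F) \<circ> \<psi>) \<and>
     set_integrable lborel U (\<lambda>u. norm (cross3 (pd 1 ((T \<circ> F) \<circ> \<psi>) u) (pd 2 ((T \<circ> F) \<circ> \<psi>) u)))}"
  have "shrinker_surface M (T \<circ> F) P"
  proof
    show "Hausdorff_space M" "second_countable M" by (fact atlas)+
    have "closed_map euclidean euclidean T"
      unfolding closed_map_def using closed_injective_linear_image[OF _ T(1) injT] by auto
    then have "proper_map euclidean euclidean T"
      using injT by (intro closed_injective_imp_proper_map) auto
    then show "proper_map M euclidean (T \<circ> F)" by (rule proper_map_compose[OF prp])
  next
    fix U \<psi> assume U: "(U, \<psi>) \<in> P"
    then obtain U0 \<phi> where P: "(U0, \<phi>) \<in> A" "\<psi> = \<phi> \<circ> S" "open U" "S ` U \<subseteq> U0"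
      "shrinker_patch U ((T \<circ> F) \<circ> \<psi>)"
      "set_integrable lborel U (\<lambda>u. norm (cross3 (pd 1 ((T \<circ> F) \<circ> \<psi>) u) (pd 2 ((T \<circ> F) \<circ> \<psi>) u)))"
      unfolding P_def by blast
    show "shrinker_patch U ((T \<circ> F) \<circ> \<psi>)"
      "set_integrable lborel U (\<lambda>u. norm (cross3 (pd 1 ((T \<circ> F) \<circ> \<psi>) u) (pd 2 ((T \<circ> F) \<circ> \<psi>) u)))"
      by (fact P)+
    show "openin M (\<psi> ` U)"
      using opA[OF P(1) opS[OF P(3)] P(4)] by (simp add: P(2) image_comp)
    have "homeomorphic_map (top_of_set (S ` U)) (subtopology M (\<phi> ` S ` U)) \<phi>"
    proof -
      have "homeomorphic_map (subtopology (top_of_set U0) (S ` U)) (subtopology (subtopology M (\<phi> ` U0)) (\<phi> ` S ` U)) \<phi>"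
      proof (rule homeomorphic_map_subtopologies)
        show "homeomorphic_map (top_of_set U0) (subtopology M (\<phi> ` U0)) \<phi>"
          using atlas(3)[OF P(1)] by blast
        show "\<phi> ` (topspace (top_of_set U0) \<inter> S ` U) = topspace (subtopology M (\<phi> ` U0)) \<inter> \<phi> ` S ` U"
          using atlas(3)[OF P(1)] P(4) openin_subset[of M "\<phi> ` U0"] by auto
      qed
      moreover have "U0 \<inter> S ` U = S ` U" "\<phi> ` U0 \<inter> \<phi> ` S ` U = \<phi> ` S ` U" using P(4) by auto
      ultimately show ?thesis by (simp add: subtopology_subtopology)
    qed
    moreover have "homeomorphic_map (top_of_set U) (top_of_set (S ` U)) S"
      unfolding homeomorphic_map_maps homeomorphic_maps_def
      using RS SR S R by (intro exI[of _ R]) (auto simp: linear_continuous_on)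
    ultimately show "homeomorphic_map (top_of_set U) (subtopology M (\<psi> ` U)) \<psi>"
      unfolding P(2) image_comp[symmetric] by (rule homeomorphic_map_compose[rotated])
  next
    fix U \<psi> V \<xi> u assume U: "(U, \<psi>) \<in> P" and V: "(V, \<xi>) \<in> P" and u: "u \<in> U" "\<psi> u \<in> \<xi> ` V"
    obtain U0 \<phi> where P: "(U0, \<phi>) \<in> A" "\<psi> = \<phi> \<circ> S" "open U" "S ` U \<subseteq> U0"
      using U unfolding P_def by blast
    obtain V0 \<phi>' where P': "(V0, \<phi>') \<in> A" "\<xi> = \<phi>' \<circ> S" "open V" "S ` V \<subseteq> V0"
      using V unfolding P_def by blast
    define \<kappa> where "\<kappa> = the_inv_into V0 \<phi>' \<circ> \<phi>"
    let ?D = "{x \<in> U0. \<phi> x \<in> \<phi>' ` V0}"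
    have "open ?D" using pre[OF P(1)] atlas(3)[OF P'(1)] by blast
    moreover have "S u \<in> ?D" using u P P' by auto
    moreover have "Ck_on (Suc 0) ?D \<kappa>"
      using atlas(5)[OF P(1) P'(1)] unfolding smooth_on_def \<kappa>_def by blast
    ultimately have "(\<kappa> has_derivative frechet_derivative \<kappa> (at (S u))) (at (S u))"
      using C1D(1) by blast
    from has_derivative_linear_comp[OF S R this]
    have d: "((\<lambda>w. R (\<kappa> (S w))) has_derivative (\<lambda>h. R (frechet_derivative \<kappa> (at (S u)) (S h)))) (at u)" .
    define W where "W = U \<inter> S -` {x \<in> U0. \<phi> x \<in> \<phi>' ` (S ` V)}"
    have "open {x \<in> U0. \<phi> x \<in> \<phi>' ` (S ` V)}"
      by (rule pre[OF P(1) opA[OF P'(1) opS[OF P'(3)] P'(4)]])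
    then have "open W" unfolding W_def
      by (intro open_Int P(3) open_vimage linear_continuous_on[OF S])
    moreover have "u \<in> W" using u P P' by (auto simp: W_def image_comp)
    moreover have "R (\<kappa> (S w)) = the_inv_into V \<xi> (\<psi> w)" if w: "w \<in> W" for w
    proof -
      have "\<phi> (S w) \<in> \<phi>' ` (S ` V)" using w by (simp add: W_def)
      then obtain v where v: "v \<in> V" "\<phi> (S w) = \<phi>' (S v)" by auto
      have "inj_on \<xi> V"
        unfolding P'(2) using injS inj_on_subset[OF injA[OF P'(1)] P'(4)]
        by (intro comp_inj_on) (auto intro: inj_on_subset)
      then have "the_inv_into V \<xi> (\<psi> w) = v" using v by (simp add: P(2) P'(2) the_inv_into_f_eq)
      moreover have "\<kappa> (S w) = S v"
        using v P'(4) injA[OF P'(1)] by (auto simp: \<kappa>_def intro!: the_inv_into_f_eq)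
      ultimately show ?thesis by (simp add: RS)
    qed
    ultimately have "((\<lambda>w. the_inv_into V \<xi> (\<psi> w)) has_derivative
        (\<lambda>h. R (frechet_derivative \<kappa> (at (S u)) (S h)))) (at u)"
      by (rule has_derivative_transform_within_open[OF d])
    then show "(\<lambda>u. the_inv_into V \<xi> (\<psi> u)) differentiable (at u)"
      by (auto simp: differentiable_def)
  next
    fix p W0 assume p: "p \<in> topspace M" "openin M W0" "p \<in> W0"
    obtain U0 \<phi> u where U0: "(U0, \<phi>) \<in> A" "u \<in> U0" "p = \<phi> u"
      using p(1) atlas(4) by blast
    obtain W \<nu> where W: "open W" "u \<in> W" "W \<subseteq> U0" "unit_normal_on W (F \<circ> \<phi>) \<nu>"
      "\<And>w. w \<in> W \<Longrightarrow> mean_curvature (F \<circ> \<phi>) \<nu> w = ((F \<circ> \<phi>) w \<bullet> \<nu> w) / 2"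
      using bspec[OF bspec[OF shr[unfolded self_shrinker_def] U0(1), unfolded prod.case] U0(2)] by blast
    define X where "X = F \<circ> \<phi>"
    have sm: "smooth_on U0 X" "\<And>w. w \<in> U0 \<Longrightarrow> inj (frechet_derivative X (at w))"
      using imm U0(1) unfolding smooth_immersion_def X_def by blast+
    have \<nu>: "smooth_on W \<nu>" "\<And>w. w \<in> W \<Longrightarrow> norm (\<nu> w) = 1"
      "\<And>w v. w \<in> W \<Longrightarrow> \<nu> w \<bullet> frechet_derivative X (at w) v = 0"
      using W(4) unfolding unit_normal_on_def X_def by auto
    have XW: "Ck_on (Suc (Suc 0)) W X"
      using sm(1) W(3) unfolding smooth_on_def by (meson Ck_on_subset)
    have \<nu>W: "Ck_on (Suc 0) W \<nu>" using \<nu>(1) unfolding smooth_on_def by blast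
    define Y where "Y = (T \<circ> F) \<circ> (\<phi> \<circ> S)"
    define nn where "nn v = T (\<nu> (S v))" for v
    have Yeq: "Y = (\<lambda>v. T (X (S v)))" by (auto simp: Y_def X_def)
    \<comment> \<open>Both constraints are imposed on the parameters at once: a unit normal is
      available, and the image stays in the prescribed neighbourhood \<open>W0\<close> of
      \<open>p\<close>.\<close>
    define W' where "W' = S -` (W \<inter> {x \<in> U0. \<phi> x \<in> W0})"
    have W'o: "open W'" unfolding W'_def using pre[OF U0(1) p(2)] W(1) S
      by (intro open_vimage open_Int) (auto simp: linear_continuous_on)
    have uW': "R u \<in> W'" using W(2) U0 p(3) by (simp add: W'_def SR)
    have W'W: "S v \<in> W" if "v \<in> W'" for v using that by (simp add: W'_def)
    have sub: "W' \<subseteq> S -` W" by (auto simp: W'_def)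
    have YC: "Ck_on (Suc (Suc 0)) W' Y"
      unfolding Yeq by (rule Ck_on_subset[OF Ck_on_linear_comp[OF S Tb W(1) XW] sub])
    have nC: "Ck_on (Suc 0) W' nn"
      unfolding nn_def[abs_def] by (rule Ck_on_subset[OF Ck_on_linear_comp[OF S Tb W(1) \<nu>W] sub])
    have dX: "X differentiable (at (S v))" "\<nu> differentiable (at (S v))" if "v \<in> W'" for v
      using XW \<nu>W W'W[OF that] W(1) by (auto simp: differentiable_on_eq_differentiable_at)
    have pdY: "pd k Y v = T (frechet_derivative X (at (S v)) (S (axis k 1)))"
      "pd k nn v = T (frechet_derivative \<nu> (at (S v)) (S (axis k 1)))" if "v \<in> W'" for v k
      unfolding pd_def Yeq nn_def[abs_def]
      using frechet_derivative_linear_comp[OF S Tb] dX[OF that] by auto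
    have N: "cross3 (pd 1 Y v) (pd 2 Y v) \<noteq> 0" if v: "v \<in> W'" for v
    proof (rule cross3_ne_0)
      fix s t assume st: "s *\<^sub>R pd 1 Y v + t *\<^sub>R pd 2 Y v = 0"
      have lin: "linear (frechet_derivative X (at (S v)))"
        using dX(1)[OF v] by (simp add: linear_frechet_derivative)
      have "T (frechet_derivative X (at (S v)) (s *\<^sub>R axis i1 1 + t *\<^sub>R axis i2 1)) = 0"
        using st unfolding pdY(1)[OF v] Sax
        by (simp add: linear_add[OF lin] linear_cmul[OF lin] linear_add[OF T(1)] linear_cmul[OF T(1)])
      then have "s *\<^sub>R axis i1 1 + t *\<^sub>R axis i2 (1::real) = 0"
        using T0 sm(2)[of "S v"] W'W[OF v] W(3) lin linear_injective_0 by blast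
      then show "s = 0 \<and> t = 0"
        using i(2) by (auto simp: vec_eq_iff all axis_def)
    qed
    have H: "(cross3 (pd 1 nn v) (pd 2 Y v) + cross3 (pd 1 Y v) (pd 2 nn v)) \<bullet> cross3 (pd 1 Y v) (pd 2 Y v)
       = ((Y v \<bullet> nn v) / 2) * (cross3 (pd 1 Y v) (pd 2 Y v) \<bullet> cross3 (pd 1 Y v) (pd 2 Y v))"
      if v: "v \<in> W'" for v
    proof -
      have dots: "(cross3 p b + cross3 a q) \<bullet> cross3 a b
          = (p \<bullet> a) * (b \<bullet> b) - (p \<bullet> b) * (a \<bullet> b) + (a \<bullet> a) * (q \<bullet> b) - (a \<bullet> b) * (q \<bullet> a)"
        "cross3 a b \<bullet> cross3 a b = (a \<bullet> a) * (b \<bullet> b) - (a \<bullet> b)\<^sup>2" for p q a b :: "real^3"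
        by (simp_all add: cross3_simps power2_eq_square)
      have nz: "cross3 (pd 1 Y v) (pd 2 Y v) \<bullet> cross3 (pd 1 Y v) (pd 2 Y v) \<noteq> 0" using N[OF v] by simp
      note mc = mean_curvature_dim2[OF i nz[unfolded dots pdY[OF v] Sax T(2)], of \<nu>]
      have Hv: "mean_curvature X \<nu> (S v) = (X (S v) \<bullet> \<nu> (S v)) / 2"
        using W(5)[OF W'W[OF v]] by (simp add: X_def)
      have YN: "Y v \<bullet> nn v = X (S v) \<bullet> \<nu> (S v)" by (simp add: Yeq nn_def T(2))
      show ?thesis
        unfolding YN dots pdY[OF v] Sax T(2) using mc[unfolded Hv] by (rule sym)
    qed
    have unit: "norm (nn v) = 1" "nn v \<bullet> pd k Y v = 0" if "v \<in> W'" for v k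
      using \<nu>(2,3)[OF W'W[OF that]] by (simp_all add: nn_def Tnorm pdY[OF that] T(2))
    obtain r where r: "r > 0" "cball (R u) r \<subseteq> W'" "shrinker_patch (ball (R u) r) Y"
      "set_integrable lborel (ball (R u) r) (\<lambda>u. norm (cross3 (pd 1 Y u) (pd 2 Y u)))"
      by (rule shrinker_patch_of_param[OF W'o uW' YC nC unit N H])
    have BW: "ball (R u) r \<subseteq> W'" using r(2) ball_subset_cball by blast
    have "(ball (R u) r, \<phi> \<circ> S) \<in> P"
      unfolding P_def using U0(1) BW r(3,4) unfolding Y_def
      by (intro CollectI, unfold prod.case, intro exI[of _ U0] exI[of _ \<phi>]) (auto simp: W'_def)
    moreover have "p \<in> (\<phi> \<circ> S) ` ball (R u) r"
      using r(1) U0(3) by (intro image_eqI[of _ _ "R u"]) (auto simp: SR)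
    moreover have "(\<phi> \<circ> S) ` ball (R u) r \<subseteq> W0" using BW by (auto simp: W'_def)
    ultimately show "\<exists>(U, \<psi>)\<in>P. p \<in> \<psi> ` U \<and> \<psi> ` U \<subseteq> W0" by blast
  qed
  then show ?thesis using that by blast
qed

section \<open>The measure of the link of the cone\<close>

text \<open>Order \<open>\<rho>\<close> balls of diameter \<open>24 / \<rho>\<close> have total
  two-dimensional content of order \<open>1 / \<rho>\<close>, which tends to 0 as
  \<open>\<rho>\<close> grows.\<close>

lemma hausdorff_measure_2_eq_0:
  fixes K :: "'a::euclidean_space set"
  assumes cover: "\<And>\<rho>. \<rho> \<ge> \<rho>0 \<Longrightarrow> \<exists>Y. finite Y \<and> real (card Y) \<le> a + b * \<rho> \<and> K \<subseteq> (\<Union>y\<in>Y. cball y (12 / \<rho>))"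
  shows "hausdorff_measure 2 K = 0"
proof -
  define v where "v = unit_ball_vol (real 2)"
  have v: "v \<ge> 0" by (simp add: v_def)
  have "(INF E \<in> {E :: nat \<Rightarrow> 'a set. K \<subseteq> (\<Union>i. E i) \<and> (\<forall>i. bounded (E i) \<and> diameter (E i) \<le> \<delta>)}.
       \<Sum>i. ennreal (v * (diameter (E i) / 2) ^ 2)) \<le> 0" (is "?I \<le> 0") if \<delta>: "\<delta> > 0" for \<delta> :: real
  proof -
    have le: "?I \<le> ennreal ((a + b * \<rho>) * (v * (12 / \<rho>)\<^sup>2))" if \<rho>: "\<rho> \<ge> \<rho>0" "\<rho> > 0" "24 / \<rho> \<le> \<delta>" for \<rho>
    proof -
      obtain Y where Y: "finite Y" "real (card Y) \<le> a + b * \<rho>" "K \<subseteq> (\<Union>y\<in>Y. cball y (12 / \<rho>))"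
        using cover[OF \<rho>(1)] by blast
      obtain e where e: "bij_betw e {..<card Y} Y"
        using ex_bij_betw_nat_finite[OF Y(1)] by (auto simp: atLeast0LessThan)
      \<comment> \<open>The finite cover is padded with empty sets, of diameter 0, to the sequence
        that the definition of the measure asks for.\<close>
      define E where "E j = (if j < card Y then cball (e j) (12 / \<rho>) else {})" for j
      have d: "diameter (E j) = (if j < card Y then 24 / \<rho> else 0)" for j
        using \<rho>(2) by (simp add: E_def)
      have "K \<subseteq> (\<Union>i. E i)"
      proof
        fix x assume "x \<in> K"
        then obtain y where "y \<in> Y" "x \<in> cball y (12 / \<rho>)" using Y(3) by blast
        moreover then obtain j where "j < card Y" "y = e j" using e by (auto simp: bij_betw_def)
        ultimately show "x \<in> (\<Union>i. E i)" by (auto simp: E_def intro!: exI[of _ j])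
      qed
      moreover have "bounded (E j)" "diameter (E j) \<le> \<delta>" for j
        using \<rho> \<delta> unfolding d by (auto simp: E_def)
      ultimately have "?I \<le> (\<Sum>i. ennreal (v * (diameter (E i) / 2) ^ 2))"
        by (intro INF_lower) auto
      also have "\<dots> = (\<Sum>i<card Y. ennreal (v * (diameter (E i) / 2) ^ 2))"
        by (rule suminf_finite) (auto simp: d)
      also have "\<dots> = (\<Sum>i<card Y. ennreal (v * (12 / \<rho>)\<^sup>2))"
        by (rule sum.cong) (auto simp: d)
      also have "\<dots> = ennreal (real (card Y) * (v * (12 / \<rho>)\<^sup>2))"
        using v by (simp add: ennreal_of_nat_eq_real_of_nat ennreal_mult)
      also have "\<dots> \<le> ennreal ((a + b * \<rho>) * (v * (12 / \<rho>)\<^sup>2))"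
        using Y(2) v by (intro ennreal_leI mult_right_mono) auto
      finally show ?thesis .
    qed
    have "((\<lambda>\<rho>::real. (a + b * \<rho>) * (v * (12 / \<rho>)\<^sup>2)) \<longlongrightarrow> 0) at_top"
    proof -
      have "((\<lambda>\<rho>::real. a * v * 144 * (1 / \<rho>) * (1 / \<rho>) + b * v * 144 * (1 / \<rho>)) \<longlongrightarrow> a * v * 144 * 0 * 0 + b * v * 144 * 0) at_top"
        by (intro tendsto_intros tendsto_divide_0[OF tendsto_const] filterlim_ident filterlim_at_top_imp_at_infinity)
      moreover have "\<forall>\<^sub>F \<rho>::real in at_top. a * v * 144 * (1 / \<rho>) * (1 / \<rho>) + b * v * 144 * (1 / \<rho>) = (a + b * \<rho>) * (v * (12 / \<rho>)\<^sup>2)"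
        using eventually_gt_at_top[of 0]
        by eventually_elim (simp add: power2_eq_square field_simps)
      ultimately show ?thesis
        using tendsto_cong by force
    qed
    then have lim: "((\<lambda>\<rho>::real. ennreal ((a + b * \<rho>) * (v * (12 / \<rho>)\<^sup>2))) \<longlongrightarrow> 0) at_top"
      using tendsto_ennrealI by fastforce
    have "\<forall>\<^sub>F \<rho> in at_top. \<rho> \<ge> \<rho>0 \<and> \<rho> > 0 \<and> \<rho> \<ge> 24 / \<delta>"
      using eventually_ge_at_top[of \<rho>0] eventually_gt_at_top[of 0] eventually_ge_at_top[of "24 / \<delta>"]
      by eventually_elim auto
    then have "\<forall>\<^sub>F \<rho> in at_top. ?I \<le> ennreal ((a + b * \<rho>) * (v * (12 / \<rho>)\<^sup>2))"
    proof eventually_elim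
      case (elim \<rho>)
      then have "24 / \<rho> \<le> \<delta>" using \<delta> by (simp add: field_simps)
      then show ?case using le elim by blast
    qed
    then show "?I \<le> 0"
      by (intro tendsto_lowerbound[OF lim]) auto
  qed
  then have "hausdorff_measure 2 K \<le> 0"
    unfolding hausdorff_measure_def v_def[symmetric] by (intro SUP_least) auto
  then show ?thesis by simp
qed

text \<open>A separated set of maximal cardinality is automatically a net.\<close>

lemma separated_net:
  fixes K :: "'a::metric_space set"
  assumes bound: "\<And>Y. finite Y \<Longrightarrow> Y \<subseteq> K \<Longrightarrow> (\<And>y y'. y \<in> Y \<Longrightarrow> y' \<in> Y \<Longrightarrow> y \<noteq> y' \<Longrightarrow> dist y y' > e) \<Longrightarrow>
    real (card Y) \<le> B"
    and e: "e \<ge> 0"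
  shows "\<exists>Y. finite Y \<and> real (card Y) \<le> B \<and> K \<subseteq> (\<Union>y\<in>Y. cball y e)"
proof -
  define sep where "sep Y \<longleftrightarrow> finite Y \<and> Y \<subseteq> K \<and> (\<forall>y\<in>Y. \<forall>y'\<in>Y. y \<noteq> y' \<longrightarrow> dist y y' > e)" for Y
  have "sep {}" by (simp add: sep_def)
  moreover have cb: "card Y \<le> nat \<lfloor>B\<rfloor>" if "sep Y" for Y
    using bound[of Y] that by (simp add: sep_def le_nat_floor)
  then have "\<forall>Y. sep Y \<longrightarrow> card Y < Suc (nat \<lfloor>B\<rfloor>)" by (simp add: less_Suc_eq_le)
  ultimately obtain Y where Y: "sep Y" "\<And>Z. sep Z \<Longrightarrow> card Z \<le> card Y"
    using ex_has_greatest_nat[of sep "{}" card "Suc (nat \<lfloor>B\<rfloor>)"] by blast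
  have "x \<in> (\<Union>y\<in>Y. cball y e)" if x: "x \<in> K" for x
  proof (rule ccontr)
    assume "\<not> ?thesis"
    then have far: "\<And>y. y \<in> Y \<Longrightarrow> dist y x > e" by (auto simp: not_le)
    then have "x \<notin> Y" using e by fastforce
    have "sep (insert x Y)"
      using Y(1) x far by (auto simp: sep_def dist_commute)
    then have "card (insert x Y) \<le> card Y" by (rule Y(2))
    then show False using \<open>x \<notin> Y\<close> Y(1) by (simp add: sep_def)
  qed
  then show ?thesis using Y(1) bound[of Y] by (auto simp: sep_def)
qed

theorem theorem2:
  fixes M :: "'p topology"
    and A :: "('n::finite, 'p) atlas"
    and F :: "'p \<Rightarrow> real^'m::finite"
    and \<Sigma> :: "(real^'m) set"
  assumes dim: "CARD('m) = CARD('n) + 1"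
    and manifold: "smooth_manifold M A" "topspace M \<noteq> {}"
    and immersed: "smooth_immersion A F"
    and proper: "proper_map M euclidean F"
    and complete: "complete_immersion M F"
    and shrinker: "self_shrinker A F"
    and image: "\<Sigma> = F ` topspace M"
  shows "\<exists>K C. compact K \<and> K \<subseteq> sphere 0 1 \<and> C = cone_generated K \<and>
           locally_hausdorff_tendsto (\<lambda>l::real. (*\<^sub>R) l ` \<Sigma>) C (at_right 0) \<and>
           (CARD('n) = 2 \<longrightarrow>
             (\<exists>N. \<forall>\<^sub>F r in at_top. finite (components (sphere 0 r \<inter> \<Sigma>)) \<and>
                                 card (components (sphere 0 r \<inter> \<Sigma>)) \<le> N) \<longrightarrow>
             hausdorff_measure 2 (C \<inter> sphere 0 1) = 0)"
proof -
  interpret shrinker_set \<Sigma> "real CARD('n)"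
    unfolding image by (rule shrinker_set_image[OF dim manifold immersed proper shrinker])
  let ?K = "limit_cone \<inter> sphere 0 1"
  have "hausdorff_measure 2 ?K = 0"
    if n: "CARD('n) = 2" and N: "\<forall>\<^sub>F r in at_top. finite (components (sphere 0 r \<inter> \<Sigma>)) \<and>
                                 card (components (sphere 0 r \<inter> \<Sigma>)) \<le> N" for N
  proof -
    \<comment> \<open>The area estimates are carried out in \<open>real^3\<close>, while the cone
      and the slices stay in the given ambient space.\<close>
    obtain T :: "real^'m \<Rightarrow> real^3" where T: "linear T" "\<And>x y. T x \<bullet> T y = x \<bullet> y"
      using isometry_to_real3 dim n by auto
    have Tnorm: "norm (T x) = norm x" for x by (simp add: norm_eq_sqrt_inner T(2))
    have Tdist: "dist (T x) (T y) = dist x y" for x y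
      by (simp add: dist_norm Tnorm flip: linear_diff[OF T(1)])
    obtain P where P: "shrinker_surface M (T \<circ> F) P"
      by (rule shrinker_surface_of_atlas[OF n manifold(1) immersed proper shrinker T])
    interpret S: shrinker_surface M "T \<circ> F" P by (rule P)
    obtain c :: "nat \<Rightarrow> (real^2) set \<times> (real^2 \<Rightarrow> 'p)" where c: "range c \<subseteq> P" "(\<Union>i. S.img (c i)) = topspace M"
      by (rule S.countable_cover[OF manifold(2)]) (erule (1) that)
    interpret S: shrinker_cover M "T \<circ> F" P c
      using c by unfold_locales auto
    \<comment> \<open>Both constructions use only inner products, so the upper and the lower bound
      concern the same subset of the plane.\<close>
    have tubes: "tube_map (T y) ` tube ((T \<circ> F) ` topspace M) \<rho> (T y) = tube_map y ` tube \<Sigma> \<rho> y" for \<rho> y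
    proof -
      have "tube ((T \<circ> F) ` topspace M) \<rho> (T y) = T ` tube \<Sigma> \<rho> y"
        by (auto simp: tube_def image T(2) Tnorm)
      then show ?thesis by (simp add: image_comp tube_map_def T(2) o_def)
    qed
    obtain r0 where r0: "\<And>r. r \<ge> r0 \<Longrightarrow> finite (components (sphere 0 r \<inter> \<Sigma>)) \<and>
                                 card (components (sphere 0 r \<inter> \<Sigma>)) \<le> N"
      using N by (auto simp: eventually_at_top_linorder)
    obtain C where C: "C \<ge> 0" "\<And>\<rho> Y. \<lbrakk>\<rho> \<ge> 4; finite Y; \<And>y. y \<in> Y \<Longrightarrow> norm y = 1;
      \<And>y y'. y \<in> Y \<Longrightarrow> y' \<in> Y \<Longrightarrow> y \<noteq> y' \<Longrightarrow> dist y y' > 12 / \<rho>\<rbrakk> \<Longrightarrow>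
    (\<Sum>y\<in>Y. measure lebesgue (tube_map y ` tube ((T \<circ> F) ` topspace M) \<rho> y)) \<le> C * \<rho> ^ 3"
    proof (rule S.sum_tube_measure_le)
      fix C
      assume h: "C \<ge> 0" "\<And>\<rho> Y. \<lbrakk>\<rho> \<ge> 4; finite Y; \<And>y. y \<in> Y \<Longrightarrow> norm y = 1;
        \<And>y y'. y \<in> Y \<Longrightarrow> y' \<in> Y \<Longrightarrow> y \<noteq> y' \<Longrightarrow> dist y y' > 12 / \<rho>\<rbrakk> \<Longrightarrow>
        (\<Sum>y\<in>Y. measure lebesgue (tube_map y ` tube ((T \<circ> F) ` topspace M) \<rho> y)) \<le> C * \<rho> ^ 3"
      show thesis by (rule that[OF h(1)], rule h(2); (assumption | blast))
    qed
    \<comment> \<open>The lower bound \<open>21 \<rho>^2 (card Y - N)\<close> meets the upper bound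
      \<open>C \<rho>^3\<close>. The threshold 12 comes from
      \<open>exists_on_sphere_near_axis\<close>.\<close>
    have card: "real (card Y) \<le> real N + C / 21 * \<rho>"
      if \<rho>: "\<rho> \<ge> max r0 12" and Y: "finite Y" "Y \<subseteq> ?K"
        "\<And>y y'. y \<in> Y \<Longrightarrow> y' \<in> Y \<Longrightarrow> y \<noteq> y' \<Longrightarrow> dist y y' > 12 / \<rho>" for \<rho> Y
    proof -
      have injT: "inj_on T Y" using Tdist by (metis dist_eq_0_iff inj_onI)
      have "21 * \<rho>\<^sup>2 * (real (card Y) - real N) \<le> (\<Sum>y\<in>Y. measure lebesgue (tube_map y ` tube \<Sigma> \<rho> y))"
      proof (rule sum_measure_tubes_ge[OF closed _ _ Y(1)])
        show "\<rho> > 4" using \<rho> by simp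
        show "finite (components (sphere 0 r \<inter> \<Sigma>)) \<and> card (components (sphere 0 r \<inter> \<Sigma>)) \<le> N"
          if "\<rho> \<le> r" for r using r0[of r] \<rho> that by simp
        show "norm y = 1" if "y \<in> Y" for y using Y(2) that by auto
        show "\<exists>x\<in>\<Sigma>. norm x = r \<and> x \<bullet> y > 0 \<and> x \<bullet> x - (x \<bullet> y)\<^sup>2 \<le> 9" if y: "y \<in> Y" and r: "\<rho> \<le> r" for y r
        proof -
          have "y \<in> limit_cone" "norm y = 1" "r \<ge> 12" using Y(2) y r \<rho> by auto
          then show ?thesis using exists_on_sphere_near_axis[of y r] n by (metis of_nat_numeral)
        qed
      qed (use Y(3) in auto)
      also have "\<dots> = (\<Sum>y\<in>T ` Y. measure lebesgue (tube_map y ` tube ((T \<circ> F) ` topspace M) \<rho> y))"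
        unfolding sum.reindex[OF injT] by (simp only: o_def tubes[unfolded o_def])
      also have "\<dots> \<le> C * \<rho> ^ 3"
      proof (rule C(2))
        show "norm z = 1" if "z \<in> T ` Y" for z using that Y(2) Tnorm by auto
        show "dist z z' > 12 / \<rho>" if "z \<in> T ` Y" "z' \<in> T ` Y" "z \<noteq> z'" for z z'
        proof -
          obtain y y' where yy: "y \<in> Y" "y' \<in> Y" "z = T y" "z' = T y'" using \<open>z \<in> T ` Y\<close> \<open>z' \<in> T ` Y\<close> by blast
          then have "y \<noteq> y'" using \<open>z \<noteq> z'\<close> by blast
          then show ?thesis using Y(3)[OF yy(1,2)] yy(3,4) Tdist by simp
        qed
      qed (use Y(1) \<rho> in auto)
      finally have "\<rho>\<^sup>2 * (21 * (real (card Y) - real N)) \<le> \<rho>\<^sup>2 * (C * \<rho>)"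
        by (simp add: power2_eq_square power3_eq_cube mult_ac)
      then have "21 * (real (card Y) - real N) \<le> C * \<rho>" using \<rho> by (simp add: mult_le_cancel_left)
      then show ?thesis by simp
    qed
    show ?thesis
    proof (rule hausdorff_measure_2_eq_0[of "max r0 12" "real N" "C / 21"])
      fix \<rho> assume \<rho>: "\<rho> \<ge> max r0 12"
      show "\<exists>Y. finite Y \<and> real (card Y) \<le> real N + C / 21 * \<rho> \<and> ?K \<subseteq> (\<Union>y\<in>Y. cball y (12 / \<rho>))"
        by (rule separated_net) (use card[OF \<rho>] \<rho> in auto)
    qed
  qed
  moreover have "compact ?K"
    by (intro closed_Int_compact closed_limit_cone compact_sphere)
  moreover have "locally_hausdorff_tendsto (\<lambda>l::real. (*\<^sub>R) l ` \<Sigma>) limit_cone (at_right 0)"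
    using scaled_tendsto_limit_cone unfolding scaled_def[abs_def] .
  ultimately show ?thesis
    using limit_cone_eq by (intro exI[of _ ?K] exI[of _ limit_cone]) auto
qed

end
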